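(* \textsc{Unweighted Flexible Graph Connectivity} can be solved in $O(\ell^{8\ell}\cdot \mathrm{poly}(n))$ time, where $n=|V|$ and $\ell := 2n-4-k$ for an instance $(G=(V,S,U),k)$.
   Context: A graph $G=(V,S,U)$ is an undirected graph on vertex set $V$ whose edge set $S\cup U$ is partitioned into safe edges $S$ and unsafe edges $U$. An edge set $T\subseteq S\cup U$ is an unsafe spanning connected subgraph of $G$ if $(V,T)$ is connected and, for every unsafe edge $e\in T\cap U$, $(V,T\setminus\{e\})$ is connected. \textsc{Unweighted Flexible Graph Connectivity}: given $G=(V,S,U)$ and an integer $k$, decide whether $G$ has an unsafe spanning connected subgraph $T$ with $|T|\le k$. *)

theory Defs
  imports "HOL-Computational_Algebra.Polynomial"
begin

definition flex_graph :: "'a set \<Rightarrow> 'a set set \<Rightarrow> 'a set set \<Rightarrow> bool" where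
  "flex_graph V S U \<longleftrightarrow>
     finite V \<and> S \<union> U \<subseteq> {e. e \<subseteq> V \<and> card e = 2} \<and> S \<inter> U = {}"

definition graph_connected :: "'a set \<Rightarrow> 'a set set \<Rightarrow> bool" where
  "graph_connected V T \<longleftrightarrow> (\<forall>u\<in>V. \<forall>v\<in>V. (u, v) \<in> {(x, y). {x, y} \<in> T}\<^sup>*)"

definition unsafe_spanning_connected :: "'a set \<Rightarrow> 'a set set \<Rightarrow> 'a set set \<Rightarrow> 'a set set \<Rightarrow> bool" where
  "unsafe_spanning_connected V S U T \<longleftrightarrow>
     T \<subseteq> S \<union> U \<and> graph_connected V T \<and> (\<forall>e\<in>T \<inter> U. graph_connected V (T - {e}))"

definition UFGC :: "'a set \<Rightarrow> 'a set set \<Rightarrow> 'a set set \<Rightarrow> int \<Rightarrow> bool" where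
  "UFGC V S U k \<longleftrightarrow> (\<exists>T. unsafe_spanning_connected V S U T \<and> int (card T) \<le> k)"

text \<open>
  For \<open>k \<ge> 2n - 4\<close> the parameter is truncated to 0. As \<open>0 ^ 0 = 1\<close>, a bound
  \<open>ell ^ (8 * ell) * poly(n)\<close> then means polynomial time on these instances.
\<close>
definition ell :: "nat \<Rightarrow> int \<Rightarrow> nat" where
  "ell n k = nat (2 * int n - 4 - k)"

text \<open>
  The machine model is the RAM with the uniform cost measure: memory cells hold integers, addresses
  are computed at run time, and every memory access, addition, subtraction, comparison and Boolean
  operation costs one step. There is deliberately no unit-cost multiplication, division or bit
  operation. Control flow is structured, and memory consists of finitely many (per program) named
  arrays indexed by the integers; a scalar variable \<open>x\<close> is cell 0 of array \<open>x\<close>.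
\<close>

type_synonym store = "string \<Rightarrow> int \<Rightarrow> int"

datatype aexp =
    Const int
  | Cell string aexp
  | Add aexp aexp
  | Sub aexp aexp

datatype bexp =
    Less aexp aexp
  | Not bexp
  | And bexp bexp

datatype com =
    Skip
  | Assign string aexp aexp  \<comment> \<open>array, index, value\<close>
  | Seq com com
  | If bexp com com
  | While bexp com

fun aval :: "aexp \<Rightarrow> store \<Rightarrow> int" where
  "aval (Const c) s = c"
| "aval (Cell x a) s = s x (aval a s)"
| "aval (Add a b) s = aval a s + aval b s"
| "aval (Sub a b) s = aval a s - aval b s"

fun bval :: "bexp \<Rightarrow> store \<Rightarrow> bool" where
  "bval (Less a b) s \<longleftrightarrow> aval a s < aval b s"
| "bval (Not b) s \<longleftrightarrow> \<not> bval b s"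
| "bval (And b c) s \<longleftrightarrow> bval b s \<and> bval c s"

fun acost :: "aexp \<Rightarrow> nat" where
  "acost (Const c) = 1"
| "acost (Cell x a) = 1 + acost a"
| "acost (Add a b) = 1 + acost a + acost b"
| "acost (Sub a b) = 1 + acost a + acost b"

fun bcost :: "bexp \<Rightarrow> nat" where
  "bcost (Less a b) = 1 + acost a + acost b"
| "bcost (Not b) = 1 + bcost b"
| "bcost (And b c) = 1 + bcost b + bcost c"

definition update :: "store \<Rightarrow> string \<Rightarrow> int \<Rightarrow> int \<Rightarrow> store" where
  "update s x i v = s(x := (s x)(i := v))"

text \<open>\<open>exec c s t s'\<close>: started in store \<open>s\<close>, program \<open>c\<close> halts in store \<open>s'\<close> after exactly \<open>t\<close> steps.\<close>

inductive exec :: "com \<Rightarrow> store \<Rightarrow> nat \<Rightarrow> store \<Rightarrow> bool" where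
  Skip: "exec Skip s 1 s"
| Assign: "exec (Assign x a b) s (1 + acost a + acost b) (update s x (aval a s) (aval b s))"
| Seq: "exec c s t s' \<Longrightarrow> exec d s' t' s'' \<Longrightarrow> exec (Seq c d) s (t + t') s''"
| IfTrue: "bval b s \<Longrightarrow> exec c s t s' \<Longrightarrow> exec (If b c d) s (1 + bcost b + t) s'"
| IfFalse: "\<not> bval b s \<Longrightarrow> exec d s t s' \<Longrightarrow> exec (If b c d) s (1 + bcost b + t) s'"
| WhileFalse: "\<not> bval b s \<Longrightarrow> exec (While b c) s (1 + bcost b) s"
| WhileTrue: "bval b s \<Longrightarrow> exec c s t s' \<Longrightarrow> exec (While b c) s' t' s'' \<Longrightarrow>
    exec (While b c) s (1 + bcost b + t + t') s''"

text \<open>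
  An instance on the vertex set \<open>{..<n}\<close> is presented as the number \<open>n\<close>, the integer \<open>k\<close> and the
  row-major adjacency matrix, with entry 1 for safe edges, 2 for unsafe edges and 0 for non-edges.
  All other cells are initially 0.
\<close>
definition instance_store :: "nat \<Rightarrow> nat set set \<Rightarrow> nat set set \<Rightarrow> int \<Rightarrow> store" where
  "instance_store n S U k = (\<lambda>x i.
     if x = ''n'' \<and> i = 0 then int n
     else if x = ''k'' \<and> i = 0 then k
     else if x = ''G'' \<and> 0 \<le> i \<and> i < int n * int n then
       (let e = {nat i div n, nat i mod n} in if e \<in> S then 1 else if e \<in> U then 2 else 0)
     else 0)"

definition solves_UFGC_within :: "com \<Rightarrow> (nat \<Rightarrow> int \<Rightarrow> nat) \<Rightarrow> bool" where
  "solves_UFGC_within prog f \<longleftrightarrow>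
     (\<forall>n S U k. flex_graph {..<n} S U \<longrightarrow>
       (\<exists>t s'. exec prog (instance_store n S U k) t s' \<and> t \<le> f n k \<and>
               s' ''out'' 0 = (if UFGC {..<n} S U k then 1 else 0)))"

end

theory Submission
  imports Defs
begin

text \<open>
  Contracting a cycle of length \<open>L\<close> merges \<open>L\<close> classes with \<open>L\<close> edges and contracting a safe edge merges
  two classes with one edge, so compared with two edges per lost class these steps save \<open>L - 2\<close> and
  1 edges. A feasible instance has a solution with at most \<open>2 (n - 1) - q\<close> edges iff some sequence of
  such steps saves \<open>q = 2 n - 2 - k\<close> in total; steps of length 2 that save nothing can be avoided,
  because contracting an edge never increases the achievable saving.

  If no step is possible any more, the merged vertices form a vertex cover that contains all ends of
  safe edges and has at most three vertices per saved edge. Hence a greedy 2-approximate cover \<open>H\<close>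
  with more than \<open>6 q\<close> vertices certifies a positive answer. Otherwise every vertex outside \<open>H\<close> has
  only neighbours in \<open>H\<close>, and it suffices to consider, for every pair in \<open>H\<close>, its first \<open>128 q\<close> common
  neighbours: any other vertex can be replaced by unused ones among these. So a sequence of steps
  is described by \<open>7 q\<close> digits to base \<open>128 q\<close>, where a long last cycle is described by an initial
  segment that can be completed by some path. The program tries all digit strings.
\<close>

section \<open>Merging classes along cycles\<close>

text \<open>Two estimates shape the argument. Guessing vertices freely would need base
  \<open>n\<close>, while the time bound allows only a base linear in \<open>q\<close>; hence the
  cover \<open>H\<close> and the truncated lists of common neighbours. The other constraint is the
  exponent: at least half of the classes on a cycle contain a cover vertex and cost one digit, the
  others cost three, so a cycle of length L takes at most 2 L + 1 digits including the closing one.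
  It saves L - 2 edges, and the worst ratio is 7, attained at L = 3. The constant 128 is the least
  power of two (the machine doubles but does not multiply) above 72 = 3 * 4 * 6: all steps together
  get by with at most 4 |H| edges, a replacement needs three times as many candidates, and |H| is at
  most 6 q. The obstacle in a replacement is that the removed vertex may be adjacent to many classes
  in later steps, whereas no single substitute is. It is overcome by giving each of its neighbours a
  substitute of its own and contracting all substitutes into the cycle; the saving in the contracted
  graph carries back to the uncontracted one.\<close>

text \<open>A labelling \<open>lab\<close> stands for the partition of the vertices into its fibres.\<close>

definition adj :: "'v set set \<Rightarrow> ('v \<Rightarrow> 'l) \<Rightarrow> 'l \<Rightarrow> 'l \<Rightarrow> bool" where
  "adj E lab p r \<longleftrightarrow> (\<exists>x y. {x, y} \<in> E \<and> lab x = p \<and> lab y = r)"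

definition merge :: "('v \<Rightarrow> 'l) \<Rightarrow> 'l list \<Rightarrow> 'v \<Rightarrow> 'l" where
  "merge lab ps = (\<lambda>v. if lab v \<in> set ps then hd ps else lab v)"

text \<open>A walk of length 2 stands for the contraction of one safe edge. Two parallel unsafe
  edges also form a cycle, but one with saving 0; the condition on the closing edge excludes
  it.\<close>

definition closed_walk :: "'v set set \<Rightarrow> 'v set set \<Rightarrow> ('v \<Rightarrow> 'l) \<Rightarrow> 'l list \<Rightarrow> bool" where
  "closed_walk S E lab ps \<longleftrightarrow> distinct ps \<and> successively (adj E lab) ps \<and>
     (3 \<le> length ps \<and> adj E lab (last ps) (hd ps) \<or>
      length ps = 2 \<and> adj (E \<inter> S) lab (last ps) (hd ps))"

definition profit :: "'l list \<Rightarrow> nat" where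
  "profit ps = (if length ps = 2 then 1 else length ps - 2)"

text \<open>The inequality in \<open>gain_step\<close> makes the achievable savings downward closed,
  so a longer walk may stand in for a shorter one.\<close>

inductive gain :: "'v set set \<Rightarrow> 'v set set \<Rightarrow> ('v \<Rightarrow> 'l) \<Rightarrow> nat \<Rightarrow> bool" for S E where
  gain_0: "gain S E lab 0"
| gain_step: "closed_walk S E lab ps \<Longrightarrow> gain S E (merge lab ps) m \<Longrightarrow> k \<le> profit ps + m \<Longrightarrow>
    gain S E lab k"

lemma adjI: "{x, y} \<in> E \<Longrightarrow> adj E lab (lab x) (lab y)"
  unfolding adj_def by blast

lemma adj_sym: "adj E lab p r \<longleftrightarrow> adj E lab r p"
  unfolding adj_def by (metis insert_commute)

lemma adj_mono: "adj E lab p r \<Longrightarrow> E \<subseteq> F \<Longrightarrow> adj F lab p r"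
  unfolding adj_def by blast

lemma adj_comp: "adj E lab p r \<Longrightarrow> adj E (\<kappa> \<circ> lab) (\<kappa> p) (\<kappa> r)"
  unfolding adj_def by auto

lemma merge_eq_comp: "merge lab ps = (\<lambda>p. if p \<in> set ps then hd ps else p) \<circ> lab"
  unfolding merge_def by auto

lemma closed_walk_length: "closed_walk S E lab ps \<Longrightarrow> 2 \<le> length ps"
  unfolding closed_walk_def by auto

lemma closed_walk_ne: "closed_walk S E lab ps \<Longrightarrow> ps \<noteq> []"
  unfolding closed_walk_def by auto

lemma closed_walk_adj_last: "closed_walk S E lab ps \<Longrightarrow> adj E lab (last ps) (hd ps)"
  unfolding closed_walk_def by (auto intro: adj_mono)

lemma gain_mono: "gain S E lab m \<Longrightarrow> k \<le> m \<Longrightarrow> gain S E lab k"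
  by (induction rule: gain.induct) (auto intro: gain.intros order_trans)

lemma successively_adj_ex:
  assumes "successively P ps" "2 \<le> length ps" "p \<in> set ps"
  shows "\<exists>r. P p r \<or> P r p"
proof -
  obtain i where i: "i < length ps" "p = ps ! i"
    using assms(3) by (auto simp: in_set_conv_nth)
  then show ?thesis
    using assms(1,2) unfolding successively_conv_nth
    by (cases i; auto simp: Suc_le_eq numeral_2_eq_2)
qed

lemma closed_walk_labels:
  assumes "closed_walk S E lab ps" shows "set ps \<subseteq> lab ` \<Union>E"
proof
  fix p assume p: "p \<in> set ps"
  have "successively (adj E lab) ps" using assms unfolding closed_walk_def by auto
  then obtain r where "adj E lab p r"
    using successively_adj_ex[OF _ closed_walk_length[OF assms] p] adj_sym by metis
  then show "p \<in> lab ` \<Union>E" unfolding adj_def by auto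
qed

section \<open>Transfer of gains along maps of labels\<close>

text \<open>Walks never repeat a label, so only adjacencies between distinct labels must be
  preserved; edges inside a class may vanish. Injectivity on the labels in use admits the inverse of
  an injective labelling as \<open>\<phi>\<close>.\<close>

lemma gain_hom_on:
  assumes "gain S E lab m"
    and "inj_on \<phi> (range lab)"
    and "\<And>p r. p \<noteq> r \<Longrightarrow> adj E lab p r \<Longrightarrow> adj E' lab' (\<phi> p) (\<phi> r)"
    and "\<And>p r. p \<noteq> r \<Longrightarrow> adj (E \<inter> S) lab p r \<Longrightarrow> adj (E' \<inter> S) lab' (\<phi> p) (\<phi> r)"
  shows "gain S E' lab' m"
  using assms
proof (induction arbitrary: lab' rule: gain.induct)
  case (gain_0 lab)
  then show ?case by (simp add: gain.gain_0)
next
  case (gain_step lab ps m k)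
  have d: "distinct ps" and ne: "ps \<noteq> []" and len: "length ps \<ge> 2"
    using gain_step.hyps(1) closed_walk_ne closed_walk_length unfolding closed_walk_def by auto
  have rng: "set ps \<subseteq> range lab" using closed_walk_labels[OF gain_step.hyps(1)] by blast
  have inj: "\<phi> p = \<phi> r \<longleftrightarrow> p = r" if "p \<in> range lab" "r \<in> range lab" for p r
    using gain_step.prems(1) that by (simp add: inj_on_eq_iff)
  have lh: "last ps \<noteq> hd ps"
    using d len by (cases ps) (auto simp: Suc_le_eq)
  have succ: "successively (adj E' lab') (map \<phi> ps)"
  proof -
    have "successively (adj E lab) ps"
      using gain_step.hyps(1) unfolding closed_walk_def by auto
    then have "successively (\<lambda>p r. adj E lab p r \<and> p \<noteq> r) ps"
      using d by (simp add: successively_conv_nth distinct_conv_nth)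
    then have "successively (\<lambda>p r. adj E' lab' (\<phi> p) (\<phi> r)) ps"
      by (rule successively_mono) (use gain_step.prems in auto)
    then show ?thesis by (simp add: successively_map)
  qed
  have cw: "closed_walk S E' lab' (map \<phi> ps)"
    using gain_step.hyps(1) succ lh ne gain_step.prems
    unfolding closed_walk_def
    by (auto simp: distinct_map last_map hd_map intro: inj_on_subset[OF gain_step.prems(1) rng])
  \<comment> \<open>Labels that are distinct and adjacent after the merge come from labels that were
    distinct before, to which the hypothesis applies.\<close>
  have merge': "adj F' (merge lab' (map \<phi> ps)) (\<phi> p) (\<phi> r)"
    if pr: "p \<noteq> r" "adj F (merge lab ps) p r"
      and h: "\<And>p r. p \<noteq> r \<Longrightarrow> adj F lab p r \<Longrightarrow> adj F' lab' (\<phi> p) (\<phi> r)" for p r F F'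
  proof -
    obtain x y where xy: "{x, y} \<in> F" "merge lab ps x = p" "merge lab ps y = r"
      using pr(2) unfolding adj_def by blast
    then have "lab x \<noteq> lab y" using pr(1) unfolding merge_def by metis
    moreover have "adj F lab (lab x) (lab y)" using xy by (simp add: adjI)
    ultimately obtain x' y' where x'y': "{x', y'} \<in> F'" "lab' x' = \<phi> (lab x)" "lab' y' = \<phi> (lab y)"
      using h unfolding adj_def by metis
    have "\<phi> (lab z) \<in> \<phi> ` set ps \<longleftrightarrow> lab z \<in> set ps" for z
      using inj_on_image_mem_iff[OF gain_step.prems(1) _ rng] by blast
    then have "merge lab' (map \<phi> ps) x' = \<phi> p" "merge lab' (map \<phi> ps) y' = \<phi> r"
      using x'y' xy(2,3) ne unfolding merge_def by (auto simp: hd_map)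
    then show ?thesis using x'y'(1) unfolding adj_def by blast
  qed
  have "gain S E' (merge lab' (map \<phi> ps)) m"
  proof (rule gain_step.IH)
    have "range (merge lab ps) \<subseteq> range lab" using rng hd_in_set[OF ne] unfolding merge_def by auto
    then show "inj_on \<phi> (range (merge lab ps))" by (rule inj_on_subset[OF gain_step.prems(1)])
  qed (use gain_step.prems merge' in blast)+
  moreover have "profit (map \<phi> ps) = profit ps" by (simp add: profit_def)
  ultimately show ?case using cw gain_step.hyps(3) gain.gain_step by metis
qed

lemma gain_hom:
  assumes "gain S E lab m"
    and "inj \<phi>"
    and "\<And>p r. p \<noteq> r \<Longrightarrow> adj E lab p r \<Longrightarrow> adj E' lab' (\<phi> p) (\<phi> r)"
    and "\<And>p r. p \<noteq> r \<Longrightarrow> adj (E \<inter> S) lab p r \<Longrightarrow> adj (E' \<inter> S) lab' (\<phi> p) (\<phi> r)"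
  shows "gain S E' lab' m"
  using gain_hom_on[OF assms(1) inj_on_subset[OF assms(2) subset_UNIV] assms(3,4)] .

lemma gain_subset: "gain S E lab m \<Longrightarrow> E \<subseteq> F \<Longrightarrow> gain S F lab m"
  by (erule gain_hom[where \<phi> = id]) (auto simp: adj_def)

text \<open>The head of a walk only names the merged class; exchanging the two heads translates one
  naming into the other. This permits rotating a walk.\<close>

lemma gain_merge_cong:
  assumes "gain S E (merge lab ps) m" "set ps = set qs" "ps \<noteq> []"
  shows "gain S E (merge lab qs) m"
proof -
  define \<phi> where "\<phi> p = (if p = hd ps then hd qs else if p = hd qs then hd ps else p)" for p
  have in_set: "hd ps \<in> set ps" "hd qs \<in> set ps"
    using assms(2,3) by (cases ps; cases qs; auto)+
  have m: "merge lab qs x = \<phi> (merge lab ps x)" for x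
    using in_set assms(2) unfolding merge_def \<phi>_def by auto
  have "merge lab qs = \<phi> \<circ> merge lab ps" using m by auto
  then have h: "adj F (merge lab ps) p r \<Longrightarrow> adj F (merge lab qs) (\<phi> p) (\<phi> r)" for F p r
    by (simp only: adj_comp)
  have inj: "inj \<phi>" unfolding inj_on_def \<phi>_def by auto
  show ?thesis by (rule gain_hom[OF assms(1) inj]) (erule h)+
qed

section \<open>Contractions and the lifting of walks\<close>

lemma rtrancl_simple_path:
  assumes "(a, b) \<in> {(p, r). P p r}\<^sup>*"
  shows "\<exists>ws. ws \<noteq> [] \<and> hd ws = a \<and> last ws = b \<and> distinct ws \<and> successively P ws"
  using assms
proof (induction rule: rtrancl_induct)
  case base
  show ?case by (rule exI[of _ "[a]"]) simp
next
  case (step b c)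
  then obtain ws where ws: "ws \<noteq> []" "hd ws = a" "last ws = b" "distinct ws" "successively P ws"
    by blast
  show ?case
  proof (cases "c \<in> set ws")
    case True
    then obtain us vs where "ws = (us @ [c]) @ vs" by (metis append.assoc append_Cons append_Nil split_list)
    moreover from this have "hd (us @ [c]) = hd ws" by (cases us) auto
    ultimately have "hd (us @ [c]) = a" "distinct (us @ [c])" "successively P (us @ [c])"
      using ws by (auto simp only: successively_append_iff distinct_append)
    then show ?thesis by (intro exI[of _ "us @ [c]"]) auto
  next
    case False
    then show ?thesis using ws step(2)
      by (intro exI[of _ "ws @ [c]"]) (auto simp: successively_append_iff)
  qed
qed

lemma successively_rtrancl:
  "successively P ws \<Longrightarrow> ws \<noteq> [] \<Longrightarrow> p \<in> set ws \<Longrightarrow> (hd ws, p) \<in> {(p, r). P p r}\<^sup>*"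
proof (induction ws)
  case (Cons a ws)
  then show ?case
    by (cases ws) (auto intro: converse_rtrancl_into_rtrancl)
qed simp

lemma rtrancl_sym_adj:
  "(p, r) \<in> {(p, r). adj E lab p r}\<^sup>* \<Longrightarrow> (r, p) \<in> {(p, r). adj E lab p r}\<^sup>*"
  by (rule symD[OF sym_rtrancl]) (auto simp: sym_def adj_sym)

text \<open>The fibres of \<open>\<kappa>\<close> are connected in the quotient graph, so passing
  from \<open>lab\<close> to \<open>\<kappa> \<circ> lab\<close> is a contraction in the sense of
  graph minors, with the fibres as branch sets.\<close>

definition class_connected :: "'v set set \<Rightarrow> ('v \<Rightarrow> 'l) \<Rightarrow> ('l \<Rightarrow> 'm) \<Rightarrow> bool" where
  "class_connected E lab \<kappa> \<longleftrightarrow> (\<forall>p\<in>range lab. \<forall>r\<in>range lab. \<kappa> p = \<kappa> r \<longrightarrow>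
     (p, r) \<in> {(a, b). adj E lab a b \<and> \<kappa> a = \<kappa> b}\<^sup>*)"

lemma class_path:
  assumes "class_connected E lab \<kappa>" "\<kappa> i = p" "\<kappa> j = p" "i \<in> range lab" "j \<in> range lab"
  shows "\<exists>ws. ws \<noteq> [] \<and> hd ws = i \<and> last ws = j \<and> distinct ws \<and> successively (adj E lab) ws \<and>
    \<kappa> ` set ws = {p}"
proof -
  have "(i, j) \<in> {(a, b). adj E lab a b \<and> \<kappa> a = \<kappa> b}\<^sup>*"
    using assms unfolding class_connected_def by auto
  then obtain ws where ws: "ws \<noteq> []" "hd ws = i" "last ws = j" "distinct ws"
    "successively (\<lambda>a b. adj E lab a b \<and> \<kappa> a = \<kappa> b) ws"
    using rtrancl_simple_path[of i j "\<lambda>a b. adj E lab a b \<and> \<kappa> a = \<kappa> b"] by auto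
  have "\<kappa> q = p" if "q \<in> set ws" for q
  proof -
    have "(hd ws, q) \<in> {(a, b). adj E lab a b \<and> \<kappa> a = \<kappa> b}\<^sup>*"
      using successively_rtrancl[OF ws(5,1) that] .
    then show ?thesis using ws(2) assms(2)
      by (induction rule: rtrancl_induct) auto
  qed
  then have "\<kappa> ` set ws = {p}" using ws(1) by (auto simp: image_iff) (metis hd_in_set)
  moreover have "successively (adj E lab) ws" by (rule successively_mono[OF ws(5)]) auto
  ultimately show ?thesis using ws by blast
qed

text \<open>Each class is replaced by a simple path within its fibre. Distinct classes have disjoint
  fibres, so the pieces form a simple path. Both ends are prescribed: the induction needs the first,
  the closing edge of a cycle needs both.\<close>

lemma lift_path:
  assumes "class_connected E lab \<kappa>"
    and "successively (adj E (\<kappa> \<circ> lab)) ps" "ps \<noteq> []" "distinct ps"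
    and "\<kappa> i = hd ps" "\<kappa> j = last ps" "i \<in> range lab" "j \<in> range lab"
  shows "\<exists>ws. ws \<noteq> [] \<and> hd ws = i \<and> last ws = j \<and> distinct ws \<and> successively (adj E lab) ws \<and>
    \<kappa> ` set ws = set ps \<and> length ps \<le> length ws"
  using assms(2-)
proof (induction ps arbitrary: i)
  case (Cons p ps)
  show ?case
  proof (cases ps)
    case Nil
    then obtain ws where ws: "ws \<noteq> []" "hd ws = i" "last ws = j" "distinct ws"
        "successively (adj E lab) ws" "\<kappa> ` set ws = {p}"
      using class_path[OF assms(1), of i p j] Cons.prems by auto
    moreover have "1 \<le> length ws" using ws(1) by (simp add: Suc_le_eq)
    ultimately show ?thesis using Nil by (intro exI[of _ ws]) auto
  next
    case (Cons r rs)
    with Cons.prems(1) have "adj E (\<kappa> \<circ> lab) p r" by (simp del: comp_apply)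
    then obtain x y where xy: "{x, y} \<in> E" "\<kappa> (lab x) = p" "\<kappa> (lab y) = r"
      unfolding adj_def by auto
    obtain us where us: "us \<noteq> []" "hd us = i" "last us = lab x" "distinct us"
        "successively (adj E lab) us" "\<kappa> ` set us = {p}"
      using class_path[OF assms(1), of i p "lab x"] Cons.prems xy by auto
    have "\<exists>ws. ws \<noteq> [] \<and> hd ws = lab y \<and> last ws = j \<and> distinct ws \<and> successively (adj E lab) ws \<and>
       \<kappa> ` set ws = set ps \<and> length ps \<le> length ws"
      by (rule Cons.IH) (use Cons.prems Cons xy in auto)
    then obtain ws where ws: "ws \<noteq> []" "hd ws = lab y" "last ws = j" "distinct ws"
        "successively (adj E lab) ws" "\<kappa> ` set ws = set ps" "length ps \<le> length ws"
      by blast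
    have "z \<notin> set ws" if "z \<in> set us" for z
    proof
      assume "z \<in> set ws"
      then have "\<kappa> z \<in> set ps" using ws(6) by blast
      moreover have "\<kappa> z = p" using that us(6) by blast
      ultimately show False using Cons.prems(3) by simp
    qed
    then have "set us \<inter> set ws = {}" by blast
    moreover have "adj E lab (lab x) (lab y)" using xy(1) by (rule adjI)
    moreover have "1 \<le> length us" using us(1) by (simp add: Suc_le_eq)
    ultimately show ?thesis
      using us ws by (intro exI[of _ "us @ ws"]) (auto simp: successively_append_iff)
  qed
qed simp

text \<open>The two ends of a closing edge are taken as the ends of the lifted path. For length 2
  the safe edge itself is the lifted walk.\<close>

lemma lift_closed_walk:
  assumes cc: "class_connected E lab \<kappa>" and cw: "closed_walk S E (\<kappa> \<circ> lab) ps"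
  shows "\<exists>ws. closed_walk S E lab ws \<and> \<kappa> ` set ws = set ps \<and> profit ps \<le> profit ws"
proof -
  have ps: "distinct ps" "ps \<noteq> []" "successively (adj E (\<kappa> \<circ> lab)) ps"
    using cw closed_walk_ne unfolding closed_walk_def by auto
  show ?thesis
  proof (cases "length ps = 2")
    case True
    then obtain p r where pr: "ps = [p, r]"
      by (metis (no_types, opaque_lifting) One_nat_def Suc_1 length_0_conv length_Suc_conv)
    then have "p \<noteq> r" using ps by auto
    have "adj (E \<inter> S) (\<kappa> \<circ> lab) r p" using cw pr unfolding closed_walk_def by auto
    then obtain x y where xy: "{x, y} \<in> E \<inter> S" "\<kappa> (lab x) = r" "\<kappa> (lab y) = p"
      unfolding adj_def by auto
    have "adj (E \<inter> S) lab (lab x) (lab y)" using xy(1) by (rule adjI)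
    moreover from this have "adj E lab (lab y) (lab x)" by (subst adj_sym) (rule adj_mono, auto)
    ultimately have "closed_walk S E lab [lab y, lab x]"
      using \<open>p \<noteq> r\<close> xy unfolding closed_walk_def by auto
    then show ?thesis
      using xy pr by (intro exI[of _ "[lab y, lab x]"]) (auto simp: profit_def)
  next
    case False
    then have l3: "3 \<le> length ps" and "adj E (\<kappa> \<circ> lab) (last ps) (hd ps)"
      using cw unfolding closed_walk_def by auto
    then obtain x y where xy: "{x, y} \<in> E" "\<kappa> (lab x) = last ps" "\<kappa> (lab y) = hd ps"
      unfolding adj_def by auto
    obtain ws where ws: "ws \<noteq> []" "hd ws = lab y" "last ws = lab x" "distinct ws"
        "successively (adj E lab) ws" "\<kappa> ` set ws = set ps" "length ps \<le> length ws"
      using lift_path[OF cc ps(3,2,1) xy(3,2)] by auto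
    then have "closed_walk S E lab ws"
      using l3 xy(1) unfolding closed_walk_def by (auto intro: adjI)
    then show ?thesis using ws l3 by (intro exI[of _ ws]) (auto simp: profit_def)
  qed
qed

text \<open>Cycles of the contracted graph lift to cycles that are at least as long.\<close>

lemma gain_contract:
  assumes "gain S E lab' m" "lab' = \<kappa> \<circ> lab" "class_connected E lab \<kappa>"
  shows "gain S E lab m"
  using assms
proof (induction arbitrary: lab \<kappa> rule: gain.induct)
  case (gain_0 lab)
  then show ?case by (simp add: gain.gain_0)
next
  case (gain_step lab' ps m k)
  obtain ws where ws: "closed_walk S E lab ws" "\<kappa> ` set ws = set ps" "profit ps \<le> profit ws"
    using lift_closed_walk gain_step.hyps(1) gain_step.prems by metis
  have ne: "ws \<noteq> []" using ws(1) closed_walk_ne by blast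
  define \<mu> where "\<mu> p = (if p \<in> set ws then hd ws else p)" for p
  \<comment> \<open>The lifted walk meets exactly the fibres over \<open>ps\<close>. After both
    merges these fibres form a single one, so the merged lower graph still contracts onto the merged
    upper one.\<close>
  define \<kappa>' where "\<kappa>' p = (if \<kappa> p \<in> set ps then hd ps else \<kappa> p)" for p
  have mer: "merge lab ws = \<mu> \<circ> lab" unfolding merge_eq_comp \<mu>_def by auto
  have hdw: "\<kappa> (hd ws) \<in> set ps" using ws(2) ne by auto
  have \<kappa>'\<mu>: "\<kappa>' (\<mu> p) = \<kappa>' p" for p
    using ws(2) hdw unfolding \<kappa>'_def \<mu>_def by auto
  have 1: "merge lab' ps = \<kappa>' \<circ> merge lab ws"
    unfolding mer using \<kappa>'\<mu> by (auto simp: fun_eq_iff merge_def \<kappa>'_def gain_step.prems(1))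
  define R where "R = {(a, b). adj E (merge lab ws) a b \<and> \<kappa>' a = \<kappa>' b}"
  have sym: "(b, a) \<in> R\<^sup>*" if "(a, b) \<in> R\<^sup>*" for a b
    by (rule symD[OF sym_rtrancl that]) (auto simp: sym_def R_def adj_sym)
  have trans1: "(\<mu> a, \<mu> b) \<in> R\<^sup>*" if "(a, b) \<in> {(a, b). adj E lab a b \<and> \<kappa> a = \<kappa> b}\<^sup>*" for a b
    using that
  proof (induction rule: rtrancl_induct)
    case (step b c)
    then have "(\<mu> b, \<mu> c) \<in> R"
      unfolding R_def mer using \<kappa>'\<mu> by (auto intro: adj_comp simp: \<kappa>'_def)
    with step show ?case by auto
  qed simp
  have same: "(\<mu> a, \<mu> b) \<in> R\<^sup>*" if "\<kappa> a = \<kappa> b" "a \<in> range lab" "b \<in> range lab" for a b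
    using that gain_step.prems(2) unfolding class_connected_def by (intro trans1) auto
  have rng: "p \<in> range lab" if "p \<in> set ws" for p
  proof -
    have "successively (adj E lab) ws" "2 \<le> length ws" 
      using ws(1) closed_walk_length unfolding closed_walk_def by auto
    moreover obtain i where i: "i < length ws" "p = ws ! i"
      using \<open>p \<in> set ws\<close> by (auto simp: in_set_conv_nth)
    ultimately have "\<exists>r. adj E lab p r \<or> adj E lab r p"
      unfolding successively_conv_nth
      by (cases i; auto simp: Suc_le_eq numeral_2_eq_2)
    then show ?thesis unfolding adj_def by auto
  qed
  \<comment> \<open>Every fibre over \<open>ps\<close> contains a label of the lifted walk and is
    connected, hence is joined to the merged class.\<close>
  have to_hd: "(\<mu> a, hd ws) \<in> R\<^sup>*" if a: "\<kappa> a \<in> set ps" "a \<in> range lab" for a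
  proof -
    obtain b where "b \<in> set ws" "\<kappa> a = \<kappa> b" using a ws(2) by (metis imageE)
    then have "(\<mu> a, \<mu> b) \<in> R\<^sup>*" using same rng a by blast
    then show ?thesis using \<open>b \<in> set ws\<close> unfolding \<mu>_def by auto
  qed
  have 2: "class_connected E (merge lab ws) \<kappa>'"
    unfolding class_connected_def R_def[symmetric]
  proof (intro ballI impI)
    fix p r assume pr: "p \<in> range (merge lab ws)" "r \<in> range (merge lab ws)" "\<kappa>' p = \<kappa>' r"
    then obtain a b where ab: "p = \<mu> a" "r = \<mu> b" "a \<in> range lab" "b \<in> range lab"
      unfolding mer by auto
    have eq: "\<kappa>' a = \<kappa>' b" using pr(3) ab \<kappa>'\<mu> by auto
    have hdp: "hd ps \<in> set ps" using closed_walk_ne[OF gain_step.hyps(1)] by simp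
    show "(p, r) \<in> R\<^sup>*"
    proof (cases "\<kappa> a \<in> set ps")
      case True
      then have "\<kappa> b \<in> set ps" using eq hdp unfolding \<kappa>'_def by (auto split: if_splits)
      then show ?thesis using to_hd True ab sym by (meson rtrancl_trans)
    next
      case False
      then have "\<kappa> a = \<kappa> b" using eq hdp unfolding \<kappa>'_def by (auto split: if_splits)
      then show ?thesis using same ab by auto
    qed
  qed
  have "gain S E (merge lab ws) m" using gain_step.IH[OF 1 2] .
  then show ?case using ws gain_step.hyps(3) by (intro gain.gain_step[of S E lab ws m]) auto
qed

section \<open>Savings of a solution\<close>

definition conn :: "'v set \<Rightarrow> 'v set set \<Rightarrow> ('v \<Rightarrow> 'l) \<Rightarrow> bool" where
  "conn V T lab \<longleftrightarrow> (\<forall>p\<in>lab ` V. \<forall>r\<in>lab ` V. (p, r) \<in> {(a, b). adj T lab a b}\<^sup>*)"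

text \<open>For \<open>lab = id\<close> this is the condition on a solution. In a quotient an edge
  is still deleted as an edge of the original graph, so parallel edges between two classes protect
  each other.\<close>

definition good :: "'v set \<Rightarrow> 'v set set \<Rightarrow> 'v set set \<Rightarrow> ('v \<Rightarrow> 'l) \<Rightarrow> bool" where
  "good V U T lab \<longleftrightarrow> conn V T lab \<and> (\<forall>e\<in>T \<inter> U. conn V (T - {e}) lab)"

lemma rtrancl_adj_mono:
  "(p, r) \<in> {(a, b). adj T lab a b}\<^sup>* \<Longrightarrow> T \<subseteq> T' \<Longrightarrow> (p, r) \<in> {(a, b). adj T' lab a b}\<^sup>*"
  by (rule subsetD[OF rtrancl_mono]) (auto intro: adj_mono)

lemma conn_mono: "conn V T lab \<Longrightarrow> T \<subseteq> T' \<Longrightarrow> conn V T' lab"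
  unfolding conn_def by (meson rtrancl_adj_mono)

lemma conn_comp: 
  assumes "conn V T lab" shows "conn V T (\<kappa> \<circ> lab)"
proof -
  have "(\<kappa> a, \<kappa> b) \<in> {(a, b). adj T (\<kappa> \<circ> lab) a b}\<^sup>*" if "(a, b) \<in> {(a, b). adj T lab a b}\<^sup>*" for a b
    using that
  proof (induction rule: rtrancl_induct)
    case (step b c)
    then have "adj T (\<kappa> \<circ> lab) (\<kappa> b) (\<kappa> c)" by (blast intro: adj_comp)
    then show ?case using step.IH by (blast intro: rtrancl_into_rtrancl)
  qed simp
  then show ?thesis using assms unfolding conn_def by auto
qed

lemma good_merge: "good V U T lab \<Longrightarrow> good V U T (merge lab ps)"
  unfolding good_def merge_eq_comp by (auto intro: conn_comp)

text \<open>A path of the merged graph lifts piecewise: wherever it passes through the merged class,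
  \<open>C\<close> connects the label of arrival with the label of departure.\<close>

lemma conn_glue:
  assumes T: "conn V T (merge lab ps)" and ne: "ps \<noteq> []"
    and C: "\<And>p r. p \<in> set ps \<Longrightarrow> r \<in> set ps \<Longrightarrow> (p, r) \<in> {(a, b). adj C lab a b}\<^sup>*"
  shows "conn V (T \<union> C) lab"
proof -
  let ?R = "{(a, b). adj (T \<union> C) lab a b}"
  have same: "(lab x, lab y) \<in> ?R\<^sup>*" if "merge lab ps x = merge lab ps y" for x y
  proof (cases "lab x \<in> set ps")
    case True
    then have "lab y \<in> set ps" using that hd_in_set[OF ne] unfolding merge_def by (auto split: if_splits)
    with True show ?thesis using C rtrancl_adj_mono by (metis Un_upper2)
  next
    case False
    then have "lab y = lab x" using that hd_in_set[OF ne] unfolding merge_def by (auto split: if_splits)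
    then show ?thesis by simp
  qed
  have "(lab x, lab y) \<in> ?R\<^sup>*" 
    if "(merge lab ps x, c) \<in> {(a, b). adj T (merge lab ps) a b}\<^sup>*" "merge lab ps y = c" for x y c
    using that
  proof (induction arbitrary: y rule: rtrancl_induct)
    case base
    then show ?case using same by simp
  next
    case (step b c)
    then obtain u v where uv: "{u, v} \<in> T" "merge lab ps u = b" "merge lab ps v = c"
      unfolding adj_def by auto
    have "(lab x, lab u) \<in> ?R\<^sup>*" using step.IH uv by auto
    moreover have "(lab u, lab v) \<in> ?R" using uv(1) by (auto intro: adjI)
    moreover have "(lab v, lab y) \<in> ?R\<^sup>*" using same uv(3) step.prems by simp
    ultimately show ?case by (meson rtrancl_into_rtrancl rtrancl_trans)
  qed
  then show ?thesis using T unfolding conn_def by blast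
qed

lemma card_merge:
  assumes "finite V" "distinct ps" "ps \<noteq> []" "set ps \<subseteq> lab ` V"
  shows "card (merge lab ps ` V) + length ps = card (lab ` V) + 1"
proof -
  have img: "merge lab ps ` V = insert (hd ps) (lab ` V - set ps)"
  proof -
    obtain v where "v \<in> V" "lab v = hd ps" using assms(3,4) by (metis hd_in_set imageE subsetD)
    then have "merge lab ps v = hd ps" unfolding merge_def by auto
    then have "hd ps \<in> merge lab ps ` V" using \<open>v \<in> V\<close> by force
    then show ?thesis unfolding merge_def by auto
  qed
  have "card (merge lab ps ` V) = Suc (card (lab ` V - set ps))"
    unfolding img using assms by (subst card_insert_disjoint) auto
  also have "card (lab ` V - set ps) = card (lab ` V) - length ps"
    using assms by (simp add: card_Diff_subset distinct_card)
  finally show ?thesis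
    using assms card_mono[of "lab ` V" "set ps"] by (simp add: distinct_card)
qed

lemma successively_sub_edges:
  "successively (adj E lab) ps \<Longrightarrow>
    \<exists>P\<subseteq>E. finite P \<and> card P \<le> length ps - 1 \<and> successively (adj P lab) ps"
proof (induction ps)
  case (Cons p ps)
  show ?case
  proof (cases ps)
    case Nil
    then show ?thesis by (intro exI[of _ "{}"]) auto
  next
    case (Cons r rs)
    with Cons.prems Cons.IH obtain P where P: "P \<subseteq> E" "finite P" "card P \<le> length ps - 1"
      "successively (adj P lab) ps" by auto
    from Cons Cons.prems obtain x y where xy: "{x, y} \<in> E" "lab x = p" "lab y = r"
      unfolding adj_def by auto
    have "successively (adj (insert {x, y} P) lab) ps"
      using P(4) by (rule successively_mono) (auto intro: adj_mono)
    then have "successively (adj (insert {x, y} P) lab) (p # ps)"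
      using Cons xy by (auto intro: adjI simp: successively_Cons)
    moreover have "card (insert {x, y} P) \<le> length (p # ps) - 1"
      using P Cons card_insert_le_m1[of "length ps" P] by (simp add: card_insert_if)
    ultimately show ?thesis using P xy by (intro exI[of _ "insert {x, y} P"]) auto
  qed
qed (intro exI[of _ "{}"], auto)

section \<open>Gluing a cycle or a safe edge into a solution\<close>

text \<open>The labels are distinct, so \<open>e\<close> can serve only one step. If the first step
  is lost, \<open>e\<close> has an end in the first class, and all later steps survive.\<close>

lemma path_minus_edge:
  assumes "distinct ps" "successively (adj P lab) ps" "p \<in> set ps"
  shows "(p, hd ps) \<in> {(a, b). adj (P - {e}) lab a b}\<^sup>* \<or> (p, last ps) \<in> {(a, b). adj (P - {e}) lab a b}\<^sup>*"
  using assms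
proof (induction ps arbitrary: p)
  case (Cons q ps)
  let ?R = "{(a, b). adj (P - {e}) lab a b}"
  show ?case
  proof (cases "ps = []")
    case True
    then show ?thesis using Cons.prems by auto
  next
    case ne: False
    have IH: "p \<in> set ps \<Longrightarrow> (p, hd ps) \<in> ?R\<^sup>* \<or> (p, last ps) \<in> ?R\<^sup>*" for p
      using Cons.IH Cons.prems by (auto simp: successively_Cons)
    show ?thesis
    proof (cases "adj (P - {e}) lab q (hd ps)")
      case True
      then have "(hd ps, q) \<in> ?R" by (auto simp: adj_sym)
      then show ?thesis using IH Cons.prems(3) ne
        by (auto intro: rtrancl_into_rtrancl)
    next
      case False
      have "adj P lab q (hd ps)" using Cons.prems ne by (auto simp: successively_Cons)
      with False have e: "\<exists>x y. e = {x, y} \<and> lab x = q" unfolding adj_def by auto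
      have "adj (P - {e}) lab a b" if "adj P lab a b" "a \<in> set ps" "b \<in> set ps" for a b
        using that e Cons.prems(1) unfolding adj_def
        by (metis Diff_iff distinct.simps(2) insertCI insertE singletonD)
      then have "successively (adj (P - {e}) lab) ps"
        using Cons.prems(2) ne
        by (auto simp: successively_Cons successively_conv_nth)
      then have "(last ps, b) \<in> ?R\<^sup>*" if "b \<in> set ps" for b
      proof -
        have "(hd ps, b) \<in> ?R\<^sup>*" "(hd ps, last ps) \<in> ?R\<^sup>*"
          using that \<open>successively (adj (P - {e}) lab) ps\<close> ne
          by (auto intro!: successively_rtrancl)
        then show ?thesis using rtrancl_sym_adj rtrancl_trans by metis
      qed
      then have "(b, last ps) \<in> ?R\<^sup>*" if "b \<in> set ps" for b
        using that rtrancl_sym_adj by metis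
      then show ?thesis using Cons.prems(3) ne by auto
    qed
  qed
qed simp

text \<open>When a path edge is lost, every class still reaches one end of the path, and
  \<open>e0\<close> joins the two ends. That \<open>e0\<close> lies outside \<open>P\<close> matters
  for length 2, where it is a second edge parallel to the one in \<open>P\<close>.\<close>

lemma cycle_minus_edge:
  assumes "distinct ps" "successively (adj P lab) ps" "e0 = {x, y}" "e0 \<notin> P"
    and "lab x = last ps" "lab y = hd ps" "p \<in> set ps" "r \<in> set ps"
  shows "(p, r) \<in> {(a, b). adj (insert e0 P - {e}) lab a b}\<^sup>*"
proof -
  let ?R = "{(a, b). adj (insert e0 P - {e}) lab a b}"
  have ne: "ps \<noteq> []" using assms by auto
  have "(p, hd ps) \<in> ?R\<^sup>*" if "p \<in> set ps" for p
  proof (cases "e = e0")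
    case True
    then have "insert e0 P - {e} = P" using assms(4) by auto
    then show ?thesis
      using successively_rtrancl[OF assms(2) ne that] rtrancl_sym_adj by metis
  next
    case False
    then have "adj (insert e0 P - {e}) lab (last ps) (hd ps)"
      using assms(3,5,6) unfolding adj_def by blast
    then have "(last ps, hd ps) \<in> ?R" by auto
    moreover have "(p, hd ps) \<in> ?R\<^sup>* \<or> (p, last ps) \<in> ?R\<^sup>*"
      using path_minus_edge[OF assms(1,2) that, of e] rtrancl_adj_mono[of _ _ "P - {e}" lab "insert e0 P - {e}"]
      by blast
    ultimately show ?thesis by (meson rtrancl_into_rtrancl)
  qed
  then show ?thesis using assms(7,8) rtrancl_sym_adj rtrancl_trans by metis
qed

lemma good_glue_cycle:
  assumes T: "good V U T (merge lab ps)" "T \<subseteq> E" "finite T"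
    and ps: "distinct ps" "ps \<noteq> []" "successively (adj (E - {{x, y}}) lab) ps"
    and xy: "{x, y} \<in> E" "lab x = last ps" "lab y = hd ps"
  shows "\<exists>T'\<subseteq>E. finite T' \<and> good V U T' lab \<and> card T' \<le> card T + length ps"
proof -
  obtain P where P: "P \<subseteq> E - {{x, y}}" "finite P" "card P \<le> length ps - 1" "successively (adj P lab) ps"
    using successively_sub_edges[OF ps(3)] by blast
  define C where "C = insert {x, y} P"
  have Ce: "(p, r) \<in> {(a, b). adj (C - {e}) lab a b}\<^sup>*" if "p \<in> set ps" "r \<in> set ps" for p r e
    unfolding C_def by (rule cycle_minus_edge[OF ps(1) P(4) refl _ xy(2,3) that]) (use P in auto)
  have C: "(p, r) \<in> {(a, b). adj C lab a b}\<^sup>*" if "p \<in> set ps" "r \<in> set ps" for p r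
    using Ce[OF that] rtrancl_adj_mono by (metis Diff_subset)
  have "good V U (T \<union> C) lab"
    unfolding good_def
  proof (intro conjI ballI)
    show "conn V (T \<union> C) lab"
      using T(1) ps(2) C unfolding good_def by (auto intro: conn_glue)
    fix e assume "e \<in> (T \<union> C) \<inter> U"
    then have "conn V (T - {e}) (merge lab ps)"
      using T(1) unfolding good_def by (cases "e \<in> T") auto
    then have "conn V (T - {e} \<union> (C - {e})) lab"
      using ps(2) Ce by (rule conn_glue)
    then show "conn V (T \<union> C - {e}) lab" by (simp add: Un_Diff)
  qed
  moreover have "card (T \<union> C) \<le> card T + length ps"
  proof -
    have "card C \<le> Suc (card P)" unfolding C_def using P(2) by (simp add: card_insert_if)
    also have "\<dots> \<le> length ps" using P(3) ps(2) by (cases ps) auto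
    finally show ?thesis using card_Un_le[of T C] by linarith
  qed
  ultimately show ?thesis using T P xy(1) unfolding C_def by (intro exI[of _ "T \<union> insert {x, y} P"]) auto
qed

lemma good_glue_safe:
  assumes T: "good V U T (merge lab [lab x, lab y])" "finite T" and xy: "{x, y} \<notin> U"
  shows "good V U (insert {x, y} T) lab"
proof -
  have C: "(p, r) \<in> {(a, b). adj {{x, y}} lab a b}\<^sup>*" 
    if "p \<in> set [lab x, lab y]" "r \<in> set [lab x, lab y]" for p r
  proof -
    have "(lab x, lab y) \<in> {(a, b). adj {{x, y}} lab a b}" by (auto intro: adjI)
    moreover have "(lab y, lab x) \<in> {(a, b). adj {{x, y}} lab a b}" 
      by (auto intro: adjI simp: adj_sym[of _ _ "lab y"])
    ultimately show ?thesis using that by auto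
  qed
  show ?thesis
    unfolding good_def
  proof (intro conjI ballI)
    have "conn V (T \<union> {{x, y}}) lab"
      using T(1) C unfolding good_def by (intro conn_glue[where ps = "[lab x, lab y]"]) auto
    then show "conn V (insert {x, y} T) lab" by simp
    fix e assume e: "e \<in> insert {x, y} T \<inter> U"
    then have "conn V (T - {e}) (merge lab [lab x, lab y])"
      using T(1) xy unfolding good_def by auto
    then have "conn V (T - {e} \<union> {{x, y}}) lab"
      using C by (intro conn_glue[where ps = "[lab x, lab y]"]) auto
    moreover have "T - {e} \<union> {{x, y}} = insert {x, y} T - {e}" using e xy by auto
    ultimately show "conn V (insert {x, y} T - {e}) lab" by simp
  qed
qed

lemma conn_ex_crossing:
  assumes "conn V E lab" "finite V" "2 \<le> card (lab ` V)"
  shows "\<exists>x y. {x, y} \<in> E \<and> lab x \<noteq> lab y"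
proof (rule ccontr)
  assume "\<not> ?thesis"
  then have "{(a, b). adj E lab a b} \<subseteq> Id" unfolding adj_def by auto
  then have "{(a, b). adj E lab a b}\<^sup>* \<subseteq> Id" by (metis rtrancl_idemp rtrancl_mono rtrancl_reflcl sup.absorb2 sup_commute reflcl_trancl rtrancl_empty Un_empty_left)
  then have "p = r" if "p \<in> lab ` V" "r \<in> lab ` V" for p r
    using assms(1) that unfolding conn_def by blast
  then have "card (lab ` V) \<le> Suc 0" using assms(2) by (simp add: card_le_Suc0_iff_eq)
  with assms(3) show False by simp
qed

text \<open>The closing edge has its ends in the first and the last class, which are consecutive
  only when the length is 2.\<close>

lemma closed_walk_avoid_closing:
  assumes "distinct ps" "3 \<le> length ps" "successively (adj E lab) ps" "lab x = last ps" "lab y = hd ps"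
  shows "successively (adj (E - {{x, y}}) lab) ps"
  unfolding successively_conv_nth
proof (intro allI impI)
  fix i assume i: "Suc i < length ps"
  then obtain u v where uv: "{u, v} \<in> E" "lab u = ps ! i" "lab v = ps ! Suc i"
    using assms(3) unfolding successively_conv_nth adj_def by blast
  have "{u, v} \<noteq> {x, y}"
  proof
    assume "{u, v} = {x, y}"
    then have "lab u = lab x \<or> lab u = lab y \<and> lab v = lab x" by (auto simp: doubleton_eq_iff)
    moreover have "last ps = ps ! (length ps - 1)" "hd ps = ps ! 0"
      using assms(2) by (simp_all add: last_conv_nth hd_conv_nth flip: length_greater_0_conv)
    ultimately have "ps ! i = ps ! (length ps - 1) \<or> ps ! i = ps ! 0 \<and> ps ! Suc i = ps ! (length ps - 1)"
      using uv(2,3) assms(4,5) by simp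
    moreover have "length ps - 1 < length ps" "i \<noteq> length ps - 1" "\<not> (i = 0 \<and> Suc i = length ps - 1)"
      using assms(2) i by auto
    ultimately show False
      using nth_eq_iff_index_eq[OF assms(1), of i "length ps - 1"] nth_eq_iff_index_eq[OF assms(1), of i 0]
        nth_eq_iff_index_eq[OF assms(1), of "Suc i" "length ps - 1"] i
      by (metis Suc_lessD gr_implies_not0 length_greater_0_conv list.size(3))
  qed
  then show "adj (E - {{x, y}}) lab (ps ! i) (ps ! Suc i)"
    using uv unfolding adj_def by blast
qed

section \<open>Counting the edges between classes\<close>

text \<open>Edges inside a class are paid for already; the crossing edges are the cost that remains
  in the quotient.\<close>

definition crossing :: "'v set set \<Rightarrow> ('v \<Rightarrow> 'l) \<Rightarrow> 'v set set" where
  "crossing T lab = {e \<in> T. \<exists>x y. e = {x, y} \<and> lab x \<noteq> lab y}"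

text \<open>Different steps of a path with distinct labels join different pairs of classes and so
  use different edges.\<close>

lemma path_crossing:
  assumes "distinct ps" "successively (adj T lab) ps" "finite T"
  shows "length ps \<le> card {e \<in> crossing T lab. lab ` e \<subseteq> set ps} + 1"
  using assms(1,2)
proof (induction ps)
  case Nil
  show ?case by simp
next
  case (Cons p ps)
  let ?A = "\<lambda>ps. {e \<in> crossing T lab. lab ` e \<subseteq> set ps}"
  show ?case
  proof (cases "ps = []")
    case True
    then show ?thesis by simp
  next
    case False
    have "adj T lab p (hd ps)" "successively (adj T lab) ps"
      using Cons.prems(2) False by (simp_all add: successively_Cons)
    then obtain x y where xy: "{x, y} \<in> T" "lab x = p" "lab y = hd ps" unfolding adj_def by blast
    have hd: "hd ps \<in> set ps" and p: "p \<notin> set ps" using Cons.prems(1) False by simp_all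
    then have "lab x \<noteq> lab y" using xy by metis
    then have "{x, y} \<in> crossing T lab" using xy(1) unfolding crossing_def by blast
    then have mem: "{x, y} \<in> ?A (p # ps)" "{x, y} \<notin> ?A ps" using xy hd p by simp_all
    have sub: "?A ps \<subseteq> ?A (p # ps)" by (simp add: Collect_mono subset_insertI2)
    have fin: "finite (?A (p # ps))" using assms(3) unfolding crossing_def by simp
    define A B where "A = ?A ps" and "B = ?A (p # ps)"
    have "A \<subset> B" using mem sub unfolding A_def[symmetric] B_def[symmetric] by blast
    then have "card A < card B" using fin unfolding B_def[symmetric] by (rule psubset_card_mono[rotated])
    moreover have "length ps \<le> card A + 1"
      unfolding A_def by (rule Cons.IH) (use Cons.prems(1) \<open>successively (adj T lab) ps\<close> in simp_all)
    ultimately show ?thesis unfolding B_def by simp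
  qed
qed

lemma crossing_merge:
  assumes "finite T" "X \<subseteq> crossing T lab" "\<And>e. e \<in> X \<Longrightarrow> lab ` e \<subseteq> set ps"
  shows "card (crossing T (merge lab ps)) + card X \<le> card (crossing T lab)"
proof -
  have fin: "finite (crossing T l)" for l :: "'a \<Rightarrow> 'b" using assms(1) unfolding crossing_def by auto
  have "crossing T (merge lab ps) \<inter> X = {}"
  proof -
    have "merge lab ps x = merge lab ps y" if "{x, y} \<in> X" for x y
      using assms(3)[OF that] unfolding merge_def by simp
    then show ?thesis unfolding crossing_def by blast
  qed
  then have "card (crossing T (merge lab ps)) + card X = card (crossing T (merge lab ps) \<union> X)"
    using fin finite_subset[OF assms(2)] by (simp add: card_Un_disjoint)
  also have "\<dots> \<le> card (crossing T lab)"
  proof (rule card_mono[OF fin])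
    show "crossing T (merge lab ps) \<union> X \<subseteq> crossing T lab"
    proof
      fix e assume "e \<in> crossing T (merge lab ps) \<union> X"
      moreover have "merge lab ps x = merge lab ps y" if "lab x = lab y" for x y
        using that unfolding merge_def by simp
      ultimately show "e \<in> crossing T lab" using assms(2) unfolding crossing_def by blast
    qed
  qed
  finally show ?thesis .
qed

lemma good_id_iff: 
  assumes "T \<subseteq> S \<union> U"
  shows "good V U T id \<longleftrightarrow> unsafe_spanning_connected V S U T"
  using assms unfolding good_def unsafe_spanning_connected_def conn_def graph_connected_def adj_def by simp

section \<open>Solutions and gains\<close>

locale flex =
  fixes V :: "'v set" and S U :: "'v set set"
  assumes flex: "flex_graph V S U"
begin

lemma fin: "finite V" and disj: "S \<inter> U = {}"
  using flex unfolding flex_graph_def by auto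

lemma edgeD:
  assumes "{x, y} \<in> S \<union> U" shows "x \<in> V \<and> y \<in> V \<and> x \<noteq> y"
proof -
  have "{x, y} \<subseteq> V" "card {x, y} = 2" using flex assms unfolding flex_graph_def by auto
  then show ?thesis by (auto simp: card_insert_if split: if_splits)
qed

lemma edge_ex: "e \<in> S \<union> U \<Longrightarrow> \<exists>x y. e = {x, y} \<and> x \<in> V \<and> y \<in> V \<and> x \<noteq> y"
proof -
  assume "e \<in> S \<union> U"
  then have "e \<subseteq> V" "card e = 2" using flex unfolding flex_graph_def by auto
  then show ?thesis by (auto simp: card_2_iff)
qed

lemma finE: "finite (S \<union> U)"
proof -
  have "S \<union> U \<subseteq> Pow V" using flex unfolding flex_graph_def by auto
  then show ?thesis using fin finite_subset by auto
qed

lemma Union_edges: "\<Union>(S \<union> U) \<subseteq> V"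
  using flex unfolding flex_graph_def by auto

lemma closed_walk_V: "closed_walk S E lab ps \<Longrightarrow> E \<subseteq> S \<union> U \<Longrightarrow> set ps \<subseteq> lab ` V"
  using closed_walk_labels Union_edges by (metis Sup_subset_mono image_mono subset_trans)

lemma card_merge_closed_walk:
  assumes "closed_walk S E lab ps" "E \<subseteq> S \<union> U"
  shows "card (merge lab ps ` V) + length ps = card (lab ` V) + 1"
  using card_merge[OF fin _ closed_walk_ne[OF assms(1)] closed_walk_V[OF assms]] assms(1)
  unfolding closed_walk_def by auto

text \<open>Deleting an unsafe edge preserves connectedness, so an unsafe crossing edge lies on a
  cycle of the quotient.\<close>

lemma good_crossing_path:
  assumes "good V U E lab" "{x, y} \<in> E \<inter> U" "{x, y} \<in> S \<union> U" "lab x \<noteq> lab y"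
  shows "\<exists>ws. distinct ws \<and> hd ws = lab y \<and> last ws = lab x \<and> 2 \<le> length ws \<and>
    successively (adj (E - {{x, y}}) lab) ws"
proof -
  have "conn V (E - {{x, y}}) lab" using assms unfolding good_def by auto
  then have "(lab y, lab x) \<in> {(a, b). adj (E - {{x, y}}) lab a b}\<^sup>*"
    using edgeD[OF assms(3)] unfolding conn_def by auto
  then obtain ws where ws: "ws \<noteq> []" "hd ws = lab y" "last ws = lab x" "distinct ws"
    "successively (adj (E - {{x, y}}) lab) ws"
    using rtrancl_simple_path[of _ _ "adj (E - {{x, y}}) lab"] by blast
  moreover have "2 \<le> length ws"
    using ws(1-3) assms(4) by (cases ws; cases "tl ws") auto
  ultimately show ?thesis by blast
qed

text \<open>The bound without any saving: a safe edge loses one class for one edge, a cycle of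
  length L loses L - 1 classes for L edges, and L is at most 2 (L - 1).\<close>

lemma good_small_subgraph:
  assumes "good V U (S \<union> U) lab" "V \<noteq> {}"
  shows "\<exists>T\<subseteq>S \<union> U. finite T \<and> good V U T lab \<and> card T + 2 \<le> 2 * card (lab ` V)"
  using assms(1)
proof (induction "card (lab ` V)" arbitrary: lab rule: less_induct)
  case less
  show ?case
  proof (cases "2 \<le> card (lab ` V)")
    case False
    moreover have "card (lab ` V) \<noteq> 0" using fin assms(2) by simp
    ultimately have c1: "card (lab ` V) = 1" by simp
    then obtain p where "lab ` V = {p}" by (auto simp: card_1_singleton_iff)
    then have "good V U {} lab" unfolding good_def conn_def by auto
    then show ?thesis using c1 by (intro exI[of _ "{}"]) auto
  next
    case True
    then obtain x y where xy: "{x, y} \<in> S \<union> U" "lab x \<noteq> lab y"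
      using conn_ex_crossing fin less.prems unfolding good_def by blast
    show ?thesis
    proof (cases "{x, y} \<in> U")
      case False
      let ?ps = "[lab x, lab y]"
      have c: "card (merge lab ?ps ` V) + 2 = card (lab ` V) + 1"
        using card_merge[OF fin, of ?ps lab] xy edgeD[OF xy(1)] by auto
      then have "card (merge lab ?ps ` V) < card (lab ` V)" by linarith
      then have "\<exists>T\<subseteq>S \<union> U. finite T \<and> good V U T (merge lab ?ps) \<and> card T + 2 \<le> 2 * card (merge lab ?ps ` V)"
        by (rule less.hyps[OF _ good_merge[OF less.prems]])
      then obtain T where T: "T \<subseteq> S \<union> U" "finite T" "good V U T (merge lab ?ps)" 
          "card T + 2 \<le> 2 * card (merge lab ?ps ` V)"
        by (elim exE conjE)
      have "good V U (insert {x, y} T) lab" using good_glue_safe[OF T(3,2) False] .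
      moreover have "card (insert {x, y} T) + 2 \<le> 2 * card (lab ` V)"
        using T(2,4) c by (simp add: card_insert_if)
      ultimately show ?thesis using T xy(1) by (intro exI[of _ "insert {x, y} T"]) auto
    next
      case True
      then obtain ws where ws: "distinct ws" "hd ws = lab y" "last ws = lab x" "2 \<le> length ws"
        "successively (adj (S \<union> U - {{x, y}}) lab) ws"
        using good_crossing_path[OF less.prems _ xy(1,2)] xy(1) by blast
      have ne: "ws \<noteq> []" using ws by auto
      have "set ws \<subseteq> lab ` V"
      proof
        fix p assume "p \<in> set ws"
        then obtain r where "adj (S \<union> U - {{x, y}}) lab p r"
          using successively_adj_ex[OF ws(5,4)] adj_sym by metis
        then show "p \<in> lab ` V" using edgeD unfolding adj_def by blast
      qed
      then have c: "card (merge lab ws ` V) + length ws = card (lab ` V) + 1"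
        using card_merge[OF fin ws(1) ne] by blast
      then have "card (merge lab ws ` V) < card (lab ` V)" using ws(4) by linarith
      then have "\<exists>T\<subseteq>S \<union> U. finite T \<and> good V U T (merge lab ws) \<and> card T + 2 \<le> 2 * card (merge lab ws ` V)"
        by (rule less.hyps[OF _ good_merge[OF less.prems]])
      then obtain T where T: "T \<subseteq> S \<union> U" "finite T" "good V U T (merge lab ws)" 
          "card T + 2 \<le> 2 * card (merge lab ws ` V)"
        by (elim exE conjE)
      obtain T' where "T'\<subseteq>S \<union> U" "finite T'" "good V U T' lab" "card T' \<le> card T + length ws"
        using good_glue_cycle[OF T(3,1,2) ws(1) ne ws(5) xy(1)] ws(2,3) by metis
      then show ?thesis using T c ws(4) by (intro exI[of _ T']) auto
    qed
  qed
qed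

text \<open>The steps are undone from the last to the first. The labelling after the last step is
  completed by \<open>good_small_subgraph\<close>, and every step undone adds its edges.\<close>

lemma gain_sound:
  assumes "gain S (S \<union> U) lab m" "good V U (S \<union> U) lab" "V \<noteq> {}"
  shows "\<exists>T\<subseteq>S \<union> U. finite T \<and> good V U T lab \<and> card T + m + 2 \<le> 2 * card (lab ` V)"
  using assms
proof (induction rule: gain.induct)
  case (gain_0 lab)
  then show ?case using good_small_subgraph by auto
next
  case (gain_step lab ps m k)
  have c: "card (merge lab ps ` V) + length ps = card (lab ` V) + 1"
    using card_merge_closed_walk[OF gain_step.hyps(1)] by blast
  obtain T where T: "T \<subseteq> S \<union> U" "finite T" "good V U T (merge lab ps)" 
      "card T + m + 2 \<le> 2 * card (merge lab ps ` V)"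
    using gain_step.IH gain_step.prems good_merge by metis
  have ps: "distinct ps" "ps \<noteq> []" "successively (adj (S \<union> U) lab) ps"
    using gain_step.hyps(1) closed_walk_ne unfolding closed_walk_def by auto
  show ?case
  proof (cases "length ps = 2")
    case True
    then obtain p r where pr: "ps = [p, r]"
      by (metis (no_types, opaque_lifting) One_nat_def Suc_1 length_0_conv length_Suc_conv)
    then have "adj S lab r p" using gain_step.hyps(1) 
      unfolding closed_walk_def by (auto intro: adj_mono)
    then have "adj S lab p r" by (subst adj_sym)
    then obtain x y where xy: "{x, y} \<in> S" "lab x = p" "lab y = r" unfolding adj_def by blast
    have "good V U (insert {x, y} T) lab"
      by (rule good_glue_safe) (use T xy pr disj in auto)
    moreover have "card (insert {x, y} T) + k + 2 \<le> 2 * card (lab ` V)"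
      using T(2,4) c gain_step.hyps(3) True by (auto simp: card_insert_if profit_def)
    ultimately show ?thesis using T xy(1) by (intro exI[of _ "insert {x, y} T"]) auto
  next
    case False
    then have l: "3 \<le> length ps" using gain_step.hyps(1) unfolding closed_walk_def by auto
    obtain x y where xy: "{x, y} \<in> S \<union> U" "lab x = last ps" "lab y = hd ps"
      using closed_walk_adj_last[OF gain_step.hyps(1)] unfolding adj_def by blast
    have "successively (adj (S \<union> U - {{x, y}}) lab) ps"
      by (rule closed_walk_avoid_closing[OF ps(1) l ps(3) xy(2,3)])
    then obtain T' where "T'\<subseteq>S \<union> U" "finite T'" "good V U T' lab" "card T' \<le> card T + length ps"
      using good_glue_cycle[OF T(3,1,2) ps(1,2) _ xy] by metis
    then show ?thesis using T c l gain_step.hyps(3) by (intro exI[of _ T']) (auto simp: profit_def)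
  qed
qed

text \<open>The solution \<open>T\<close> itself dictates the steps: each of its crossing edges is
  safe or lies on a cycle of \<open>T\<close>. A cycle of length L removes L - 1 classes and at
  least L crossing edges.\<close>

lemma gain_complete:
  assumes "good V U T lab" "T \<subseteq> S \<union> U" "V \<noteq> {}"
  shows "\<exists>m. gain S T lab m \<and> 2 * card (lab ` V) \<le> m + card (crossing T lab) + 2"
  using assms(1)
proof (induction "card (lab ` V)" arbitrary: lab rule: less_induct)
  case less
  have finT: "finite T" using finE assms(2) finite_subset by blast
  show ?case
  proof (cases "2 \<le> card (lab ` V)")
    case False
    then show ?thesis by (intro exI[of _ 0]) (auto intro: gain.gain_0)
  next
    case True
    then obtain x y where xy: "{x, y} \<in> T" "lab x \<noteq> lab y"
      using conn_ex_crossing fin less.prems unfolding good_def by blast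
    have xyE: "{x, y} \<in> S \<union> U" using xy assms(2) by auto
    have xyc: "{x, y} \<in> crossing T lab" using xy unfolding crossing_def by auto
    show ?thesis
    proof (cases "{x, y} \<in> U")
      case False
      let ?ps = "[lab y, lab x]"
      have c: "card (merge lab ?ps ` V) + 2 = card (lab ` V) + 1"
        using card_merge[OF fin, of ?ps lab] xy edgeD[OF xyE] by auto
      then have "card (merge lab ?ps ` V) < card (lab ` V)" by linarith
      then have "\<exists>m. gain S T (merge lab ?ps) m \<and>
          2 * card (merge lab ?ps ` V) \<le> m + card (crossing T (merge lab ?ps)) + 2"
        by (rule less.hyps[OF _ good_merge[OF less.prems]])
      then obtain m where m: "gain S T (merge lab ?ps) m" 
        "2 * card (merge lab ?ps ` V) \<le> m + card (crossing T (merge lab ?ps)) + 2"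
        by (elim exE conjE)
      have "{x, y} \<in> T \<inter> S" using False xy xyE by auto
      then have "adj (T \<inter> S) lab (lab x) (lab y)" by (rule adjI)
      moreover from this have "adj T lab (lab y) (lab x)" by (subst adj_sym) (rule adj_mono, auto)
      ultimately have "closed_walk S T lab ?ps" using xy(2) unfolding closed_walk_def by auto
      then have "gain S T lab (m + 1)"
        using m(1) by (rule gain.gain_step) (simp add: profit_def)
      moreover have "card (crossing T (merge lab ?ps)) + card {{x, y}} \<le> card (crossing T lab)"
        by (rule crossing_merge[OF finT]) (use xyc in auto)
      ultimately show ?thesis using m(2) c by (intro exI[of _ "m + 1"]) auto
    next
      case True
      then obtain ws where ws: "distinct ws" "hd ws = lab y" "last ws = lab x" "2 \<le> length ws"
        "successively (adj (T - {{x, y}}) lab) ws"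
        using good_crossing_path[OF less.prems _ xyE xy(2)] xy(1) by blast
      have ne: "ws \<noteq> []" using ws by auto
      have adjT: "successively (adj T lab) ws"
        by (rule successively_mono[OF ws(5)]) (auto intro: adj_mono)
      have "set ws \<subseteq> lab ` V"
      proof
        fix p assume "p \<in> set ws"
        then obtain r where "adj T lab p r"
          using successively_adj_ex[OF adjT ws(4)] adj_sym by metis
        then show "p \<in> lab ` V" using edgeD assms(2) unfolding adj_def by blast
      qed
      then have c: "card (merge lab ws ` V) + length ws = card (lab ` V) + 1"
        using card_merge[OF fin ws(1) ne] by blast
      then have "card (merge lab ws ` V) < card (lab ` V)" using ws(4) by linarith
      then have "\<exists>m. gain S T (merge lab ws) m \<and>
          2 * card (merge lab ws ` V) \<le> m + card (crossing T (merge lab ws)) + 2"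
        by (rule less.hyps[OF _ good_merge[OF less.prems]])
      then obtain m where m: "gain S T (merge lab ws) m" 
        "2 * card (merge lab ws ` V) \<le> m + card (crossing T (merge lab ws)) + 2"
        by (elim exE conjE)
      define X where "X = {e \<in> crossing (T - {{x, y}}) lab. lab ` e \<subseteq> set ws}"
      have X: "length ws \<le> card X + 1"
        unfolding X_def by (rule path_crossing[OF ws(1,5)]) (use finT in auto)
      have "card (crossing T (merge lab ws)) + card (insert {x, y} X) \<le> card (crossing T lab)"
      proof (rule crossing_merge[OF finT])
        show "insert {x, y} X \<subseteq> crossing T lab"
          using xyc unfolding X_def crossing_def by auto
        show "lab ` e \<subseteq> set ws" if "e \<in> insert {x, y} X" for e
          using that ws(2,3) ne unfolding X_def by (auto simp flip: ws(2,3))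
      qed
      moreover have "card (insert {x, y} X) = Suc (card X)"
        using finT unfolding X_def crossing_def by (subst card_insert_disjoint) auto
      ultimately have cr: "card (crossing T (merge lab ws)) + length ws \<le> card (crossing T lab)"
        using X by simp
      show ?thesis
      proof (cases "length ws = 2")
        case True
        \<comment> \<open>A pair of parallel edges is not an admissible step and would save nothing.
          Merging two adjacent classes is a contraction, so the gain after the merge is available
          before it.\<close>
        have "class_connected T lab (\<lambda>p. if p \<in> set ws then hd ws else p)"
        proof -
          obtain p r where pr: "ws = [p, r]" using True
            by (metis (no_types, opaque_lifting) One_nat_def Suc_1 length_0_conv length_Suc_conv)
          then have "adj T lab p r" using adjT by simp
          moreover from this have "adj T lab r p" by (subst adj_sym)
          ultimately show ?thesis
            unfolding class_connected_def pr by (auto intro!: r_into_rtrancl)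
        qed
        then have "gain S T lab m"
          using gain_contract[OF m(1) merge_eq_comp] by blast
        then show ?thesis using m(2) c cr True by (intro exI[of _ m]) auto
      next
        case False
        then have "closed_walk S T lab ws"
          using ws adjT xy(1) unfolding closed_walk_def by (auto intro: adjI)
        then have "gain S T lab (profit ws + m)" using m(1) by (rule gain.gain_step) simp
        then show ?thesis using m(2) c cr False ws(4)
          by (intro exI[of _ "profit ws + m"]) (auto simp: profit_def)
      qed
    qed
  qed
qed

text \<open>A feasible instance always has a solution with \<open>2 * (card V - 1)\<close> edges,
  and the budget \<open>k\<close> asks to save the difference. Truncation by \<open>nat\<close>
  covers budgets beyond that; otherwise the demand is \<open>2 * n - 2 - k\<close>, two more than
  \<open>2 * n - 4 - k\<close>.\<close>

theorem UFGC_iff_gain: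
  assumes "V \<noteq> {}"
  shows "UFGC V S U k \<longleftrightarrow> good V U (S \<union> U) id \<and> gain S (S \<union> U) id (nat (2 * int (card V) - 2 - k))"
proof
  assume "UFGC V S U k"
  then obtain T where T: "unsafe_spanning_connected V S U T" "int (card T) \<le> k"
    unfolding UFGC_def by blast
  then have TE: "T \<subseteq> S \<union> U" and finT: "finite T" unfolding unsafe_spanning_connected_def
    using finE finite_subset by auto
  then have g: "good V U T id" using T good_id_iff by blast
  obtain m where m: "gain S T id m" "2 * card V \<le> m + card (crossing T id) + 2"
    using gain_complete[OF g TE assms] by auto
  have "card (crossing T id) \<le> card T"
    using finT by (intro card_mono) (auto simp: crossing_def)
  then have "gain S (S \<union> U) id (nat (2 * int (card V) - 2 - k))"
    using gain_mono[OF gain_subset[OF m(1) TE]] m(2) T(2) by auto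
  moreover have "good V U (S \<union> U) id"
    unfolding good_def
  proof (intro conjI ballI)
    show "conn V (S \<union> U) id" using g TE conn_mono unfolding good_def by blast
    fix e assume "e \<in> (S \<union> U) \<inter> U"
    then have "conn V (T - {e}) id" using g unfolding good_def by (cases "e \<in> T") auto
    then show "conn V (S \<union> U - {e}) id" by (rule conn_mono) (use TE in auto)
  qed
  ultimately show "good V U (S \<union> U) id \<and> gain S (S \<union> U) id (nat (2 * int (card V) - 2 - k))" by blast
next
  assume a: "good V U (S \<union> U) id \<and> gain S (S \<union> U) id (nat (2 * int (card V) - 2 - k))"
  then obtain T where T: "T \<subseteq> S \<union> U" "good V U T id" 
      "card T + nat (2 * int (card V) - 2 - k) + 2 \<le> 2 * card V"
    using gain_sound[of id] assms by auto
  then have "unsafe_spanning_connected V S U T" using good_id_iff by blast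
  moreover have "int (card T) \<le> k" using T(3) by linarith
  ultimately show "UFGC V S U k" unfolding UFGC_def by blast
qed

end

section \<open>A small vertex cover and vertex substitution\<close>

definition nontrivial :: "'v set \<Rightarrow> ('v \<Rightarrow> 'l) \<Rightarrow> 'v set" where
  "nontrivial V lab = {v \<in> V. \<exists>w\<in>V. w \<noteq> v \<and> lab w = lab v}"

text \<open>Each label of the walk contributes at most one new vertex, because two vertices with
  equal labels were nontrivial before.\<close>

lemma nontrivial_merge:
  assumes "finite V"
  shows "card (nontrivial V (merge lab ps)) \<le> card (nontrivial V lab) + length ps"
proof -
  define Y where "Y = {v \<in> V. lab v \<in> set ps \<and> v \<notin> nontrivial V lab}"
  have "nontrivial V (merge lab ps) \<subseteq> nontrivial V lab \<union> Y"
  proof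
    fix v assume "v \<in> nontrivial V (merge lab ps)"
    then obtain w where w: "v \<in> V" "w \<in> V" "w \<noteq> v" "merge lab ps w = merge lab ps v"
      unfolding nontrivial_def by blast
    show "v \<in> nontrivial V lab \<union> Y"
    proof (cases "lab v \<in> set ps")
      case True
      then show ?thesis using w(1) unfolding Y_def by simp
    next
      case False
      then have "merge lab ps v = lab v" unfolding merge_def by simp
      moreover have "merge lab ps w = lab w \<or> merge lab ps w \<in> set ps"
        unfolding merge_def by (auto split: if_splits) (metis hd_in_set list.set(1) empty_iff)
      ultimately have "lab w = lab v" using w(4) False by metis
      then show ?thesis using w unfolding nontrivial_def by blast
    qed
  qed
  moreover have "finite Y" "finite (nontrivial V lab)"
    using assms unfolding Y_def nontrivial_def by simp_all
  ultimately have "card (nontrivial V (merge lab ps)) \<le> card (nontrivial V lab) + card Y"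
    by (meson card_Un_le card_mono finite_UnI order_trans)
  moreover have "card Y \<le> card (set ps)"
  proof (rule card_inj_on_le)
    show "inj_on lab Y" unfolding inj_on_def Y_def nontrivial_def by blast
    show "lab ` Y \<subseteq> set ps" unfolding Y_def by blast
  qed simp
  ultimately show ?thesis using card_length[of ps] by linarith
qed

context flex
begin

text \<open>Steps are made greedily until none is left, and \<open>s\<close> is what they save. The
  factor 3 stems from triangles, which merge three classes for a saving of 1; all other steps have a
  better ratio.\<close>

lemma stuck_ex:
  fixes lab :: "'v \<Rightarrow> 'l"
  assumes "good V U (S \<union> U) lab"
  shows "\<exists>(lab' :: 'v \<Rightarrow> 'l) s. (\<forall>m. gain S (S \<union> U) lab' m \<longrightarrow> gain S (S \<union> U) lab (s + m)) \<and>
    (\<forall>ps. \<not> closed_walk S (S \<union> U) lab' ps) \<and> good V U (S \<union> U) lab' \<and>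
    card (nontrivial V lab') \<le> card (nontrivial V lab) + 3 * s"
  using assms
proof (induction "card (lab ` V)" arbitrary: lab rule: less_induct)
  case less
  show ?case
  proof (cases "\<forall>ps. \<not> closed_walk S (S \<union> U) lab ps")
    case True
    then show ?thesis using less.prems by (intro exI[of _ lab] exI[of _ 0]) simp
  next
    case False
    then obtain ps where ps: "closed_walk S (S \<union> U) lab ps" by blast
    then have len: "card (merge lab ps ` V) + length ps = card (lab ` V) + 1" "2 \<le> length ps"
      using card_merge_closed_walk closed_walk_length by blast+
    then have "card (merge lab ps ` V) < card (lab ` V)" by linarith
    then obtain lab' :: "'v \<Rightarrow> 'l" and s where IH: "\<And>m. gain S (S \<union> U) lab' m \<Longrightarrow> gain S (S \<union> U) (merge lab ps) (s + m)"
        "\<forall>ps. \<not> closed_walk S (S \<union> U) lab' ps" "good V U (S \<union> U) lab'"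
        "card (nontrivial V lab') \<le> card (nontrivial V (merge lab ps)) + 3 * s"
      using less.hyps[OF _ good_merge[OF less.prems], of ps] by metis
    have "gain S (S \<union> U) lab (profit ps + s + m)" if "gain S (S \<union> U) lab' m" for m
      by (rule gain_step[OF ps IH(1)[OF that]]) simp
    moreover have "length ps \<le> 3 * profit ps"
      using len(2) unfolding profit_def by auto
    ultimately show ?thesis
      using IH(2-4) nontrivial_merge[OF fin, of lab ps]
      by (intro exI[of _ lab'] exI[of _ "profit ps + s"]) simp
  qed
qed

text \<open>As all ends of safe edges are included, a step of length 2 never involves a class
  without cover vertices.\<close>

definition safe_cover :: "'v set \<Rightarrow> bool" where
  "safe_cover X \<longleftrightarrow> X \<subseteq> V \<and> (\<forall>x y. {x, y} \<in> S \<union> U \<longrightarrow> x \<in> X \<or> y \<in> X) \<and> \<Union>S \<subseteq> X"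

text \<open>Once no positive step is possible, two vertices outside the merged classes cannot be
  adjacent, since a second route between them would close a cycle of length at least 3.\<close>

lemma safe_cover_ex:
  assumes "good V U (S \<union> U) id"
  shows "\<exists>X s. safe_cover X \<and> card X \<le> 3 * s \<and> gain S (S \<union> U) id s"
proof -
  obtain lab :: "'v \<Rightarrow> 'v" and s where lab: 
      "\<And>m. gain S (S \<union> U) lab m \<Longrightarrow> gain S (S \<union> U) id (s + m)"
      "\<And>ps. \<not> closed_walk S (S \<union> U) lab ps" "good V U (S \<union> U) lab"
      "card (nontrivial V lab) \<le> card (nontrivial V (id :: 'v \<Rightarrow> 'v)) + 3 * s"
    using stuck_ex[OF assms] by (elim exE conjE) metis
  have "nontrivial V (id :: 'v \<Rightarrow> 'v) = {}" unfolding nontrivial_def by auto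
  then have card: "card (nontrivial V lab) \<le> 3 * s" using lab(4) by simp
  have gain: "gain S (S \<union> U) id s" using lab(1)[OF gain_0] by simp
  have safe: "lab x = lab y" if "{x, y} \<in> S" for x y
  proof (rule ccontr)
    assume ne: "lab x \<noteq> lab y"
    have "adj ((S \<union> U) \<inter> S) lab (lab x) (lab y)" "adj (S \<union> U) lab (lab x) (lab y)"
      using that by (auto intro: adjI)
    then have "closed_walk S (S \<union> U) lab [lab y, lab x]"
      unfolding closed_walk_def using ne adj_sym[of "S \<union> U" lab "lab y" "lab x"] by simp
    then show False using lab(2) by blast
  qed
  have same: "x \<in> nontrivial V lab" if "{x, y} \<in> S \<union> U" "lab x = lab y" for x y
    using that(2) edgeD[OF that(1)] unfolding nontrivial_def by (intro CollectI conjI bexI[of _ y]) auto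
  have diff: "x \<in> nontrivial V lab \<or> y \<in> nontrivial V lab"
    if xy: "{x, y} \<in> S \<union> U" "lab x \<noteq> lab y" for x y
  proof (rule ccontr)
    assume not: "\<not> (x \<in> nontrivial V lab \<or> y \<in> nontrivial V lab)"
    have U: "{x, y} \<in> (S \<union> U) \<inter> U" using xy safe by blast
    obtain ws where ws: "distinct ws" "hd ws = lab y" "last ws = lab x" "2 \<le> length ws"
        "successively (adj (S \<union> U - {{x, y}}) lab) ws"
      using good_crossing_path[OF lab(3) U xy] by blast
    \<comment> \<open>Length 2 would give a second edge between the two classes; both consist of a
      single vertex, and the graph is simple.\<close>
    have "length ws \<noteq> 2"
    proof
      assume "length ws = 2"
      then obtain p r where "ws = [p, r]"
        by (metis (no_types, opaque_lifting) One_nat_def Suc_1 length_0_conv length_Suc_conv)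
      then have "adj (S \<union> U - {{x, y}}) lab (lab y) (lab x)" using ws by simp
      then obtain u v where uv: "{u, v} \<in> S \<union> U" "{u, v} \<noteq> {x, y}" "lab u = lab y" "lab v = lab x"
        unfolding adj_def by blast
      have "u = y" "v = x"
        using not uv edgeD[OF uv(1)] edgeD[OF xy(1)] unfolding nontrivial_def by blast+
      then show False using uv(2) by (simp add: insert_commute)
    qed
    then have "closed_walk S (S \<union> U) lab ws"
      using ws xy(1) successively_mono[OF ws(5), of "adj (S \<union> U) lab"]
      unfolding closed_walk_def by (auto intro: adjI adj_mono)
    then show False using lab(2) by blast
  qed
  have SX: "\<Union>S \<subseteq> nontrivial V lab"
  proof
    fix x assume "x \<in> \<Union>S"
    then obtain e where e: "e \<in> S" "x \<in> e" by blast
    then obtain a b where "e = {a, b}" using edge_ex by blast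
    then obtain y where "{x, y} \<in> S" using e by (metis insertE insert_commute singletonD)
    then show "x \<in> nontrivial V lab" using same[of x y] safe[of x y] by blast
  qed
  have "safe_cover (nontrivial V lab)"
    unfolding safe_cover_def
  proof (intro conjI allI impI SX)
    show "nontrivial V lab \<subseteq> V" unfolding nontrivial_def by blast
    show "x \<in> nontrivial V lab \<or> y \<in> nontrivial V lab" if "{x, y} \<in> S \<union> U" for x y
      using same[OF that] diff[OF that] by blast
  qed
  then show ?thesis using card gain by blast
qed

text \<open>The merged vertices of a stuck state form a cover of at most \<open>3 * s\<close>
  vertices for an achievable saving \<open>s\<close>, so
  \<open>6 * q < h \<le> 6 * s\<close>.\<close>

lemma gain_if_no_small_cover:
  assumes "good V U (S \<union> U) id" "\<And>X. safe_cover X \<Longrightarrow> h \<le> 2 * card X" "6 * q < h"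
  shows "gain S (S \<union> U) id q"
proof -
  obtain X s where "safe_cover X" "card X \<le> 3 * s" "gain S (S \<union> U) id s"
    using safe_cover_ex[OF assms(1)] by blast
  moreover from this have "q \<le> s" using assms(2,3) by fastforce
  ultimately show ?thesis using gain_mono by blast
qed

end

section \<open>Cover vertices on paths and cycles, distinct representatives\<close>

text \<open>No two consecutive entries lie outside \<open>A\<close>. The allowance of 1 for a head
  outside \<open>A\<close> is what the induction carries; a path may start and end outside.\<close>

lemma half_path:
  assumes "successively Q ps" "\<And>a b. Q a b \<Longrightarrow> a \<in> A \<or> b \<in> A" "distinct ps" "ps \<noteq> []"
  shows "length ps \<le> 2 * card (set ps \<inter> A) + (if hd ps \<in> A then 0 else 1)"
  using assms(1,3,4)
proof (induction ps)
  case (Cons p ps)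
  show ?case
  proof (cases "ps = []")
    case True
    then show ?thesis by auto
  next
    case False
    have Q: "Q p (hd ps)" and IH: "length ps \<le> 2 * card (set ps \<inter> A) + (if hd ps \<in> A then 0 else 1)"
      using Cons.IH Cons.prems False by (auto simp: successively_Cons)
    show ?thesis
    proof (cases "p \<in> A")
      case True
      then have "set (p # ps) \<inter> A = insert p (set ps \<inter> A)" by simp
      then have "card (set (p # ps) \<inter> A) = Suc (card (set ps \<inter> A))"
        using Cons.prems(2) by simp
      then show ?thesis using IH True by (simp split: if_splits)
    next
      case False
      then have "hd ps \<in> A" using Q assms(2) by blast
      then show ?thesis using IH False by simp
    qed
  qed
qed simp

text \<open>The first and the last entry are adjacent as well, so the list or its reversal starts in
  \<open>A\<close>, and the allowance disappears.\<close>

lemma half_cycle: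
  assumes "successively Q ps" "\<And>a b. Q a b \<Longrightarrow> a \<in> A \<or> b \<in> A" "\<And>a b. Q a b \<Longrightarrow> Q b a"
    and "distinct ps" "ps \<noteq> []" "Q (last ps) (hd ps)"
  shows "length ps \<le> 2 * card (set ps \<inter> A)"
proof (cases "hd ps \<in> A")
  case True
  then show ?thesis using half_path[OF assms(1,2,4,5)] by simp
next
  case False
  have "successively Q (rev ps)"
    unfolding successively_rev by (rule successively_mono[OF assms(1)]) (rule assms(3))
  moreover have "hd (rev ps) \<in> A" using False assms(2,6) by (auto simp: hd_rev)
  ultimately show ?thesis using half_path[of Q "rev ps" A] assms by simp
qed

text \<open>A trivial case of Hall's theorem: the forbidden set together with the representatives
  chosen so far never exhausts any \<open>P c\<close>, so a greedy choice succeeds.\<close>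

lemma sdr:
  assumes "finite N" "finite X" "\<And>c. c \<in> N \<Longrightarrow> card X + card N \<le> card (P c)"
  shows "\<exists>fr. inj_on fr N \<and> (\<forall>c\<in>N. fr c \<in> P c - X)"
  using assms
proof (induction arbitrary: X rule: finite_induct)
  case empty
  then show ?case by simp
next
  case (insert c N)
  have "card X < card (P c)" using insert.prems(2)[of c] insert.hyps by simp
  then have "\<not> P c \<subseteq> X" using insert.prems(1) card_mono by (metis leD)
  then obtain f where f: "f \<in> P c" "f \<notin> X" by blast
  have "\<exists>fr. inj_on fr N \<and> (\<forall>c\<in>N. fr c \<in> P c - insert f X)"
    by (rule insert.IH) (use insert.prems insert.hyps f in \<open>auto simp: card_insert_if\<close>)
  then obtain fr where fr: "inj_on fr N" "\<forall>c\<in>N. fr c \<in> P c - insert f X" by blast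
  have "inj_on (fr(c := f)) (insert c N)"
    using fr insert.hyps(2) unfolding inj_on_def by auto
  moreover have "\<forall>a\<in>insert c N. (fr(c := f)) a \<in> P a - X"
    using fr(2) f by auto
  ultimately show ?case by blast
qed

lemma closed_walk_rotate:
  assumes "closed_walk S E lab (as @ bs)" "3 \<le> length (as @ bs)"
  shows "closed_walk S E lab (bs @ as)"
proof (cases "as = [] \<or> bs = []")
  case True
  then show ?thesis using assms(1) by auto
next
  case False
  then show ?thesis using assms unfolding closed_walk_def
    by (auto simp: successively_append_iff)
qed

lemma closed_walk_subset:
  assumes "closed_walk S F lab ps" 
    and "\<And>u v. {u, v} \<in> F \<Longrightarrow> lab u \<in> set ps \<Longrightarrow> lab v \<in> set ps \<Longrightarrow> {u, v} \<in> E"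
  shows "closed_walk S E lab ps"
proof -
  have ne: "ps \<noteq> []" using assms(1) closed_walk_ne by blast
  have "adj F lab p r \<Longrightarrow> p \<in> set ps \<Longrightarrow> r \<in> set ps \<Longrightarrow> adj E lab p r" 
    "adj (F \<inter> S) lab p r \<Longrightarrow> p \<in> set ps \<Longrightarrow> r \<in> set ps \<Longrightarrow> adj (E \<inter> S) lab p r" for p r
    using assms(2) unfolding adj_def by blast+
  then show ?thesis
    using assms(1) ne unfolding closed_walk_def by (auto simp: successively_conv_nth)
qed

section \<open>Replacing vertices outside the cover\<close>

locale covered_flex = flex V S U for V :: "'v set" and S U +
  fixes H :: "'v set"
  assumes cover: "safe_cover H"
begin

lemma finH: "finite H"
  using cover fin finite_subset unfolding safe_cover_def by blast

lemma coverD: "{x, y} \<in> S \<union> U \<Longrightarrow> x \<in> H \<or> y \<in> H"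
  using cover unfolding safe_cover_def by metis

lemma safeD:
  assumes "{x, y} \<in> S" shows "x \<in> H \<and> y \<in> H"
proof -
  have "\<Union>S \<subseteq> H" using cover unfolding safe_cover_def by metis
  then show ?thesis using assms by blast
qed

lemma adj_cover:
  assumes "adj E lab p r" "E \<subseteq> S \<union> U"
  shows "p \<in> lab ` H \<or> r \<in> lab ` H"
proof -
  obtain x y where "{x, y} \<in> E" "lab x = p" "lab y = r" using assms(1) unfolding adj_def by blast
  moreover from this have "x \<in> H \<or> y \<in> H" using coverD assms(2) by blast
  ultimately show ?thesis by blast
qed

lemma closed_walk_cover:
  assumes "closed_walk S E lab ps" "E \<subseteq> S \<union> U"
  shows "length ps \<le> 2 * card (set ps \<inter> lab ` H)" "length ps = 2 \<Longrightarrow> set ps \<subseteq> lab ` H"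
proof -
  show "length ps \<le> 2 * card (set ps \<inter> lab ` H)"
  proof (rule half_cycle[where Q = "adj E lab"])
    show "adj E lab (last ps) (hd ps)" by (rule closed_walk_adj_last[OF assms(1)])
    show "distinct ps" "ps \<noteq> []" "successively (adj E lab) ps"
      using assms(1) closed_walk_ne unfolding closed_walk_def by auto
    show "adj E lab a b \<Longrightarrow> a \<in> lab ` H \<or> b \<in> lab ` H" for a b
      by (rule adj_cover[OF _ assms(2)])
    show "adj E lab a b \<Longrightarrow> adj E lab b a" for a b by (subst adj_sym)
  qed
  assume l: "length ps = 2"
  then obtain p r where pr: "ps = [p, r]"
    by (metis (no_types, opaque_lifting) One_nat_def Suc_1 length_0_conv length_Suc_conv)
  then have "adj (E \<inter> S) lab r p" using assms(1) unfolding closed_walk_def by auto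
  then obtain x y where "{x, y} \<in> S" "lab x = r" "lab y = p" unfolding adj_def by blast
  then show "set ps \<subseteq> lab ` H" using pr safeD by auto
qed

text \<open>A step that meets \<open>hl\<close> cover classes has at most \<open>2 * hl\<close>
  classes and edges and lowers the number of cover classes by at least \<open>hl - 1\<close>. Since
  \<open>2 * hl \<le> 4 * (hl - 1)\<close> for \<open>hl \<ge> 2\<close>, four edges per lost cover
  class suffice.\<close>

lemma gain_few_edges:
  assumes "gain S E lab m" "E \<subseteq> S \<union> U"
  shows "\<exists>F\<subseteq>E. finite F \<and> card F \<le> 4 * card (lab ` H) \<and> gain S F lab m"
  using assms
proof (induction rule: gain.induct)
  case (gain_0 lab)
  then show ?case by (intro exI[of _ "{}"]) (simp add: gain.gain_0)
next
  case (gain_step lab ps m k)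
  obtain F where F: "F \<subseteq> E" "finite F" "card F \<le> 4 * card (merge lab ps ` H)" "gain S F (merge lab ps) m"
    using gain_step.IH gain_step.prems by blast
  have ps: "distinct ps" "successively (adj E lab) ps" "ps \<noteq> []" "2 \<le> length ps"
    using gain_step.hyps(1) closed_walk_ne closed_walk_length unfolding closed_walk_def by auto
  obtain P where P: "P \<subseteq> E" "finite P" "card P \<le> length ps - 1" "successively (adj P lab) ps"
    using successively_sub_edges[OF ps(2)] by blast
  obtain e where e: "e \<in> E" "closed_walk S (insert e P) lab ps"
  proof -
    have succ: "successively (adj (insert e P) lab) ps" for e
      by (rule successively_mono[OF P(4)]) (auto intro: adj_mono)
    show thesis
    proof (cases "length ps = 2")
      case True
      then have "adj (E \<inter> S) lab (last ps) (hd ps)"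
        using gain_step.hyps(1) unfolding closed_walk_def by auto
      then obtain x y where xy: "{x, y} \<in> E \<inter> S" "lab x = last ps" "lab y = hd ps"
        unfolding adj_def by blast
      then have "adj (insert {x, y} P \<inter> S) lab (last ps) (hd ps)"
        unfolding adj_def by blast
      then show thesis using that[of "{x, y}"] xy(1) succ ps(1) True unfolding closed_walk_def by auto
    next
      case False
      have "adj E lab (last ps) (hd ps)" by (rule closed_walk_adj_last[OF gain_step.hyps(1)])
      then obtain x y where xy: "{x, y} \<in> E" "lab x = last ps" "lab y = hd ps"
        unfolding adj_def by blast
      then have "adj (insert {x, y} P) lab (last ps) (hd ps)"
        unfolding adj_def by blast
      then show thesis using that[of "{x, y}"] xy(1) succ ps(1,4) False unfolding closed_walk_def by auto
    qed
  qed
  define hl where "hl = card (set ps \<inter> lab ` H)"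
  have hl: "length ps \<le> 2 * hl" unfolding hl_def
    by (rule closed_walk_cover[OF gain_step.hyps(1) gain_step.prems])
  \<comment> \<open>For length 2 counting alone gives only \<open>hl \<ge> 1\<close>, but then both
    ends of the safe edge lie in the cover.\<close>
  have hl2: "2 \<le> hl"
  proof (cases "length ps = 2")
    case True
    then have "set ps \<inter> lab ` H = set ps"
      using closed_walk_cover(2)[OF gain_step.hyps(1) gain_step.prems] by blast
    then show ?thesis unfolding hl_def using ps by (simp add: distinct_card)
  next
    case False
    then show ?thesis using hl ps(4) by linarith
  qed
  have "card (merge lab ps ` H) + hl \<le> card (lab ` H) + 1"
  proof -
    have "merge lab ps ` H \<subseteq> insert (hd ps) (lab ` H - set ps)" unfolding merge_def by auto
    then have "card (merge lab ps ` H) \<le> card (insert (hd ps) (lab ` H - set ps))"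
      using finH by (intro card_mono) auto
    also have "\<dots> \<le> Suc (card (lab ` H - set ps))" by (rule card_insert_le_m1) simp_all
    also have "card (lab ` H - set ps) = card (lab ` H) - hl"
      unfolding hl_def using finH by (simp add: card_Diff_subset_Int Int_commute)
    finally have "card (merge lab ps ` H) \<le> Suc (card (lab ` H) - hl)" .
    moreover have "hl \<le> card (lab ` H)" unfolding hl_def using finH by (intro card_mono) auto
    ultimately show ?thesis by linarith
  qed
  moreover have "card (insert e P) \<le> length ps"
    using P(3) ps(3,4) card_insert_le_m1[of "length ps" P e] by simp
  moreover have "card (insert e P \<union> F) \<le> card (insert e P) + card F" by (rule card_Un_le)
  ultimately have "card (insert e P \<union> F) \<le> 4 * card (lab ` H)"
    using F(3) hl hl2 by linarith
  moreover have "gain S (insert e P \<union> F) lab k"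
  proof (rule gain.gain_step[OF _ _ gain_step.hyps(3)])
    show "closed_walk S (insert e P \<union> F) lab ps" by (rule closed_walk_subset[OF e(2)]) auto
    show "gain S (insert e P \<union> F) (merge lab ps) m" by (rule gain_subset[OF F(4)]) auto
  qed
  ultimately show ?case using P F e(1) by (intro exI[of _ "insert e P \<union> F"]) auto
qed

text \<open>Steps are copied until a walk passes through the singleton class of \<open>d\<close>,
  between classes of two neighbours \<open>x\<close> and \<open>y\<close>. A common neighbour
  \<open>f\<close> of \<open>x\<close> and \<open>y\<close> outside \<open>F\<close> takes the place
  of \<open>d\<close> there. Later steps may use further edges \<open>{c, d}\<close> although
  \<open>f\<close> is not adjacent to \<open>c\<close>; for each such \<open>c\<close> a common
  neighbour \<open>fr c\<close> of \<open>x\<close> and \<open>c\<close> provides a path from the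
  merged class to \<open>c\<close>.\<close>

lemma gain_avoid_vertex:
  assumes "gain S F lab m" "F \<subseteq> E0" "E0 \<subseteq> S \<union> U" "finite F" "d \<notin> H"
    and "\<And>z v. z \<notin> \<Union>F \<or> z = d \<Longrightarrow> lab v = lab z \<Longrightarrow> v = z"
    and "\<And>x c. {x, d} \<in> F \<Longrightarrow> {c, d} \<in> F \<Longrightarrow> 
      3 * card F \<le> card {f. {x, f} \<in> E0 \<and> {c, f} \<in> E0 \<and> f \<noteq> d}"
  shows "gain S {e \<in> E0. d \<notin> e} lab m"
  using assms(1,6)
proof (induction rule: gain.induct)
  case (gain_0 lab)
  then show ?case by (simp add: gain.gain_0)
next
  case (gain_step lab ps m k)
  let ?E1 = "{e \<in> E0. d \<notin> e}"
  note single = gain_step.prems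
  have labF: "p \<in> lab ` \<Union>F" if "p \<in> set ps" for p
    using closed_walk_labels[OF gain_step.hyps(1)] that by blast
  have sub: "{u, v} \<in> ?E1" if "{u, v} \<in> F" "lab u \<noteq> lab d" "lab v \<noteq> lab d" for u v
    using that assms(2) by auto
  show ?case
  proof (cases "lab d \<in> set ps")
    case False
    then have cw: "closed_walk S ?E1 lab ps"
      by (intro closed_walk_subset[OF gain_step.hyps(1)] sub) metis+
    \<comment> \<open>Only labels of ends of \<open>F\<close> are merged, so vertices that are no
      end of \<open>F\<close> stay alone in their classes; \<open>d\<close> does so because the walk
      avoids it.\<close>
    have "gain S ?E1 (merge lab ps) m"
    proof (rule gain_step.IH)
      fix z v assume z: "z \<notin> \<Union>F \<or> z = d" and eq: "merge lab ps v = merge lab ps z"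
      have "lab z \<notin> set ps"
      proof
        assume "lab z \<in> set ps"
        then obtain x where "x \<in> \<Union>F" "lab x = lab z" using labF[of "lab z"] by (metis imageE)
        then have "x = z" using single z by blast
        then show False using \<open>x \<in> \<Union>F\<close> z False \<open>lab z \<in> set ps\<close> by blast
      qed
      then have "lab v = lab z"
        using eq hd_in_set[OF closed_walk_ne[OF gain_step.hyps(1)]] unfolding merge_def
        by (auto split: if_splits)
      then show "v = z" using single z by blast
    qed
    with cw show ?thesis using gain_step.hyps(3) by (rule gain.gain_step)
  next
    case True
    \<comment> \<open>Both classes of a step of length 2 contain cover vertices, while the class of
      \<open>d\<close> contains \<open>d\<close> alone.\<close>
    have "length ps \<noteq> 2"
    proof
      assume "length ps = 2"
      then have "lab d \<in> lab ` H"
        using closed_walk_cover(2)[OF gain_step.hyps(1)] assms(2,3) True by blast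
      then obtain x where "x \<in> H" "lab x = lab d" by auto
      then show False using single assms(5) by blast
    qed
    then have len: "3 \<le> length ps" using gain_step.hyps(1) unfolding closed_walk_def by auto
    obtain as bs where split: "ps = as @ lab d # bs" using True by (meson split_list)
    \<comment> \<open>With \<open>d\<close> rotated to the front, its neighbours on the cycle are
      the first and the last class of \<open>qs\<close>.\<close>
    define qs where "qs = bs @ as"
    have cw: "closed_walk S F lab (lab d # qs)"
      using closed_walk_rotate[of S F lab as "lab d # bs"] gain_step.hyps(1) len split
      unfolding qs_def by simp
    have g: "gain S F (merge lab (lab d # qs)) m"
      by (rule gain_merge_cong[OF gain_step.hyps(2)]) (auto simp: split qs_def)
    have pr: "profit (lab d # qs) = profit ps" unfolding split qs_def profit_def by (simp add: add.commute)
    have lenq: "2 \<le> length qs" "qs \<noteq> []" using len unfolding split qs_def by auto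
    have "distinct (lab d # qs)" "successively (adj F lab) (lab d # qs)"
      using cw unfolding closed_walk_def by blast+
    then have dq: "lab d \<notin> set qs" "distinct qs" "successively (adj F lab) qs"
        "adj F lab (lab d) (hd qs)"
      using lenq(2) by (simp_all add: successively_Cons)
    have dl: "adj F lab (last qs) (lab d)" using closed_walk_adj_last[OF cw] lenq(2) by simp
    obtain y where y: "{y, d} \<in> F" "lab y = hd qs"
    proof -
      obtain u v where uv: "{u, v} \<in> F" "lab u = lab d" "lab v = hd qs"
        using dq(4) unfolding adj_def by blast
      then have "u = d" using single by blast
      then show thesis using that uv by (simp add: insert_commute)
    qed
    obtain x where x: "{x, d} \<in> F" "lab x = last qs"
    proof -
      obtain u v where uv: "{u, v} \<in> F" "lab u = last qs" "lab v = lab d"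
        using dl unfolding adj_def by blast
      then have "v = d" using single by blast
      then show thesis using that uv by simp
    qed
    have NH: "c \<in> H" if "{c, d} \<in> F" for c using that coverD assms(2,3,5) by blast
    define N where "N = {c. {c, d} \<in> F}"
    have NF: "N \<subseteq> \<Union>F" unfolding N_def by blast
    have finUF: "finite (\<Union>F)" 
      using assms(2-4) Union_edges fin by (meson Union_mono finite_subset)
    have finN: "finite N" using finUF NF finite_subset by blast
    have "card N \<le> card F"
    proof (rule card_inj_on_le[OF _ _ assms(4)])
      show "inj_on (\<lambda>c. {c, d}) N" by (auto simp: inj_on_def doubleton_eq_iff)
    qed (auto simp: N_def)
    moreover have "card (\<Union>F) \<le> 2 * card F"
    proof -
      have two: "card e = 2" if "e \<in> F" for e
      proof -
        have "e \<in> S \<union> U" using that assms(2,3) by blast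
        then obtain a b where "e = {a, b}" "a \<noteq> b" using edge_ex by blast
        then show ?thesis by simp
      qed
      have "card (\<Union>F) \<le> sum card F" by (rule card_Union_le_sum_card)
      also have "\<dots> = sum (\<lambda>_. 2) F" using two by (rule sum.cong[OF refl])
      finally show ?thesis by simp
    qed
    \<comment> \<open>Origin of the factor 3: at most \<open>2 * card F\<close> ends of
      \<open>F\<close> have to be avoided and at most \<open>card F\<close> neighbours of
      \<open>d\<close> have to be served.\<close>
    ultimately have cards: "card (\<Union>F) + card N \<le> 3 * card F" by linarith
    define Q where "Q c = {f. {x, f} \<in> E0 \<and> {c, f} \<in> E0 \<and> f \<noteq> d}" for c
    have "card (\<Union>F) + card N \<le> card (Q c)" if "c \<in> N" for c
    proof -
      have "{c, d} \<in> F" using that unfolding N_def by simp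
      then have "3 * card F \<le> card (Q c)" unfolding Q_def by (rule assms(7)[OF x(1)])
      with cards show ?thesis by linarith
    qed
    then have "\<exists>fr. inj_on fr N \<and> (\<forall>c\<in>N. fr c \<in> Q c - \<Union>F)" by (rule sdr[OF finN finUF])
    then obtain fr where fr: "inj_on fr N" "\<forall>c\<in>N. fr c \<in> Q c - \<Union>F" by (elim exE conjE)
    define f where "f = fr y"
    have yN: "y \<in> N" using y unfolding N_def by simp
    have frE: "{x, fr c} \<in> ?E1" "{fr c, c} \<in> ?E1" "fr c \<notin> \<Union>F" if "c \<in> N" for c
    proof -
      have "c \<noteq> d" "x \<noteq> d" using NH that x(1) assms(5) unfolding N_def by blast+
      moreover have "{x, fr c} \<in> E0" "{fr c, c} \<in> E0" "fr c \<noteq> d" "fr c \<notin> \<Union>F"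
        using bspec[OF fr(2) that] insert_commute[of c "fr c" "{}"] unfolding Q_def by simp_all
      ultimately show "{x, fr c} \<in> ?E1" "{fr c, c} \<in> ?E1" "fr c \<notin> \<Union>F"
        by simp_all
    qed
    have frlab: "v = fr c" if "c \<in> N" "lab v = lab (fr c)" for c v
      using single frE(3)[OF that(1)] that(2) by blast
    have frq: "lab (fr c) \<notin> set qs" if "c \<in> N" for c
    proof
      assume "lab (fr c) \<in> set qs"
      then obtain u where u: "u \<in> \<Union>F" "lab (fr c) = lab u" 
        using labF[of "lab (fr c)"] unfolding split qs_def by auto
      then have "u = fr c" using frlab[OF that] by simp
      then show False using u(1) frE(3)[OF that] by simp
    qed
    have cw': "closed_walk S ?E1 lab (lab f # qs)"
    proof -
      have "adj ?E1 lab (lab f) (hd qs)" using frE(2)[OF yN] y(2) unfolding f_def adj_def by blast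
      moreover have "adj ?E1 lab (last qs) (lab f)" using frE(1)[OF yN] x(2) unfolding f_def adj_def by blast
      moreover have "successively (adj ?E1 lab) qs"
      proof -
        have "adj ?E1 lab p r" if pr: "adj F lab p r" "p \<in> set qs" "r \<in> set qs" for p r
        proof -
          obtain u v where uv: "{u, v} \<in> F" "lab u = p" "lab v = r" using pr(1) unfolding adj_def by blast
          have "lab u \<noteq> lab d" "lab v \<noteq> lab d" using uv(2,3) pr(2,3) dq(1) by metis+
          then have "adj ?E1 lab (lab u) (lab v)" by (intro adjI sub uv(1))
          then show ?thesis using uv by simp
        qed
        then show ?thesis using dq(3) by (auto simp: successively_conv_nth)
      qed
      ultimately have "successively (adj ?E1 lab) (lab f # qs)" "adj ?E1 lab (last (lab f # qs)) (hd (lab f # qs))"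
        using lenq(2) by (simp_all add: successively_Cons)
      moreover have "distinct (lab f # qs)" "3 \<le> length (lab f # qs)"
        using dq(2) lenq(1) frq[OF yN] unfolding f_def by simp_all
      ultimately show ?thesis unfolding closed_walk_def by blast
    qed
    define lab1 where "lab1 = merge lab (lab d # qs)"
    define lab1' where "lab1' = merge lab (lab f # qs)"
    \<comment> \<open>\<open>\<kappa>\<close> contracts all substitutes into the class of the new
      cycle. After this contraction the class is adjacent to everything to which \<open>F\<close>
      joined the class of the old cycle. \<open>\<phi>\<close> exchanges the two names of that
      class.\<close>
    define \<kappa> where "\<kappa> p = (if p \<in> lab ` fr ` N then lab f else p)" for p
    define \<phi> where "\<phi> p = (if p = lab d then lab f else if p = lab f then lab d else p)" for p
    have fl: "lab f \<in> lab ` fr ` N" unfolding f_def using yN by simp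
    have fr1: "lab1' (fr c) = lab (fr c)" if "c \<in> N" for c
      using frq[OF that] unfolding lab1'_def merge_def by auto
    have fr2: "\<kappa> (lab1' (fr c)) = lab f" if "c \<in> N" for c
      using that fr1 unfolding \<kappa>_def by auto
    have x1: "lab1' x = lab f" using x(2) lenq unfolding lab1'_def merge_def by auto
    have cc: "class_connected ?E1 lab1' \<kappa>"
      unfolding class_connected_def
    proof (intro ballI impI)
      let ?R = "{(a, b). adj ?E1 lab1' a b \<and> \<kappa> a = \<kappa> b}"
      \<comment> \<open>\<open>x\<close> lies on the new cycle and is adjacent to every substitute,
        so the only nontrivial fibre of \<open>\<kappa>\<close> is spanned by a star.\<close>
      have star: "(lab f, p) \<in> ?R" if p: "p \<in> lab ` fr ` N" for p
      proof -
        obtain c where c: "c \<in> N" "p = lab (fr c)" using p by (elim imageE) metis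
        have "adj ?E1 lab1' (lab1' x) (lab1' (fr c))" by (rule adjI[OF frE(1)[OF c(1)]])
        then have "adj ?E1 lab1' (lab f) p" using x1 fr1[OF c(1)] c(2) by metis
        moreover have "\<kappa> (lab f) = \<kappa> p" using p fl unfolding \<kappa>_def by metis
        ultimately show ?thesis by blast
      qed
      then have star': "(p, lab f) \<in> ?R" if "p \<in> lab ` fr ` N" for p
        using star[OF that] adj_sym[of ?E1 lab1' p "lab f"] by (metis (mono_tags, lifting) case_prodD case_prodI mem_Collect_eq)
      fix p r assume "\<kappa> p = \<kappa> r"
      then consider "p = r" | "p \<in> lab ` fr ` N" "r \<in> lab ` fr ` N"
        using fl unfolding \<kappa>_def by (metis (full_types))
      then show "(p, r) \<in> ?R\<^sup>*"
      proof cases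
        case 2
        then show ?thesis using star' star by (meson r_into_rtrancl rtrancl_trans)
      qed simp
    qed
    \<comment> \<open>On the ends of \<open>F\<close> other than \<open>d\<close>, the old merged
      labelling and the contracted new one agree up to the names of the merged class.\<close>
    have key: "\<kappa> (lab1' u) = \<phi> (lab1 u)" if "u \<in> \<Union>F" "u \<noteq> d" for u
    proof -
      have d: "lab u \<noteq> lab d" using that(2) single by metis
      have nfr: "lab u \<notin> lab ` fr ` N" using frlab frE(3) that(1) by (metis imageE)
      then have nf: "lab u \<noteq> lab f" using fl by metis
      show ?thesis
      proof (cases "lab u \<in> set qs")
        case True
        then have "lab1 u = lab d" "lab1' u = lab f" unfolding lab1_def lab1'_def merge_def by simp_all
        then show ?thesis using fl unfolding \<kappa>_def \<phi>_def by simp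
      next
        case False
        then have "lab1 u = lab u" "lab1' u = lab u"
          using d nf unfolding lab1_def lab1'_def merge_def by simp_all
        then show ?thesis using d nf nfr unfolding \<kappa>_def \<phi>_def by simp
      qed
    qed
    have keyd: "\<phi> (lab1 d) = lab f" unfolding lab1_def merge_def \<phi>_def by simp
    have "gain S ?E1 (\<kappa> \<circ> lab1') m"
    proof (rule gain_hom[OF g[folded lab1_def]])
      show "inj \<phi>" unfolding inj_on_def \<phi>_def by auto
    next
      fix p r assume pr: "p \<noteq> r" "adj F lab1 p r"
      then obtain u v where uv: "{u, v} \<in> F" "lab1 u = p" "lab1 v = r" unfolding adj_def by blast
      have *: "u \<in> \<Union>F" "v \<in> \<Union>F" using uv(1) by auto
      \<comment> \<open>The edge from the substitute \<open>fr c\<close> to \<open>c\<close> plays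
        the role of the edge \<open>{c, d}\<close>.\<close>
      have dadj: "adj ?E1 (\<kappa> \<circ> lab1') (\<phi> (lab1 d)) (\<phi> (lab1 c))" if "{c, d} \<in> F" for c
      proof -
        have c: "c \<in> N" "c \<in> \<Union>F" "c \<noteq> d" using that NH assms(5) unfolding N_def by auto
        have "adj ?E1 (\<kappa> \<circ> lab1') ((\<kappa> \<circ> lab1') (fr c)) ((\<kappa> \<circ> lab1') c)"
          by (rule adjI[OF frE(2)[OF c(1)]])
        then show ?thesis using fr2[OF c(1)] key[OF c(2,3)] keyd by simp
      qed
      consider "u = d" "v \<noteq> d" | "v = d" "u \<noteq> d" | "u \<noteq> d" "v \<noteq> d" using uv pr(1) by blast
      then show "adj ?E1 (\<kappa> \<circ> lab1') (\<phi> p) (\<phi> r)"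
      proof cases
        case 1
        then show ?thesis using dadj[of v] uv by (simp add: insert_commute)
      next
        case 2
        then show ?thesis using dadj[of u] uv by (subst adj_sym) simp
      next
        case 3
        then have "{u, v} \<in> ?E1" using uv(1) assms(2) by blast
        then have "adj ?E1 (\<kappa> \<circ> lab1') ((\<kappa> \<circ> lab1') u) ((\<kappa> \<circ> lab1') v)" by (rule adjI)
        then show ?thesis using key[OF *(1) 3(1)] key[OF *(2) 3(2)] uv by simp
      qed
    next
      fix p r assume "adj (F \<inter> S) lab1 p r"
      then obtain u v where uv: "{u, v} \<in> F \<inter> S" "lab1 u = p" "lab1 v = r" unfolding adj_def by blast
      then have *: "u \<in> \<Union>F" "v \<in> \<Union>F" "u \<noteq> d" "v \<noteq> d" using safeD[of u v] assms(5) by blast+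
      then have "{u, v} \<in> ?E1 \<inter> S" using uv(1) assms(2) by blast
      then have "adj (?E1 \<inter> S) (\<kappa> \<circ> lab1') ((\<kappa> \<circ> lab1') u) ((\<kappa> \<circ> lab1') v)" by (rule adjI)
      then show "adj (?E1 \<inter> S) (\<kappa> \<circ> lab1') (\<phi> p) (\<phi> r)" using key * uv(2,3) by simp
    qed
    then have "gain S ?E1 lab1' m" using cc by (rule gain_contract[OF _ refl])
    moreover have "profit (lab f # qs) = profit (lab d # qs)" by (simp add: profit_def)
    ultimately show ?thesis using gain_step.hyps(3) pr unfolding lab1'_def
      by (intro gain.gain_step[OF cw']) simp_all
  qed
qed

text \<open>The vertices of \<open>D\<close> are removed one at a time. Before each removal the gain
  is cut down again to \<open>4 * card H\<close> edges, whence \<open>12 = 3 * 4\<close>. Only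
  common neighbours outside \<open>D\<close> are counted, so the supply survives all
  removals.\<close>

lemma gain_avoid:
  assumes "gain S (S \<union> U) id q" "finite D" "D \<inter> H = {}"
    and rich: "\<And>d x y. d \<in> D \<Longrightarrow> x \<in> H \<Longrightarrow> y \<in> H \<Longrightarrow> {x, d} \<in> S \<union> U \<Longrightarrow> {y, d} \<in> S \<union> U \<Longrightarrow>
      12 * card H \<le> card {f. {x, f} \<in> S \<union> U \<and> {y, f} \<in> S \<union> U \<and> f \<notin> D}"
  shows "gain S {e \<in> S \<union> U. e \<inter> D = {}} id q"
proof -
  have "gain S {e \<in> S \<union> U. e \<inter> D' = {}} id q" if "D' \<subseteq> D" for D'
    using finite_subset[OF that assms(2)] that
  proof (induction rule: finite_induct)
    case empty
    have "{e \<in> S \<union> U. e \<inter> {} = {}} = S \<union> U" by blast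
    then show ?case using assms(1) by metis
  next
    case (insert d D')
    define E0 where "E0 = {e \<in> S \<union> U. e \<inter> D' = {}}"
    have E0: "E0 \<subseteq> S \<union> U" unfolding E0_def by blast
    have "gain S E0 id q" using insert unfolding E0_def by blast
    then obtain F where F: "F \<subseteq> E0" "finite F" "card F \<le> 4 * card (id ` H)" "gain S F id q"
      using gain_few_edges[OF _ E0] by metis
    have dH: "d \<notin> H" using insert.prems assms(3) by blast
    have "gain S {e \<in> E0. d \<notin> e} id q"
    proof (rule gain_avoid_vertex[OF F(4,1) E0 F(2) dH])
      fix x c assume xc: "{x, d} \<in> F" "{c, d} \<in> F"
      then have E: "{x, d} \<in> S \<union> U" "{c, d} \<in> S \<union> U" using F(1) E0 by auto
      then have H: "x \<in> H" "c \<in> H" using coverD dH by blast+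
      have "12 * card H \<le> card {f. {x, f} \<in> S \<union> U \<and> {c, f} \<in> S \<union> U \<and> f \<notin> D}"
        using rich[OF _ H E] insert.prems by blast
      also have "\<dots> \<le> card {f. {x, f} \<in> E0 \<and> {c, f} \<in> E0 \<and> f \<noteq> d}"
      proof (rule card_mono)
        have "f \<in> V" if "{x, f} \<in> E0" for f
          using edgeD[of x f] E0 that by blast
        then have "{f. {x, f} \<in> E0 \<and> {c, f} \<in> E0 \<and> f \<noteq> d} \<subseteq> V" by blast
        then show "finite {f. {x, f} \<in> E0 \<and> {c, f} \<in> E0 \<and> f \<noteq> d}" using fin finite_subset by blast
        show "{f. {x, f} \<in> S \<union> U \<and> {c, f} \<in> S \<union> U \<and> f \<notin> D} \<subseteq> {f. {x, f} \<in> E0 \<and> {c, f} \<in> E0 \<and> f \<noteq> d}"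
          using H insert.prems assms(3) unfolding E0_def by auto
      qed
      finally show "3 * card F \<le> card {f. {x, f} \<in> E0 \<and> {c, f} \<in> E0 \<and> f \<noteq> d}" using F(3) by simp
    qed auto
    moreover have "{e \<in> E0. d \<notin> e} = {e \<in> S \<union> U. e \<inter> insert d D' = {}}" unfolding E0_def by auto
    ultimately show ?case by metis
  qed
  then show ?thesis by blast
qed

end

section \<open>Certificates\<close>

type_synonym ('v, 'l) config = "('v \<Rightarrow> 'l) \<times> 'l list \<times> nat"

section \<open>Configurations and their soundness\<close>

text \<open>An inadmissible vertex is ignored, so every digit string leads to a valid configuration
  and none has to be rejected.\<close>

definition push :: "'v set set \<Rightarrow> 'v \<Rightarrow> ('v, 'l) config \<Rightarrow> ('v, 'l) config" where
  "push E w = (\<lambda>(lab, ps, t).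
     if ps = [] \<or> adj E lab (last ps) (lab w) \<and> lab w \<notin> set ps then (lab, ps @ [lab w], t)
     else (lab, ps, t))"

definition close :: "'v set set \<Rightarrow> 'v set set \<Rightarrow> ('v, 'l) config \<Rightarrow> ('v, 'l) config" where
  "close S E = (\<lambda>(lab, ps, t).
     if 3 \<le> length ps \<and> adj E lab (last ps) (hd ps) \<or> length ps = 2 \<and> adj S lab (last ps) (hd ps)
     then (merge lab ps, [], t + profit ps) else (lab, ps, t))"

text \<open>The walk extends to a cycle through labels not on it. This is a reachability question,
  so the part of a cycle beyond the required saving does not have to be guessed.\<close>

definition closable :: "'v set set \<Rightarrow> ('v \<Rightarrow> 'l) \<Rightarrow> 'l list \<Rightarrow> bool" where
  "closable E lab ps \<longleftrightarrow>
     (last ps, hd ps) \<in> {(a, b). adj E lab a b \<and> (b \<notin> set ps \<or> b = hd ps)}\<^sup>*"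

text \<open>A cycle extending \<open>ps\<close> saves at least \<open>length ps - 2\<close>, however
  the walk is completed.\<close>

definition accept :: "'v set set \<Rightarrow> nat \<Rightarrow> ('v, 'l) config \<Rightarrow> bool" where
  "accept E q = (\<lambda>(lab, ps, t).
     q \<le> t \<or> 3 \<le> length ps \<and> q + 2 \<le> t + length ps \<and> closable E lab ps)"

text \<open>Digits: 0 is a no-op, \<open>1..h\<close> push a vertex of the cover, \<open>h + a\<close> followed by \<open>b\<close> and \<open>j\<close>
  pushes the \<open>j\<close>-th common neighbour of the \<open>a\<close>-th and \<open>b\<close>-th cover vertex, larger digits close
  the current cycle.\<close>

definition nxt :: "'v set set \<Rightarrow> 'v set set \<Rightarrow> nat \<Rightarrow> (nat \<Rightarrow> 'v) \<Rightarrow> (nat \<Rightarrow> nat \<Rightarrow> nat \<Rightarrow> 'v option) \<Rightarrow>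
    (nat \<Rightarrow> nat) \<Rightarrow> nat \<times> ('v, 'l) config \<Rightarrow> nat \<times> ('v, 'l) config" where
  "nxt S E h hv dec dg = (\<lambda>(pos, c).
     let d = dg pos in
     if d = 0 then (pos + 1, c)
     else if d \<le> h then (pos + 1, push E (hv d) c)
     else if d \<le> 2 * h then
       (pos + 3, case dec (d - h) (dg (pos + 1)) (dg (pos + 2)) of None \<Rightarrow> c | Some w \<Rightarrow> push E w c)
     else (pos + 1, close S E c))"

text \<open>\<open>t\<close> counts as earned in the sense that every saving from the current
  labelling can be added to it.\<close>

definition valid_config :: "'v set set \<Rightarrow> 'v set set \<Rightarrow> ('v \<Rightarrow> 'l) \<Rightarrow> ('v, 'l) config \<Rightarrow> bool" where
  "valid_config S E lab0 = (\<lambda>(lab, ps, t). distinct ps \<and> successively (adj E lab) ps \<and>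
     (\<forall>m. gain S E lab m \<longrightarrow> gain S E lab0 (t + m)))"

lemma valid_push: "valid_config S E lab0 c \<Longrightarrow> valid_config S E lab0 (push E w c)"
  unfolding valid_config_def push_def by (cases c) (auto simp: successively_append_iff)

lemma valid_close:
  assumes "valid_config S E lab0 c" "S \<subseteq> E"
  shows "valid_config S E lab0 (close S E c)"
proof -
  obtain lab ps t where c: "c = (lab, ps, t)" by (cases c)
  show ?thesis
  proof (cases "3 \<le> length ps \<and> adj E lab (last ps) (hd ps) \<or> length ps = 2 \<and> adj S lab (last ps) (hd ps)")
    case False
    then have "close S E c = c" by (simp only: c close_def prod.case if_False)
    then show ?thesis using assms(1) by simp
  next
    case True
    have "E \<inter> S = S" using assms(2) by blast
    then have cw: "closed_walk S E lab ps"
      using True assms(1) unfolding c valid_config_def closed_walk_def by simp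
    have "gain S E lab0 (t + profit ps + m)" if "gain S E (merge lab ps) m" for m
    proof -
      have "gain S E lab (profit ps + m)" by (rule gain_step[OF cw that]) simp
      then show ?thesis using assms(1) unfolding c valid_config_def by (simp add: add.assoc)
    qed
    moreover have "close S E c = (merge lab ps, [], t + profit ps)"
      using True by (simp only: c close_def prod.case if_True)
    ultimately show ?thesis unfolding valid_config_def by simp
  qed
qed

lemma valid_nxt: 
  assumes "valid_config S E lab0 (snd x)" "S \<subseteq> E"
  shows "valid_config S E lab0 (snd (nxt S E h hv dec dg x))"
  using valid_push[OF assms(1)] valid_close[OF assms] assms(1)
  unfolding nxt_def by (cases x) (simp add: Let_def split: option.split)

lemma valid_run:
  "valid_config S E lab0 c \<Longrightarrow> S \<subseteq> E \<Longrightarrow> valid_config S E lab0 (snd ((nxt S E h hv dec dg ^^ k) (pos, c)))"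
  by (induction k) (simp_all add: valid_nxt)

text \<open>On a simple path from the last to the first label, the first label occurs only as the
  end; hence the interior avoids \<open>ps\<close> and completes it to a cycle.\<close>

lemma accept_sound:
  assumes "valid_config S E lab0 c" "accept E q c"
  shows "gain S E lab0 q"
proof -
  obtain lab ps t where c: "c = (lab, ps, t)" by (cases c)
  have v: "distinct ps" "successively (adj E lab) ps" "\<And>m. gain S E lab m \<Longrightarrow> gain S E lab0 (t + m)"
    using assms(1) unfolding c valid_config_def by auto
  consider "q \<le> t" | "3 \<le> length ps" "q + 2 \<le> t + length ps" "closable E lab ps"
    using assms(2) unfolding c accept_def by auto
  then show ?thesis
  proof cases
    case 1
    have "gain S E lab0 (t + 0)" by (rule v(3)[OF gain_0])
    then show ?thesis by (rule gain_mono) (use 1 in linarith)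
  next
    case 2
    let ?P = "\<lambda>a b. adj E lab a b \<and> (b \<notin> set ps \<or> b = hd ps)"
    have ne: "ps \<noteq> []" using 2(1) by auto
    have lh: "last ps \<noteq> hd ps"
    proof
      assume eq: "last ps = hd ps"
      obtain p r rs where pr: "ps = p # r # rs" using 2(1) by (cases ps; cases "tl ps") auto
      then have "p \<in> set (r # rs)" using eq last_in_set[of "r # rs"] by (metis last_ConsR list.discI list.sel(1))
      then show False using pr v(1) by simp
    qed
    obtain ws where ws: "ws \<noteq> []" "hd ws = last ps" "last ws = hd ps" "distinct ws" "successively ?P ws"
      using rtrancl_simple_path[OF 2(3)[unfolded closable_def]] by (elim exE conjE)
    then obtain us where us: "ws = last ps # us" by (cases ws) simp_all
    have usne: "us \<noteq> []" using us ws(3) lh by auto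
    define xs where "xs = butlast us"
    have usx: "us = xs @ [hd ps]" using ws(3) usne unfolding us xs_def by (metis append_butlast_last_id last_ConsR)
    have succ: "successively ?P (last ps # xs @ [hd ps])" using ws(5) unfolding us usx .
    have dis: "distinct (last ps # xs @ [hd ps])" using ws(4) unfolding us usx .
    have xs: "x \<notin> set ps" if "x \<in> set xs" for x
    proof -
      obtain i where i: "i < length xs" "x = xs ! i" using \<open>x \<in> set xs\<close> by (auto simp: in_set_conv_nth)
      then have "?P ((last ps # xs @ [hd ps]) ! i) ((last ps # xs @ [hd ps]) ! Suc i)"
        using succ unfolding successively_conv_nth by simp
      then have "x \<notin> set ps \<or> x = hd ps" using i by (simp add: nth_append)
      then show ?thesis using dis \<open>x \<in> set xs\<close> by auto
    qed
    have succE: "successively (adj E lab) (last ps # xs @ [hd ps])"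
      by (rule successively_mono[OF succ]) simp
    have cw: "closed_walk S E lab (ps @ xs)"
      unfolding closed_walk_def
    proof (intro conjI disjI1)
      show "distinct (ps @ xs)" using v(1) dis xs by auto
      show "successively (adj E lab) (ps @ xs)"
        using v(2) succE by (cases xs) (auto simp: successively_append_iff successively_Cons hd_append split: if_splits)
      show "3 \<le> length (ps @ xs)" using 2(1) by simp
      show "adj E lab (last (ps @ xs)) (hd (ps @ xs))"
        using succE ne by (cases xs rule: rev_cases) (auto simp: successively_append_iff successively_Cons split: if_splits)
    qed
    have "gain S E lab (length ps - 2)"
      by (rule gain_step[OF cw gain_0]) (use 2(1) in \<open>simp add: profit_def\<close>)
    then have "gain S E lab0 (t + (length ps - 2))" by (rule v(3))
    then show ?thesis by (rule gain_mono) (use 2(1,2) in linarith)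
  qed
qed

section \<open>Digit strings for sequences of steps\<close>

text \<open>\<open>D\<close> contains the vertices that no triple addresses. The largest digit with
  a meaning of its own is the closing digit \<open>2 * h + 1\<close>, which has to be below the
  base.\<close>

locale certificates = covered_flex V S U H for V :: "'v set" and S U H +
  fixes D :: "'v set" and h B :: nat and hv :: "nat \<Rightarrow> 'v" and dec :: "nat \<Rightarrow> nat \<Rightarrow> nat \<Rightarrow> 'v option"
  assumes hv: "hv ` {1..h} = H" and hB: "2 * h + 1 < B"
    and dec: "\<And>w x. w \<notin> H \<Longrightarrow> w \<notin> D \<Longrightarrow> {x, w} \<in> S \<union> U \<Longrightarrow>
      \<exists>a b j. 1 \<le> a \<and> a \<le> h \<and> 1 \<le> b \<and> b \<le> h \<and> j < B \<and> dec a b j = Some w"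
begin

abbreviation "step \<equiv> nxt S (S \<union> U) h hv dec"

text \<open>A vertex outside the cover takes three digits but a single step, so the length only
  bounds the number of steps. Quantifying over the position makes strings composable.\<close>

definition codes :: "nat list \<Rightarrow> ('v, 'l) config \<Rightarrow> ('v, 'l) config \<Rightarrow> bool" where
  "codes ds c c' \<longleftrightarrow> (\<forall>d\<in>set ds. d < B) \<and>
     (\<forall>dg pos. (\<forall>i<length ds. dg (pos + i) = ds ! i) \<longrightarrow>
       (\<exists>k\<le>length ds. (step dg ^^ k) (pos, c) = (pos + length ds, c')))"

lemma codes_Nil: "codes [] c c"
  unfolding codes_def by auto

lemma codes_append:
  assumes "codes ds1 c c1" "codes ds2 c1 c2"
  shows "codes (ds1 @ ds2) c c2"
  unfolding codes_def
proof (intro conjI allI impI)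
  show "\<forall>d\<in>set (ds1 @ ds2). d < B" using assms unfolding codes_def by auto
  fix dg pos assume dg: "\<forall>i<length (ds1 @ ds2). dg (pos + i) = (ds1 @ ds2) ! i"
  have "\<forall>i<length ds1. dg (pos + i) = ds1 ! i"
  proof (intro allI impI)
    fix i assume "i < length ds1"
    then show "dg (pos + i) = ds1 ! i" using dg[rule_format, of i] by (simp add: nth_append)
  qed
  then obtain k1 where k1: "k1 \<le> length ds1" "(step dg ^^ k1) (pos, c) = (pos + length ds1, c1)"
    using assms(1) unfolding codes_def by blast
  have "\<forall>i<length ds2. dg (pos + length ds1 + i) = ds2 ! i"
  proof (intro allI impI)
    fix i assume "i < length ds2"
    then show "dg (pos + length ds1 + i) = ds2 ! i" 
      using dg[rule_format, of "length ds1 + i"] by (simp add: nth_append add.assoc)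
  qed
  then obtain k2 where k2: "k2 \<le> length ds2" 
      "(step dg ^^ k2) (pos + length ds1, c1) = (pos + length ds1 + length ds2, c2)"
    using assms(2) unfolding codes_def by blast
  have "(step dg ^^ (k2 + k1)) (pos, c) = (pos + length (ds1 @ ds2), c2)"
    using k1(2) k2(2) by (simp add: funpow_add add.assoc)
  then show "\<exists>k\<le>length (ds1 @ ds2). (step dg ^^ k) (pos, c) = (pos + length (ds1 @ ds2), c2)"
    using k1(1) k2(1) by (intro exI[of _ "k2 + k1"]) simp
qed

lemma codes_one_step:
  assumes "\<forall>d\<in>set ds. d < B" "ds \<noteq> []"
    and "\<And>dg pos. (\<forall>i<length ds. dg (pos + i) = ds ! i) \<Longrightarrow> step dg (pos, c) = (pos + length ds, c')"
  shows "codes ds c c'"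
  unfolding codes_def
proof (intro conjI allI impI)
  fix dg pos assume "\<forall>i<length ds. dg (pos + i) = ds ! i"
  then have "(step dg ^^ 1) (pos, c) = (pos + length ds, c')" using assms(3) by simp
  moreover have "1 \<le> length ds" using assms(2) by (simp add: Suc_le_eq)
  ultimately show "\<exists>k\<le>length ds. (step dg ^^ k) (pos, c) = (pos + length ds, c')" by blast
qed (rule assms(1))

lemma codes_cover_vertex:
  assumes "w \<in> H"
  shows "\<exists>ds. length ds = 1 \<and> codes ds c (push (S \<union> U) w c)"
proof -
  obtain i where i: "1 \<le> i" "i \<le> h" "hv i = w" using assms hv by (metis atLeastAtMost_iff imageE)
  have "codes [i] c (push (S \<union> U) w c)"
    by (rule codes_one_step) (use i hB in \<open>auto simp: nxt_def\<close>)
  then show ?thesis by (intro exI[of _ "[i]"]) simp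
qed

lemma codes_other_vertex:
  assumes "w \<notin> H" "w \<notin> D" "{x, w} \<in> S \<union> U"
  shows "\<exists>ds. length ds = 3 \<and> codes ds c (push (S \<union> U) w c)"
proof -
  obtain a b j where abj: "1 \<le> a" "a \<le> h" "1 \<le> b" "b \<le> h" "j < B" "dec a b j = Some w"
    using dec[OF assms] by blast
  have "codes [h + a, b, j] c (push (S \<union> U) w c)"
  proof (rule codes_one_step)
    show "\<forall>d\<in>set [h + a, b, j]. d < B" using abj hB by simp
    fix dg :: "nat \<Rightarrow> nat" and pos
    assume dg: "\<forall>i<length [h + a, b, j]. dg (pos + i) = [h + a, b, j] ! i"
    then have "dg pos = h + a" "dg (pos + 1) = b" "dg (pos + 2) = j"
      using dg[rule_format, of 0] dg[rule_format, of 1] dg[rule_format, of 2] by simp_all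
    then show "step dg (pos, c) = (pos + length [h + a, b, j], push (S \<union> U) w c)"
      using abj unfolding nxt_def by simp
  qed simp
  then show ?thesis by (intro exI[of _ "[h + a, b, j]"]) simp
qed

lemma codes_close: "codes [2 * h + 1] c (close S (S \<union> U) c)"
  by (rule codes_one_step) (use hB in \<open>auto simp: nxt_def\<close>)

text \<open>One digit for a class with a cover vertex and three for any other: three per class minus
  two per cover class.\<close>

lemma codes_path:
  assumes "distinct ps" "successively (adj E lab) ps" "E \<subseteq> {e \<in> S \<union> U. e \<inter> D = {}}"
    and "set ps \<subseteq> lab ` \<Union>E"
  shows "\<exists>ds. length ds + 2 * card (set ps \<inter> lab ` H) \<le> 3 * length ps \<and> codes ds (lab, [], t) (lab, ps, t)"
  using assms(1,2,4)
proof (induction ps rule: rev_induct)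
  case Nil
  show ?case using codes_Nil by (intro exI[of _ "[]"]) simp
next
  case (snoc p ps)
  have "\<exists>ds. length ds + 2 * card (set ps \<inter> lab ` H) \<le> 3 * length ps \<and> codes ds (lab, [], t) (lab, ps, t)"
    by (rule snoc.IH) (use snoc.prems in \<open>simp_all add: successively_append_iff\<close>)
  then obtain ds where ds: "length ds + 2 * card (set ps \<inter> lab ` H) \<le> 3 * length ps"
      "codes ds (lab, [], t) (lab, ps, t)"
    by (elim exE conjE)
  have E: "E \<subseteq> S \<union> U" using assms(3) by blast
  have push: "push (S \<union> U) w (lab, ps, t) = (lab, ps @ [p], t)" if "lab w = p" for w
  proof -
    have "adj (S \<union> U) lab (last ps) p" if "ps \<noteq> []"
      by (rule adj_mono[OF _ E]) (use snoc.prems(2) that in \<open>simp add: successively_append_iff\<close>)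
    then show ?thesis using snoc.prems(1) that unfolding push_def by auto
  qed
  show ?case
  proof (cases "p \<in> lab ` H")
    case True
    then obtain w where "w \<in> H" "lab w = p" by blast
    then obtain ds' where "length ds' = 1" "codes ds' (lab, ps, t) (lab, ps @ [p], t)"
      using codes_cover_vertex[of w "(lab, ps, t)"] push[of w] by auto
    moreover have "card (set (ps @ [p]) \<inter> lab ` H) = Suc (card (set ps \<inter> lab ` H))"
    proof -
      have "set (ps @ [p]) \<inter> lab ` H = insert p (set ps \<inter> lab ` H)" using True by auto
      then show ?thesis using snoc.prems(1) by simp
    qed
    ultimately show ?thesis
      using ds(1) codes_append[OF ds(2)] by (intro exI[of _ "ds @ ds'"]) simp
  next
    case False
    have "p \<in> lab ` \<Union>E" using snoc.prems(3) by simp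
    \<comment> \<open>A representative that is an end of an edge of \<open>E\<close> avoids
      \<open>D\<close> and is therefore addressed by some triple.\<close>
    then obtain w where w: "w \<in> \<Union>E" "lab w = p" by (elim imageE) metis
    then obtain e where e: "e \<in> E" "w \<in> e" by blast
    then have "e \<in> S \<union> U" "e \<inter> D = {}" using assms(3) by blast+
    then obtain u v where "e = {u, v}" using edge_ex by blast
    then have "e = {if w = u then v else u, w}" using e(2) by auto
    then obtain x where x: "{x, w} \<in> S \<union> U" "w \<notin> D"
      using \<open>e \<in> S \<union> U\<close> \<open>e \<inter> D = {}\<close> e(2) by blast
    have "w \<notin> H" using False w(2) by blast
    then obtain ds' where "length ds' = 3" "codes ds' (lab, ps, t) (lab, ps @ [p], t)"
      using codes_other_vertex[OF _ x(2,1), of "(lab, ps, t)"] push[OF w(2)] by auto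
    moreover have "set (ps @ [p]) \<inter> lab ` H = set ps \<inter> lab ` H" using False by auto
    ultimately show ?thesis
      using ds(1) codes_append[OF ds(2)] by (intro exI[of _ "ds @ ds'"]) simp
  qed
qed

text \<open>The omitted rest of the cycle is the connection through fresh labels.\<close>

lemma closable_take:
  assumes "closed_walk S E lab ps" "E \<subseteq> S \<union> U" "3 \<le> r" "r \<le> length ps"
  shows "closable (S \<union> U) lab (take r ps)"
proof -
  define xs where "xs = drop r ps"
  define zs where "zs = take r ps"
  have zx: "ps = zs @ xs" unfolding xs_def zs_def by simp
  have zne: "zs \<noteq> []" using assms(3,4) unfolding zs_def by auto
  let ?P = "\<lambda>a b. adj (S \<union> U) lab a b \<and> (b \<notin> set zs \<or> b = hd zs)"
  have dis: "distinct (zs @ xs)" and succ: "successively (adj E lab) (zs @ xs)"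
    using assms(1) unfolding closed_walk_def zx by auto
  have last: "adj E lab (last (zs @ xs)) (hd (zs @ xs))" using closed_walk_adj_last[OF assms(1)] unfolding zx .
  have "successively (adj E lab) (last zs # xs @ [hd zs])"
    using succ last zne by (cases xs rule: rev_cases) (auto simp: successively_append_iff successively_Cons hd_append split: if_splits)
  then have "successively ?P (last zs # xs @ [hd zs])"
    unfolding successively_conv_nth
  proof (intro allI impI)
    fix i assume a: "\<forall>i. Suc i < length (last zs # xs @ [hd zs]) \<longrightarrow>
        adj E lab ((last zs # xs @ [hd zs]) ! i) ((last zs # xs @ [hd zs]) ! Suc i)"
      and i: "Suc i < length (last zs # xs @ [hd zs])"
    have "(xs @ [hd zs]) ! i \<in> set (xs @ [hd zs])" using i by (intro nth_mem) simp
    then have "(xs @ [hd zs]) ! i \<notin> set zs \<or> (xs @ [hd zs]) ! i = hd zs" using dis by auto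
    moreover have "adj (S \<union> U) lab ((last zs # xs @ [hd zs]) ! i) ((last zs # xs @ [hd zs]) ! Suc i)"
      using a[rule_format, OF i] assms(2) by (rule adj_mono)
    ultimately show "?P ((last zs # xs @ [hd zs]) ! i) ((last zs # xs @ [hd zs]) ! Suc i)" by simp
  qed
  then have "(hd (last zs # xs @ [hd zs]), hd zs) \<in> {(a, b). ?P a b}\<^sup>*"
    by (rule successively_rtrancl) simp_all
  then show ?thesis unfolding closable_def zs_def[symmetric] by simp
qed

text \<open>Every step is charged to the saving that it makes, at 7 digits per edge. The walk that
  reaches the goal may be far longer than this budget and is cut off.\<close>

lemma certificate_ex:
  assumes "gain S E lab m" "E = {e \<in> S \<union> U. e \<inter> D = {}}" "q \<le> t + m"
  shows "\<exists>ds c. length ds \<le> 7 * (q - t) \<and> codes ds (lab, [], t) c \<and> accept (S \<union> U) q c"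
  using assms(1,3)
proof (induction arbitrary: t rule: gain.induct)
  case (gain_0 lab)
  then have "accept (S \<union> U) q (lab, [], t)" unfolding accept_def by simp
  then show ?case using codes_Nil by (intro exI[of _ "[]"] exI[of _ "(lab, [], t)"]) simp
next
  case (gain_step lab ps m k)
  have E: "E \<subseteq> S \<union> U" "E \<subseteq> {e \<in> S \<union> U. e \<inter> D = {}}" using assms(2) by auto
  have ps: "distinct ps" "successively (adj E lab) ps" "ps \<noteq> []" "2 \<le> length ps"
    using gain_step.hyps(1) closed_walk_ne closed_walk_length unfolding closed_walk_def by auto
  have labs: "set ps \<subseteq> lab ` \<Union>E" by (rule closed_walk_labels[OF gain_step.hyps(1)])
  show ?case
  proof (cases "q \<le> t")
    case True
    then have "accept (S \<union> U) q (lab, [], t)" unfolding accept_def by simp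
    then show ?thesis using codes_Nil by (intro exI[of _ "[]"] exI[of _ "(lab, [], t)"]) simp
  next
    case qt: False
    show ?thesis
    proof (cases "3 \<le> length ps \<and> q \<le> t + profit ps")
      case True
      \<comment> \<open>A segment of \<open>r\<close> classes is worth exactly the missing saving.
        It may start and end outside the cover, so it takes up to
        \<open>3 * r - (r - 1) = 2 * (q - t) + 5\<close> digits, within budget as
        \<open>q - t \<ge> 1\<close>.\<close>
      define r where "r = q - t + 2"
      define zs where "zs = take r ps"
      have r: "3 \<le> r" "r \<le> length ps" "length zs = r"
      proof -
        have "profit ps = length ps - 2" using True unfolding profit_def by simp
        then have "q - t + 2 \<le> length ps" "3 \<le> q - t + 2" using True qt by linarith+
        then show "3 \<le> r" "r \<le> length ps" "length zs = r" unfolding r_def zs_def by simp_all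
      qed
      have dis: "distinct zs" "set zs \<subseteq> lab ` \<Union>E" "zs \<noteq> []"
      proof -
        show "distinct zs" using ps(1) unfolding zs_def by simp
        show "set zs \<subseteq> lab ` \<Union>E" using labs set_take_subset[of r ps] unfolding zs_def by (meson subset_trans)
        show "zs \<noteq> []" using r by auto
      qed
      have "successively (adj E lab) (zs @ drop r ps)" using ps(2) unfolding zs_def by simp
      then have succ: "successively (adj E lab) zs" unfolding successively_append_iff by blast
      obtain ds where ds: "length ds + 2 * card (set zs \<inter> lab ` H) \<le> 3 * length zs" 
          "codes ds (lab, [], t) (lab, zs, t)"
        using codes_path[OF dis(1) succ E(2) dis(2)] by blast
      have "length zs \<le> 2 * card (set zs \<inter> lab ` H) + (if hd zs \<in> lab ` H then 0 else 1)"
        by (rule half_path[OF succ _ dis(1,3)]) (rule adj_cover[OF _ E(1)])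
      then have "length zs \<le> 2 * card (set zs \<inter> lab ` H) + 1" by (auto split: if_splits)
      then have "length ds \<le> 7 * (q - t)" using ds(1) r qt unfolding r_def by linarith
      moreover have "accept (S \<union> U) q (lab, zs, t)"
        using closable_take[OF gain_step.hyps(1) E(1) r(1,2)] r qt
        unfolding accept_def zs_def[symmetric] by (auto simp: r_def)
      ultimately show ?thesis using ds(2) by blast
    next
      case False
      obtain ds1 where ds1: "length ds1 + 2 * card (set ps \<inter> lab ` H) \<le> 3 * length ps" 
          "codes ds1 (lab, [], t) (lab, ps, t)"
        using codes_path[OF ps(1,2) E(2) labs] by blast
      have "close S (S \<union> U) (lab, ps, t) = (merge lab ps, [], t + profit ps)"
      proof -
        have "3 \<le> length ps \<and> adj (S \<union> U) lab (last ps) (hd ps) \<or> length ps = 2 \<and> adj S lab (last ps) (hd ps)"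
        proof (cases "3 \<le> length ps")
          case True
          then show ?thesis using adj_mono[OF closed_walk_adj_last[OF gain_step.hyps(1)] E(1)] by blast
        next
          case l: False
          then have "length ps = 2" "adj (E \<inter> S) lab (last ps) (hd ps)"
            using gain_step.hyps(1) unfolding closed_walk_def by simp_all
          then show ?thesis using adj_mono[of "E \<inter> S" lab "last ps" "hd ps" S] by simp
        qed
        then show ?thesis by (simp only: close_def prod.case if_True)
      qed
      then have close: "codes [2 * h + 1] (lab, ps, t) (merge lab ps, [], t + profit ps)"
        using codes_close[of "(lab, ps, t)"] by simp
      have "q \<le> t + profit ps + m" using gain_step.hyps(3) gain_step.prems by linarith
      then obtain ds2 c where ds2: "length ds2 \<le> 7 * (q - (t + profit ps))" 
          "codes ds2 (merge lab ps, [], t + profit ps) c" "accept (S \<union> U) q c"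
        using gain_step.IH by blast
      \<comment> \<open>With the closing digit a cycle of length L takes at most
        \<open>2 * L + 1 \<le> 7 * (L - 2)\<close> digits for \<open>L \<ge> 3\<close>, tight for
        triangles; a safe edge takes three for a saving of 1.\<close>
      have len: "length ds1 + 1 + length ds2 \<le> 7 * (q - t)"
      proof (cases "length ps = 2")
        case True
        have "set ps \<inter> lab ` H = set ps"
          using closed_walk_cover(2)[OF gain_step.hyps(1) E(1) True] by blast
        then have "card (set ps \<inter> lab ` H) = 2" using ps(1) True by (simp add: distinct_card)
        then have "length ds1 \<le> 2" using ds1(1) True by linarith
        moreover have "profit ps = 1" using True unfolding profit_def by simp
        ultimately show ?thesis using ds2(1) qt by simp
      next
        case l: False
        have "length ps \<le> 2 * card (set ps \<inter> lab ` H)"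
          by (rule closed_walk_cover(1)[OF gain_step.hyps(1) E(1)])
        then have "length ds1 \<le> 2 * length ps" using ds1(1) by linarith
        moreover have "profit ps = length ps - 2" using l unfolding profit_def by simp
        ultimately show ?thesis using ds2(1) qt False l ps(4) by simp
      qed
      have "codes (ds1 @ [2 * h + 1] @ ds2) (lab, [], t) c"
        by (rule codes_append[OF ds1(2) codes_append[OF close ds2(2)]])
      then show ?thesis using len ds2(3) by (intro exI[of _ "ds1 @ [2 * h + 1] @ ds2"] exI[of _ c]) simp
    qed
  qed
qed

lemma noops: "(\<And>i. pos \<le> i \<Longrightarrow> dg i = 0) \<Longrightarrow> snd ((step dg ^^ k) (pos, c)) = c"
proof (induction k arbitrary: pos)
  case (Suc k)
  have "step dg (pos, c) = (pos + 1, c)" using Suc.prems[of pos] unfolding nxt_def by simp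
  then show ?case using Suc by (simp add: funpow_Suc_right del: funpow.simps)
qed simp

text \<open>The start labelling is an arbitrary injection because the program labels vertices by
  integers.\<close>

theorem gain_iff_certificate:
  assumes "inj lab0" 
    and rich: "\<And>d x y. d \<in> D \<Longrightarrow> x \<in> H \<Longrightarrow> y \<in> H \<Longrightarrow> {x, d} \<in> S \<union> U \<Longrightarrow> {y, d} \<in> S \<union> U \<Longrightarrow>
      12 * card H \<le> card {f. {x, f} \<in> S \<union> U \<and> {y, f} \<in> S \<union> U \<and> f \<notin> D}"
    and D: "finite D" "D \<inter> H = {}"
  shows "gain S (S \<union> U) id q \<longleftrightarrow>
    (\<exists>dg. (\<forall>i. dg i < B) \<and> (\<forall>i\<ge>7 * q. dg i = 0) \<and>
      accept (S \<union> U) q (snd ((step dg ^^ (7 * q)) (0, (lab0, [], 0)))))"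
proof
  assume "gain S (S \<union> U) id q"
  then have "gain S {e \<in> S \<union> U. e \<inter> D = {}} id q" by (rule gain_avoid[OF _ D rich])
  then have "gain S {e \<in> S \<union> U. e \<inter> D = {}} lab0 q"
    by (rule gain_hom[OF _ assms(1)]) (simp_all add: adj_def, blast+)
  then have "\<exists>ds c. length ds \<le> 7 * (q - 0) \<and> codes ds (lab0, [], 0) c \<and> accept (S \<union> U) q c"
    by (rule certificate_ex) simp_all
  then obtain ds c where ds: "length ds \<le> 7 * q" "codes ds (lab0, [], 0) c" "accept (S \<union> U) q c"
    unfolding diff_zero by (elim exE conjE)
  define dg where "dg i = (if i < length ds then ds ! i else 0)" for i
  have "\<exists>k\<le>length ds. (step dg ^^ k) (0, (lab0, [], 0)) = (0 + length ds, c)"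
    using ds(2) unfolding codes_def by (elim conjE allE[of _ dg] allE[of _ 0] impE) (simp_all add: dg_def)
  then obtain k where k: "k \<le> length ds" "(step dg ^^ k) (0, (lab0, [], 0)) = (length ds, c)"
    unfolding add_0 by (elim exE conjE)
  \<comment> \<open>The string is consumed after \<open>k\<close> steps; the remaining steps read
    the digit 0, also at positions beyond the string.\<close>
  have "7 * q = (7 * q - k) + k" using k(1) ds(1) by linarith
  then have "(step dg ^^ (7 * q)) (0, (lab0, [], 0)) = (step dg ^^ (7 * q - k)) ((step dg ^^ k) (0, (lab0, [], 0)))"
    by (metis comp_apply funpow_add)
  then have "snd ((step dg ^^ (7 * q)) (0, (lab0, [], 0))) = c"
    unfolding k(2) using noops[of "length ds" dg] by (simp add: dg_def)
  moreover have "\<forall>d\<in>set ds. d < B" using ds(2) unfolding codes_def by (rule conjunct1)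
  then have "\<forall>i. dg i < B" using hB unfolding dg_def by simp
  moreover have "\<forall>i\<ge>7 * q. dg i = 0" using ds(1) unfolding dg_def by auto
  ultimately show "\<exists>dg. (\<forall>i. dg i < B) \<and> (\<forall>i\<ge>7 * q. dg i = 0) \<and>
      accept (S \<union> U) q (snd ((step dg ^^ (7 * q)) (0, (lab0, [], 0))))"
    using ds(3) by (intro exI[of _ dg]) simp
next
  assume "\<exists>dg. (\<forall>i. dg i < B) \<and> (\<forall>i\<ge>7 * q. dg i = 0) \<and>
      accept (S \<union> U) q (snd ((step dg ^^ (7 * q)) (0, (lab0, [], 0))))"
  then obtain dg where dg: "accept (S \<union> U) q (snd ((step dg ^^ (7 * q)) (0, (lab0, [], 0))))" by blast
  have "valid_config S (S \<union> U) lab0 (lab0, [], 0)" unfolding valid_config_def by simp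
  then have "valid_config S (S \<union> U) lab0 (snd ((step dg ^^ (7 * q)) (0, (lab0, [], 0))))"
    by (rule valid_run) simp
  then have "gain S (S \<union> U) lab0 q" using dg by (rule accept_sound)
  then show "gain S (S \<union> U) id q"
  proof (rule gain_hom_on)
    show "inj_on (inv lab0) (range lab0)" by (rule inj_on_inv_into) simp
  qed (use assms(1) in \<open>simp_all add: adj_def, (metis inv_f_f)+\<close>)
qed

end

section \<open>Running times of structured programs\<close>

text \<open>Both branches of a conditional are charged, so the bound depends on the program and
  \<open>N\<close> only. The additional round of a loop pays for the final test.\<close>

fun tm :: "nat \<Rightarrow> com \<Rightarrow> nat" where
  "tm N Skip = 1"
| "tm N (Assign x a b) = 1 + acost a + acost b"
| "tm N (Seq c d) = tm N c + tm N d"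
| "tm N (If b c d) = 1 + bcost b + (tm N c + tm N d)"
| "tm N (While b c) = (N + 1) * (1 + bcost b + tm N c)"

fun mods :: "com \<Rightarrow> string set" where
  "mods Skip = {}"
| "mods (Assign x a b) = {x}"
| "mods (Seq c d) = mods c \<union> mods d"
| "mods (If b c d) = mods c \<union> mods d"
| "mods (While b c) = mods c"

definition frame :: "string set \<Rightarrow> store \<Rightarrow> store \<Rightarrow> bool" where
  "frame X s s' \<longleftrightarrow> (\<forall>y. y \<notin> X \<longrightarrow> s' y = s y)"

text \<open>\<open>tm N c\<close> bounds the running time of \<open>c\<close> provided that every loop is iterated at most
  \<open>N\<close> times.\<close>

definition runs :: "nat \<Rightarrow> com \<Rightarrow> store \<Rightarrow> (store \<Rightarrow> bool) \<Rightarrow> bool" where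
  "runs N c s Q \<longleftrightarrow> (\<exists>t s'. exec c s t s' \<and> t \<le> tm N c \<and> Q s')"

lemma update_apply [simp]:
  "update s x i v y = (if y = x then (s x)(i := v) else s y)"
  unfolding update_def by simp

lemma exec_frame: "exec c s t s' \<Longrightarrow> frame (mods c) s s'"
  by (induction rule: exec.induct) (auto simp: frame_def)

lemma frame_trans: "frame X s s' \<Longrightarrow> frame X s' s'' \<Longrightarrow> frame X s s''"
  unfolding frame_def by simp

lemma frame_mono: "frame X s s' \<Longrightarrow> X \<subseteq> Y \<Longrightarrow> frame Y s s'"
  unfolding frame_def by blast

lemma frameD: "frame X s s' \<Longrightarrow> y \<notin> X \<Longrightarrow> s' y = s y"
  unfolding frame_def by simp

lemma runs_mono: "runs N c s Q \<Longrightarrow> (\<And>s'. frame (mods c) s s' \<Longrightarrow> Q s' \<Longrightarrow> Q' s') \<Longrightarrow> runs N c s Q'"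
  unfolding runs_def using exec_frame by blast

lemma runs_Skip: "Q s \<Longrightarrow> runs N Skip s Q"
  unfolding runs_def using exec.Skip by fastforce

lemma runs_Assign: "Q (update s x (aval a s) (aval b s)) \<Longrightarrow> runs N (Assign x a b) s Q"
  unfolding runs_def using exec.Assign by fastforce

lemma runs_Seq:
  assumes "runs N c s R" "\<And>s'. frame (mods c) s s' \<Longrightarrow> R s' \<Longrightarrow> runs N d s' Q"
  shows "runs N (Seq c d) s Q"
proof -
  obtain t s' where 1: "exec c s t s'" "t \<le> tm N c" "R s'" using assms(1) unfolding runs_def by blast
  then obtain t' s'' where 2: "exec d s' t' s''" "t' \<le> tm N d" "Q s''"
    using assms(2) exec_frame unfolding runs_def by blast
  have "exec (Seq c d) s (t + t') s''" by (rule exec.Seq[OF 1(1) 2(1)])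
  then show ?thesis using 1(2) 2(2,3) unfolding runs_def by (intro exI[of _ "t + t'"] exI[of _ s'']) simp
qed

lemma runs_If:
  assumes "bval b s \<Longrightarrow> runs N c s Q" "\<not> bval b s \<Longrightarrow> runs N d s Q"
  shows "runs N (If b c d) s Q"
proof (cases "bval b s")
  case True
  then obtain t s' where 1: "exec c s t s'" "t \<le> tm N c" "Q s'" using assms(1) unfolding runs_def by blast
  have "exec (If b c d) s (1 + bcost b + t) s'" by (rule exec.IfTrue[OF True 1(1)])
  then show ?thesis using 1(2,3) unfolding runs_def by (intro exI[of _ "1 + bcost b + t"] exI[of _ s']) simp
next
  case False
  then obtain t s' where 1: "exec d s t s'" "t \<le> tm N d" "Q s'" using assms(2) unfolding runs_def by blast
  have "exec (If b c d) s (1 + bcost b + t) s'" by (rule exec.IfFalse[OF False 1(1)])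
  then show ?thesis using 1(2,3) unfolding runs_def by (intro exI[of _ "1 + bcost b + t"] exI[of _ s']) simp
qed

text \<open>The number \<open>M\<close> of rounds is kept separate from the \<open>N\<close> of
  \<open>tm\<close>, so that the same rule serves the counting loops and the exponential
  enumeration.\<close>

lemma exec_While_bounded:
  assumes step: "\<And>i s. i < M \<Longrightarrow> I i s \<Longrightarrow> bval b s \<and> (\<exists>t s'. exec c s t s' \<and> t \<le> T \<and> I (Suc i) s')"
    and stop: "\<And>s. I M s \<Longrightarrow> \<not> bval b s"
    and "I j s" "j \<le> M"
  shows "\<exists>t s'. exec (While b c) s t s' \<and> t \<le> (M - j + 1) * (1 + bcost b + T) \<and> I M s'"
  using assms(3,4)
proof (induction "M - j" arbitrary: j s)
  case 0
  then have "j = M" by simp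
  then have "exec (While b c) s (1 + bcost b) s" using 0 stop by (blast intro: exec.WhileFalse)
  then show ?case using 0 \<open>j = M\<close> by (intro exI[of _ "1 + bcost b"] exI[of _ s]) simp
next
  case (Suc m)
  then have j: "j < M" by simp
  obtain t s' where 1: "bval b s" "exec c s t s'" "t \<le> T" "I (Suc j) s'" using step[OF j Suc.prems(1)] by blast
  have "\<exists>t' s''. exec (While b c) s' t' s'' \<and> t' \<le> (M - Suc j + 1) * (1 + bcost b + T) \<and> I M s''"
    by (rule Suc.hyps(1)) (use Suc.hyps(2) 1(4) j in simp_all)
  then obtain t' s'' where 2: "exec (While b c) s' t' s''" "t' \<le> (M - Suc j + 1) * (1 + bcost b + T)" "I M s''"
    by (elim exE conjE)
  have "exec (While b c) s (1 + bcost b + t + t') s''" by (rule exec.WhileTrue[OF 1(1,2) 2(1)])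
  moreover have "1 + bcost b + t + t' \<le> (M - j + 1) * (1 + bcost b + T)"
  proof -
    have "M - j + 1 = Suc (M - Suc j + 1)" using j by simp
    then have "(M - j + 1) * (1 + bcost b + T) = (1 + bcost b + T) + (M - Suc j + 1) * (1 + bcost b + T)"
      by (metis mult_Suc)
    then show ?thesis using 1(3) 2(2) by linarith
  qed
  ultimately show ?case using 2(3) by blast
qed

section \<open>Counting loops and straight-line code\<close>

abbreviation Var :: "string \<Rightarrow> aexp" where "Var x \<equiv> Cell x (Const 0)"
abbreviation Set :: "string \<Rightarrow> aexp \<Rightarrow> com" where "Set x a \<equiv> Assign x (Const 0) a"
definition Eq :: "aexp \<Rightarrow> aexp \<Rightarrow> bexp" where "Eq a b = And (Not (Less a b)) (Not (Less b a))"
definition Or :: "bexp \<Rightarrow> bexp \<Rightarrow> bexp" where "Or b c = Not (And (Not b) (Not c))"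

lemma bval_Eq [simp]: "bval (Eq a b) s \<longleftrightarrow> aval a s = aval b s"
  unfolding Eq_def by auto

lemma bval_Or [simp]: "bval (Or b c) s \<longleftrightarrow> bval b s \<or> bval c s"
  unfolding Or_def by auto

definition For :: "string \<Rightarrow> string \<Rightarrow> com \<Rightarrow> com" where
  "For x hi c = Seq (Set x (Const 0))
     (While (Less (Var x) (Var hi)) (Seq c (Set x (Add (Var x) (Const 1)))))"

lemma mods_For [simp]: "mods (For x hi c) = insert x (mods c)"
  unfolding For_def by auto

text \<open>The body changes neither the counter nor its bound, so there are exactly
  \<open>M\<close> rounds. The invariant refers to the store after the counter has been advanced,
  hence the \<open>update\<close> in the step.\<close>

lemma runs_For:
  assumes hi: "s hi 0 = int M" "M \<le> N" "x \<noteq> hi" "hi \<notin> mods c" "x \<notin> mods c"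
    and init: "I 0 (update s x 0 0)"
    and step: "\<And>i s'. i < M \<Longrightarrow> I i s' \<Longrightarrow> frame (insert x (mods c)) s s' \<Longrightarrow> s' x 0 = int i \<Longrightarrow>
      runs N c s' (\<lambda>s''. I (Suc i) (update s'' x 0 (int (Suc i))))"
    and post: "\<And>s'. I M s' \<Longrightarrow> frame (insert x (mods c)) s s' \<Longrightarrow> Q s'"
  shows "runs N (For x hi c) s Q"
proof -
  define J where "J i s' \<longleftrightarrow> I i s' \<and> frame (insert x (mods c)) s s' \<and> s' x 0 = int i" for i s'
  have hi': "s' hi 0 = int M" if "J i s'" for i s'
    using that frameD[of "insert x (mods c)" s s' hi] hi unfolding J_def by auto
  \<comment> \<open>The summand 6 is the cost of incrementing the counter.\<close>
  have "\<exists>t s'. exec (While (Less (Var x) (Var hi)) (Seq c (Set x (Add (Var x) (Const 1)))))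
      (update s x 0 0) t s' \<and> t \<le> (M - 0 + 1) * (1 + bcost (Less (Var x) (Var hi)) + (tm N c + 6)) \<and> J M s'"
  proof (rule exec_While_bounded[where I = J])
    fix i s' assume i: "i < M" and J: "J i s'"
    obtain t s'' where 1: "exec c s' t s''" "t \<le> tm N c" "I (Suc i) (update s'' x 0 (int (Suc i)))"
      using step[OF i, of s'] J unfolding J_def runs_def by blast
    have fr: "frame (mods c) s' s''" by (rule exec_frame[OF 1(1)])
    then have x: "s'' x 0 = int i" using J hi(5) unfolding J_def frame_def by simp
    let ?a = "Set x (Add (Var x) (Const 1))"
    have "exec ?a s'' (1 + acost (Const 0) + acost (Add (Var x) (Const 1)))
        (update s'' x (aval (Const 0) s'') (aval (Add (Var x) (Const 1)) s''))"
      by (rule exec.Assign)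
    then have 2: "exec ?a s'' 6 (update s'' x 0 (int (Suc i)))"
      using x by (simp add: numeral_eq_Suc add.commute)
    have "exec (Seq c ?a) s' (t + 6) (update s'' x 0 (int (Suc i)))" by (rule exec.Seq[OF 1(1) 2])
    moreover have "J (Suc i) (update s'' x 0 (int (Suc i)))"
      using 1(3) fr J unfolding J_def frame_def by auto
    moreover have "bval (Less (Var x) (Var hi)) s'" using i J hi'[OF J] unfolding J_def by simp
    ultimately show "bval (Less (Var x) (Var hi)) s' \<and>
        (\<exists>t s''. exec (Seq c ?a) s' t s'' \<and> t \<le> tm N c + 6 \<and> J (Suc i) s'')"
      using 1(2) by (intro conjI exI[of _ "t + 6"] exI[of _ "update s'' x 0 (int (Suc i))"]) simp_all
  next
    fix s' assume "J M s'"
    then show "\<not> bval (Less (Var x) (Var hi)) s'" using hi' unfolding J_def by simp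
  next
    show "J 0 (update s x 0 0)" using init unfolding J_def frame_def by auto
  qed simp
  then obtain t s' where 1: "exec (While (Less (Var x) (Var hi)) (Seq c (Set x (Add (Var x) (Const 1)))))
      (update s x 0 0) t s'" "t \<le> (M + 1) * (1 + bcost (Less (Var x) (Var hi)) + (tm N c + 6))" "J M s'" by auto
  have "exec (Set x (Const 0)) s (1 + acost (Const 0) + acost (Const 0)) 
      (update s x (aval (Const 0) s) (aval (Const 0) s))" by (rule exec.Assign)
  then have "exec (For x hi c) s (3 + t) s'"
    unfolding For_def by (intro exec.Seq[OF _ 1(1)]) (simp add: numeral_eq_Suc)
  moreover have "3 + t \<le> tm N (For x hi c)"
  proof -
    have "(M + 1) * (1 + bcost (Less (Var x) (Var hi)) + (tm N c + 6)) \<le>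
        (N + 1) * (1 + bcost (Less (Var x) (Var hi)) + (tm N c + 6))"
      using hi(2) by (intro mult_right_mono) auto
    moreover have "tm N (For x hi c) = 3 + (N + 1) * (1 + bcost (Less (Var x) (Var hi)) + (tm N c + 6))"
      unfolding For_def by (simp add: numeral_eq_Suc)
    ultimately show ?thesis using 1(2) by linarith
  qed
  moreover have "Q s'" using post 1(3) unfolding J_def by blast
  ultimately show ?thesis unfolding runs_def by blast
qed

fun loop_free :: "com \<Rightarrow> bool" where
  "loop_free (Seq c d) = (loop_free c \<and> loop_free d)"
| "loop_free (If b c d) = (loop_free c \<and> loop_free d)"
| "loop_free (While b c) = False"
| "loop_free _ = True"

text \<open>The final store of a program without loops, which turns its verification into
  simplification. The value at a loop is a mere default.\<close>

fun ev :: "com \<Rightarrow> store \<Rightarrow> store" where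
  "ev Skip s = s"
| "ev (Assign x a b) s = update s x (aval a s) (aval b s)"
| "ev (Seq c d) s = ev d (ev c s)"
| "ev (If b c d) s = (if bval b s then ev c s else ev d s)"
| "ev (While b c) s = s"

lemma runs_loop_free: "loop_free c \<Longrightarrow> Q (ev c s) \<Longrightarrow> runs N c s Q"
proof (induction c arbitrary: s Q)
  case (Seq c d)
  show ?case by (rule runs_Seq[where R = "\<lambda>s'. s' = ev c s"]) (use Seq in auto)
qed (auto intro: runs_Skip runs_Assign runs_If)

text \<open>Exponents are added under sequential composition and grow by one for each loop; a crude
  degree is enough.\<close>

lemma tm_poly: "\<exists>a d. \<forall>N. tm N c \<le> a * (N + 1) ^ d"
proof (induction c)
  case Skip
  show ?case by (rule exI[of _ 1], rule exI[of _ 0]) simp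
next
  case (Assign x a b)
  show ?case by (rule exI[of _ "1 + acost a + acost b"], rule exI[of _ 0]) simp
next
  case (Seq c1 c2)
  then obtain a1 d1 a2 d2 where 1: "\<And>N. tm N c1 \<le> a1 * (N + 1) ^ d1" "\<And>N. tm N c2 \<le> a2 * (N + 1) ^ d2"
    by blast
  have "tm N (Seq c1 c2) \<le> (a1 + a2) * (N + 1) ^ (d1 + d2)" for N
  proof -
    have "(N + 1) ^ d1 \<le> (N + 1) ^ (d1 + d2)" "(N + 1) ^ d2 \<le> (N + 1) ^ (d1 + d2)"
      by (intro power_increasing; simp)+
    then have "a1 * (N + 1) ^ d1 + a2 * (N + 1) ^ d2 \<le> (a1 + a2) * (N + 1) ^ (d1 + d2)"
      unfolding add_mult_distrib by (intro add_mono mult_left_mono) simp_all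
    then show ?thesis using 1[of N] by simp
  qed
  then show ?case by blast
next
  case (If b c1 c2)
  then obtain a1 d1 a2 d2 where 1: "\<And>N. tm N c1 \<le> a1 * (N + 1) ^ d1" "\<And>N. tm N c2 \<le> a2 * (N + 1) ^ d2"
    by blast
  have "tm N (If b c1 c2) \<le> (1 + bcost b + (a1 + a2)) * (N + 1) ^ (d1 + d2)" for N
  proof -
    have "(N + 1) ^ d1 \<le> (N + 1) ^ (d1 + d2)" "(N + 1) ^ d2 \<le> (N + 1) ^ (d1 + d2)" "1 \<le> (N + 1) ^ (d1 + d2)"
      by (intro power_increasing; simp)+ simp
    then have "(1 + bcost b) * 1 + (a1 * (N + 1) ^ d1 + a2 * (N + 1) ^ d2)
        \<le> (1 + bcost b + (a1 + a2)) * (N + 1) ^ (d1 + d2)"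
      unfolding add_mult_distrib[of "1 + bcost b"] add_mult_distrib[of a1]
      by (intro add_mono mult_left_mono) simp_all
    then show ?thesis using 1[of N] by simp
  qed
  then show ?case by blast
next
  case (While b c)
  then obtain a d where 1: "\<And>N. tm N c \<le> a * (N + 1) ^ d" by blast
  have "tm N (While b c) \<le> (1 + bcost b + a) * (N + 1) ^ Suc d" for N
  proof -
    have "(1 + bcost b) * 1 + a * (N + 1) ^ d \<le> (1 + bcost b + a) * (N + 1) ^ d"
      unfolding add_mult_distrib[of "1 + bcost b" a] by (intro add_mono mult_left_mono) simp_all
    then have "1 + bcost b + tm N c \<le> (1 + bcost b + a) * (N + 1) ^ d" using 1[of N] by simp
    then have "(N + 1) * (1 + bcost b + tm N c) \<le> (N + 1) * ((1 + bcost b + a) * (N + 1) ^ d)"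
      by (rule mult_left_mono) simp
    moreover have "\<dots> = (1 + bcost b + a) * (N + 1) ^ Suc d" by (simp only: power_Suc mult.left_commute)
    ultimately show ?thesis by (simp only: tm.simps)
  qed
  then show ?case by blast
qed

section \<open>The program\<close>

text \<open>\<open>M\<close> marks labels rather than vertices, so reachability is explored in the
  quotient graph without building it.\<close>

definition clo :: "bexp \<Rightarrow> com" where
  "clo cnd = For ''r'' ''n'' (For ''x'' ''n'' (For ''y'' ''n''
     (If (And (Eq (Cell ''M'' (Cell ''C'' (Var ''x''))) (Const 1)) cnd)
       (Assign ''M'' (Cell ''C'' (Var ''y'')) (Const 1)) Skip)))"

lemma mods_clo [simp]: "mods (clo cnd) = {''r'', ''x'', ''y'', ''M''}"
  unfolding clo_def by auto

text \<open>After \<open>k\<close> rounds the marked set is closed or has at least \<open>k\<close>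
  elements, as a round on a set that is not closed marks something new. With at most
  \<open>n\<close> labels it is closed after \<open>n\<close> rounds.\<close>

lemma runs_clo:
  assumes n: "s ''n'' 0 = int n" "n \<le> N"
    and C: "\<And>x. x < n \<Longrightarrow> 0 \<le> s ''C'' (int x) \<and> s ''C'' (int x) < int n"
    and X0: "\<And>p. 0 \<le> p \<Longrightarrow> p < int n \<Longrightarrow> s ''M'' p = 1 \<longleftrightarrow> p \<in> X0" "X0 \<subseteq> {0..<int n}"
    and cnd: "\<And>s' x y. x < n \<Longrightarrow> y < n \<Longrightarrow> frame {''r'', ''x'', ''y'', ''M''} s s' \<Longrightarrow>
      s' ''x'' 0 = int x \<Longrightarrow> s' ''y'' 0 = int y \<Longrightarrow> bval cnd s' \<longleftrightarrow> P x y"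
  shows "runs N (clo cnd) s (\<lambda>s'. \<forall>p. 0 \<le> p \<and> p < int n \<longrightarrow>
    (s' ''M'' p = 1 \<longleftrightarrow> p \<in> {(s ''C'' (int x), s ''C'' (int y)) |x y. x < n \<and> y < n \<and> P x y}\<^sup>* `` X0))"
proof -
  define lb where "lb x = s ''C'' (int x)" for x
  define Rl where "Rl = {(lb x, lb y) |x y. x < n \<and> y < n \<and> P x y}"
  define Ms where "Ms s' = {p. 0 \<le> p \<and> p < int n \<and> s' ''M'' p = 1}" for s' :: store
  define F where "F = {''r'', ''x'', ''y'', ''M''}"
  have finMs: "finite (Ms s')" for s' 
    by (rule finite_subset[of _ "{0..<int n}"]) (auto simp: Ms_def)
  have cardMs: "card (Ms s') \<le> n" for s'
  proof -
    have "card (Ms s') \<le> card {0..<int n}" by (rule card_mono) (auto simp: Ms_def)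
    then show ?thesis by simp
  qed
  have MsX: "Ms s = X0" using X0 unfolding Ms_def by auto
  have Ms_upd: "Ms (update s' z 0 v) = Ms s'" if "z \<noteq> ''M''" for s' z v
    using that unfolding Ms_def by simp
  define I1 where "I1 k s' \<longleftrightarrow> X0 \<subseteq> Ms s' \<and> Ms s' \<subseteq> Rl\<^sup>* `` X0 \<and> (Rl `` Ms s' \<subseteq> Ms s' \<or> k \<le> card (Ms s'))"
    for k s'
  \<comment> \<open>\<open>M0\<close> is the marked set at the start of the round. Only its
    successors are promised to be marked, although new marks may already act within the
    round.\<close>
  define I2 where "I2 M0 i s' \<longleftrightarrow> M0 \<subseteq> Ms s' \<and> Ms s' \<subseteq> Rl\<^sup>* `` X0 \<and>
    (\<forall>x<i. \<forall>y<n. lb x \<in> M0 \<longrightarrow> P x y \<longrightarrow> lb y \<in> Ms s')" for M0 i s'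
  define I3 where "I3 M0 i j s' \<longleftrightarrow> I2 M0 i s' \<and> (\<forall>y<j. lb i \<in> M0 \<longrightarrow> P i y \<longrightarrow> lb y \<in> Ms s')" for M0 i j s'
  have closed_subset: "Rl\<^sup>* `` X0 \<subseteq> M0" if "X0 \<subseteq> M0" "Rl `` M0 \<subseteq> M0" for M0
  proof -
    have "p \<in> M0" if "(a, p) \<in> Rl\<^sup>*" "a \<in> X0" for a p
      using that by (induction rule: rtrancl_induct) (use \<open>X0 \<subseteq> M0\<close> \<open>Rl `` M0 \<subseteq> M0\<close> in blast)+
    then show ?thesis by blast
  qed
  let ?body = "If (And (Eq (Cell ''M'' (Cell ''C'' (Var ''x''))) (Const 1)) cnd)
       (Assign ''M'' (Cell ''C'' (Var ''y'')) (Const 1)) Skip"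
  have inner: "runs N (For ''y'' ''n'' ?body) s2 (I3 M0 i n)"
    if s2: "frame F s s2" "I2 M0 i s2" "s2 ''x'' 0 = int i" "i < n" for M0 i s2
  proof (rule runs_For[where M = n and I = "I3 M0 i"])
    have "s2 ''n'' = s ''n''" using frameD[OF s2(1)] unfolding F_def by simp
    then show "s2 ''n'' 0 = int n" using n(1) by simp
    show "I3 M0 i 0 (update s2 ''y'' 0 0)" using s2(2) Ms_upd unfolding I3_def I2_def by simp
  next
    fix j s3 assume j: "j < n" and I: "I3 M0 i j s3" and fr: "frame (insert ''y'' (mods ?body)) s2 s3"
      and y: "s3 ''y'' 0 = int j"
    have fr3: "frame F s s3" by (rule frame_trans[OF s2(1) frame_mono[OF fr]]) (auto simp: F_def)
    then have C3: "s3 ''C'' = s ''C''" unfolding F_def by (simp add: frame_def)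
    have x3: "s3 ''x'' 0 = int i" using frameD[OF fr] s2(3) by simp
    have c3: "bval cnd s3 = P i j" by (rule cnd[OF s2(4) j fr3[unfolded F_def] x3 y])
    have Ms3: "Ms (ev ?body s3) = (if lb i \<in> Ms s3 \<and> P i j then insert (lb j) (Ms s3) else Ms s3)"
      using C[OF j] C[OF s2(4)] unfolding Ms_def lb_def by (auto simp: x3 y C3 c3)
    have "lb j \<in> Rl\<^sup>* `` X0" if "lb i \<in> Ms s3" "P i j"
    proof -
      have "(lb i, lb j) \<in> Rl" using that(2) s2(4) j unfolding Rl_def by blast
      moreover have "lb i \<in> Rl\<^sup>* `` X0" using that(1) I unfolding I3_def I2_def by blast
      ultimately show ?thesis by (blast intro: rtrancl_into_rtrancl)
    qed
    then have "I3 M0 i (Suc j) (ev ?body s3)"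
      using I unfolding I3_def I2_def Ms3 by (auto simp: less_Suc_eq)
    then have "I3 M0 i (Suc j) (update (ev ?body s3) ''y'' 0 (int (Suc j)))"
      using Ms_upd[of "''y''"] unfolding I3_def I2_def by simp
    then show "runs N ?body s3 (\<lambda>s''. I3 M0 i (Suc j) (update s'' ''y'' 0 (int (Suc j))))"
      by (intro runs_loop_free) simp_all
  qed (use n(2) in auto)
  have middle: "runs N (For ''x'' ''n'' (For ''y'' ''n'' ?body)) s1 (I2 M0 n)"
    if s1: "frame F s s1" "Ms s1 = M0" "M0 \<subseteq> Rl\<^sup>* `` X0" for M0 s1
  proof (rule runs_For[where M = n and I = "I2 M0"])
    have "s1 ''n'' = s ''n''" using frameD[OF s1(1)] unfolding F_def by simp
    then show "s1 ''n'' 0 = int n" using n(1) by simp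
    show "I2 M0 0 (update s1 ''x'' 0 0)" using s1(2,3) Ms_upd unfolding I2_def by simp
  next
    fix i s2 assume i: "i < n" and I: "I2 M0 i s2" and x: "s2 ''x'' 0 = int i"
      and fr: "frame (insert ''x'' (mods (For ''y'' ''n'' ?body))) s1 s2"
    have fr2: "frame F s s2" by (rule frame_trans[OF s1(1) frame_mono[OF fr]]) (auto simp: F_def)
    show "runs N (For ''y'' ''n'' ?body) s2 (\<lambda>s''. I2 M0 (Suc i) (update s'' ''x'' 0 (int (Suc i))))"
      by (rule runs_mono[OF inner[OF fr2 I x i]])
        (use Ms_upd[of "''x''"] in \<open>auto simp: I3_def I2_def less_Suc_eq\<close>)
  qed (use n(2) in auto)
  have "runs N (clo cnd) s (I1 n)"
    unfolding clo_def
  proof (rule runs_For[where M = n and I = I1])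
    show "s ''n'' 0 = int n" by (rule n(1))
    show "I1 0 (update s ''r'' 0 0)" using MsX Ms_upd[of "''r''"] unfolding I1_def by auto
  next
    fix k s1 assume k: "k < n" and I: "I1 k s1"
      and fr: "frame (insert ''r'' (mods (For ''x'' ''n'' (For ''y'' ''n'' ?body)))) s s1"
    have fr1: "frame F s s1" by (rule frame_mono[OF fr]) (auto simp: F_def)
    have sub: "Ms s1 \<subseteq> Rl\<^sup>* `` X0" using I unfolding I1_def by blast
    show "runs N (For ''x'' ''n'' (For ''y'' ''n'' ?body)) s1 (\<lambda>s''. I1 (Suc k) (update s'' ''r'' 0 (int (Suc k))))"
    proof (rule runs_mono[OF middle[OF fr1 refl sub]])
      fix s' assume I2: "I2 (Ms s1) n s'"
      have m: "Ms s1 \<subseteq> Ms s'" "Ms s' \<subseteq> Rl\<^sup>* `` X0" and R: "Rl `` Ms s1 \<subseteq> Ms s'"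
        using I2 unfolding I2_def Rl_def by auto
      have "Rl `` Ms s' \<subseteq> Ms s' \<or> Suc k \<le> card (Ms s')"
      proof (cases "Rl `` Ms s1 \<subseteq> Ms s1")
        case True
        then have "Ms s' = Ms s1" using closed_subset[of "Ms s1"] m I unfolding I1_def by blast
        then show ?thesis using True by simp
      next
        case False
        then have "Ms s1 \<subset> Ms s'" using m R by blast
        then have "card (Ms s1) < card (Ms s')" by (rule psubset_card_mono[OF finMs])
        moreover have "k \<le> card (Ms s1)" using I False unfolding I1_def by blast
        ultimately show ?thesis by simp
      qed
      then show "I1 (Suc k) (update s' ''r'' 0 (int (Suc k)))"
        using m I Ms_upd[of "''r''"] unfolding I1_def by auto
    qed
  qed (use n(2) in auto)
  then show ?thesis
  proof (rule runs_mono)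
    fix s' assume I: "I1 n s'"
    have "Rl `` Ms s' \<subseteq> Ms s'"
    proof (cases "Rl `` Ms s' \<subseteq> Ms s'")
      case False
      then have "n \<le> card (Ms s')" using I unfolding I1_def by blast
      then have "Ms s' = {0..<int n}"
        by (intro card_subset_eq) (use cardMs[of s'] in \<open>auto simp: Ms_def\<close>)
      moreover have "Rl `` Ms s' \<subseteq> {0..<int n}" using C unfolding Rl_def lb_def by auto
      ultimately show ?thesis by simp
    qed
    then have "Ms s' = Rl\<^sup>* `` X0" using closed_subset[of "Ms s'"] I unfolding I1_def by blast
    then show "\<forall>p. 0 \<le> p \<and> p < int n \<longrightarrow>
      (s' ''M'' p = 1 \<longleftrightarrow> p \<in> {(s ''C'' (int x), s ''C'' (int y)) |x y. x < n \<and> y < n \<and> P x y}\<^sup>* `` X0)"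
      unfolding Rl_def[symmetric] lb_def[symmetric] Ms_def by blast
  qed
qed

section \<open>Access to the stored graph\<close>

definition edge_code :: "nat set set \<Rightarrow> nat set set \<Rightarrow> nat \<Rightarrow> nat \<Rightarrow> int" where
  "edge_code S U i j = (if {i, j} \<in> S then 1 else if {i, j} \<in> U then 2 else 0)"

text \<open>\<open>R\<close> supplies row offsets, in place of the multiplication in an access by
  row and column.\<close>

definition env :: "nat \<Rightarrow> nat set set \<Rightarrow> nat set set \<Rightarrow> store \<Rightarrow> bool" where
  "env n S U s \<longleftrightarrow> s ''n'' 0 = int n \<and>
     (\<forall>i<n. \<forall>j<n. s ''G'' (s ''R'' (int i) + int j) = edge_code S U i j)"

lemma env_frame: "env n S U s \<Longrightarrow> frame X s s' \<Longrightarrow> X \<inter> {''n'', ''G'', ''R''} = {} \<Longrightarrow> env n S U s'"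
  unfolding env_def frame_def by auto

abbreviation entry :: "string \<Rightarrow> string \<Rightarrow> aexp" where
  "entry x y \<equiv> Cell ''G'' (Add (Cell ''R'' (Var x)) (Var y))"

lemma edge_code_cases:
  "0 < edge_code S U i j \<longleftrightarrow> {i, j} \<in> S \<union> U" "edge_code S U i j = 1 \<longleftrightarrow> {i, j} \<in> S"
  "S \<inter> U = {} \<Longrightarrow> edge_code S U i j = 2 \<longleftrightarrow> {i, j} \<in> U"
  unfolding edge_code_def by auto

definition adjc :: com where
  "adjc = Seq (Set ''af'' (Const 0)) (Seq (Set ''sf'' (Const 0))
     (For ''x'' ''n'' (For ''y'' ''n''
       (If (And (Eq (Cell ''C'' (Var ''x'')) (Var ''p'')) (Eq (Cell ''C'' (Var ''y'')) (Var ''p2'')))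
         (Seq (If (Less (Const 0) (entry ''x'' ''y'')) (Set ''af'' (Const 1)) Skip)
              (If (Eq (entry ''x'' ''y'') (Const 1)) (Set ''sf'' (Const 1)) Skip)) Skip))))"

lemma mods_adjc [simp]: "mods adjc = {''af'', ''sf'', ''x'', ''y''}"
  unfolding adjc_def by auto

lemma ex_less_Suc_disj: "(\<exists>y<Suc j. P y) \<longleftrightarrow> (\<exists>y<j. P y) \<or> P j"
  by (auto simp: less_Suc_eq)

lemma runs_adjc:
  assumes env: "env n S U s" "n \<le> N" and lab: "\<And>v. v < n \<Longrightarrow> s ''C'' (int v) = lab v"
    and E: "\<And>x y. {x, y} \<in> S \<union> U \<Longrightarrow> x < n \<and> y < n"
  shows "runs N adjc s (\<lambda>s'. (s' ''af'' 0 = 1 \<longleftrightarrow> adj (S \<union> U) lab (s ''p'' 0) (s ''p2'' 0)) \<and>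
    (s' ''sf'' 0 = 1 \<longleftrightarrow> adj S lab (s ''p'' 0) (s ''p2'' 0)))"
proof -
  define p p2 where "p = s ''p'' 0" and "p2 = s ''p2'' 0"
  define F where "F = {''af'', ''sf'', ''x'', ''y''}"
  define hit where "hit x y A \<longleftrightarrow> lab x = p \<and> lab y = p2 \<and> {x, y} \<in> A" for x y A
  define I2 where "I2 i s' \<longleftrightarrow> (s' ''af'' 0 = 1 \<longleftrightarrow> (\<exists>x<i. \<exists>y<n. hit x y (S \<union> U))) \<and>
    (s' ''sf'' 0 = 1 \<longleftrightarrow> (\<exists>x<i. \<exists>y<n. hit x y S))" for i :: nat and s' :: store
  define I3 where "I3 i j s' \<longleftrightarrow> 
    (s' ''af'' 0 = 1 \<longleftrightarrow> (\<exists>x<i. \<exists>y<n. hit x y (S \<union> U)) \<or> (\<exists>y<j. hit i y (S \<union> U))) \<and>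
    (s' ''sf'' 0 = 1 \<longleftrightarrow> (\<exists>x<i. \<exists>y<n. hit x y S) \<or> (\<exists>y<j. hit i y S))" for i j :: nat and s' :: store
  let ?b = "If (And (Eq (Cell ''C'' (Var ''x'')) (Var ''p'')) (Eq (Cell ''C'' (Var ''y'')) (Var ''p2'')))
         (Seq (If (Less (Const 0) (entry ''x'' ''y'')) (Set ''af'' (Const 1)) Skip)
              (If (Eq (entry ''x'' ''y'') (Const 1)) (Set ''sf'' (Const 1)) Skip)) Skip"
  have inner: "runs N (For ''y'' ''n'' ?b) s2 (I3 i n)"
    if s2: "frame F s s2" "I2 i s2" "s2 ''x'' 0 = int i" "i < n" for i s2
  proof (rule runs_For[where M = n and I = "I3 i"])
    show "s2 ''n'' 0 = int n" using frameD[OF s2(1)] env unfolding F_def env_def by simp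
    show "I3 i 0 (update s2 ''y'' 0 0)" using s2(2) unfolding I3_def I2_def by simp
  next
    fix j s3 assume j: "j < n" and I: "I3 i j s3" and fr: "frame (insert ''y'' (mods ?b)) s2 s3"
      and y: "s3 ''y'' 0 = int j"
    have fr3: "frame F s s3" by (rule frame_trans[OF s2(1) frame_mono[OF fr]]) (auto simp: F_def)
    have x3: "s3 ''x'' 0 = int i" using frameD[OF fr] s2(3) by simp
    have "s3 ''C'' = s ''C''" "s3 ''G'' = s ''G''" "s3 ''R'' = s ''R''" "s3 ''p'' 0 = p" "s3 ''p2'' 0 = p2"
      using fr3 unfolding F_def p_def p2_def by (simp_all add: frame_def)
    then have c: "s3 ''C'' (int i) = lab i" "s3 ''C'' (int j) = lab j" "s3 ''p'' 0 = p" "s3 ''p2'' 0 = p2"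
      "s3 ''G'' (s3 ''R'' (int i) + int j) = edge_code S U i j"
      using lab s2(4) j env(1) unfolding env_def by simp_all
    have e: "ev ?b s3 ''af'' 0 = (if hit i j (S \<union> U) then 1 else s3 ''af'' 0)"
        "ev ?b s3 ''sf'' 0 = (if hit i j S then 1 else s3 ''sf'' 0)"
      by (simp_all add: x3 y c edge_code_cases hit_def)
    have "I3 i (Suc j) (update (ev ?b s3) ''y'' 0 (int (Suc j)))"
      unfolding I3_def ex_less_Suc_disj update_apply
      using I[unfolded I3_def] by (simp add: e del: ev.simps)
    then show "runs N ?b s3 (\<lambda>s''. I3 i (Suc j) (update s'' ''y'' 0 (int (Suc j))))"
      by (intro runs_loop_free) simp_all
  qed (use env(2) in auto)
  have outer: "runs N (For ''x'' ''n'' (For ''y'' ''n'' ?b)) s1 (I2 n)"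
    if s1: "frame F s s1" "s1 ''af'' 0 = 0" "s1 ''sf'' 0 = 0" for s1
  proof (rule runs_For[where M = n and I = I2])
    show "s1 ''n'' 0 = int n" using frameD[OF s1(1)] env unfolding F_def env_def by simp
    show "I2 0 (update s1 ''x'' 0 0)" using s1(2,3) unfolding I2_def by simp
  next
    fix i s2 assume i: "i < n" and I: "I2 i s2" and x: "s2 ''x'' 0 = int i"
      and fr: "frame (insert ''x'' (mods (For ''y'' ''n'' ?b))) s1 s2"
    have fr2: "frame F s s2" by (rule frame_trans[OF s1(1) frame_mono[OF fr]]) (auto simp: F_def)
    show "runs N (For ''y'' ''n'' ?b) s2 (\<lambda>s''. I2 (Suc i) (update s'' ''x'' 0 (int (Suc i))))"
      by (rule runs_mono[OF inner[OF fr2 I x i]]) (simp add: I3_def I2_def ex_less_Suc_disj)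
  qed (use env(2) in auto)
  have "runs N adjc s (I2 n)"
    unfolding adjc_def
    by (rule runs_Seq[OF runs_Assign[where Q = "\<lambda>s'. frame F s s' \<and> s' ''af'' 0 = 0"]],
        simp add: frame_def F_def,
        rule runs_Seq[OF runs_Assign[where Q = "\<lambda>s'. frame F s s' \<and> s' ''af'' 0 = 0 \<and> s' ''sf'' 0 = 0"]],
        simp add: frame_def F_def, rule outer, simp_all)
  then show ?thesis
  proof (rule runs_mono)
    fix s' assume "I2 n s'"
    moreover have "(\<exists>x<n. \<exists>y<n. hit x y A) \<longleftrightarrow> adj A lab p p2" if "A \<subseteq> S \<union> U" for A
      using E that unfolding hit_def adj_def by blast
    ultimately show "(s' ''af'' 0 = 1 \<longleftrightarrow> adj (S \<union> U) lab (s ''p'' 0) (s ''p2'' 0)) \<and>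
        (s' ''sf'' 0 = 1 \<longleftrightarrow> adj S lab (s ''p'' 0) (s ''p2'' 0))"
      unfolding I2_def p_def[symmetric] p2_def[symmetric] by simp
  qed
qed

section \<open>Stored configurations and the steps on them\<close>

text \<open>The walk is kept only as a label set \<open>O\<close>, a length and two ends: extending,
  closing and accepting never consult the order of its interior. For the empty walk the ends are
  unconstrained.\<close>

definition rep :: "nat \<Rightarrow> store \<Rightarrow> (nat, int) config \<Rightarrow> bool" where
  "rep n s = (\<lambda>(lab, ps, t). (\<forall>v<n. s ''C'' (int v) = lab v \<and> 0 \<le> lab v \<and> lab v < int n) \<and>
     set ps \<subseteq> {0..<int n} \<and> (\<forall>p. 0 \<le> p \<and> p < int n \<longrightarrow> s ''O'' p = (if p \<in> set ps then 1 else 0)) \<and>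
     s ''pl'' 0 = int (length ps) \<and> (ps \<noteq> [] \<longrightarrow> s ''fst'' 0 = hd ps \<and> s ''lst'' 0 = last ps) \<and>
     s ''t'' 0 = int t)"

lemma rep_frame:
  "rep n s c \<Longrightarrow> frame X s s' \<Longrightarrow> X \<inter> {''C'', ''O'', ''pl'', ''fst'', ''lst'', ''t''} = {} \<Longrightarrow> rep n s' c"
  unfolding rep_def frame_def by (cases c) auto

definition push_tail :: com where
  "push_tail = If (Or (Less (Var ''pl'') (Const 1))
       (And (Eq (Var ''af'') (Const 1)) (Less (Cell ''O'' (Var ''p2'')) (Const 1))))
     (Seq (If (Less (Var ''pl'') (Const 1)) (Set ''fst'' (Var ''p2'')) Skip)
       (Seq (Set ''lst'' (Var ''p2''))
         (Seq (Assign ''O'' (Var ''p2'') (Const 1)) (Set ''pl'' (Add (Var ''pl'') (Const 1)))))) Skip"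

definition push_com :: com where
  "push_com = Seq (Seq (Set ''p'' (Var ''lst'')) (Set ''p2'' (Cell ''C'' (Var ''w'')))) (Seq adjc push_tail)"

definition close_head :: com where
  "close_head = If (Eq (Var ''pl'') (Const 2)) (Set ''t'' (Add (Var ''t'') (Const 1)))
     (Set ''t'' (Add (Var ''t'') (Sub (Var ''pl'') (Const 2))))"

definition close_com :: com where
  "close_com = Seq (Seq (Set ''p'' (Var ''lst'')) (Set ''p2'' (Var ''fst''))) (Seq adjc
     (If (Or (And (Less (Const 2) (Var ''pl'')) (Eq (Var ''af'') (Const 1)))
             (And (Eq (Var ''pl'') (Const 2)) (Eq (Var ''sf'') (Const 1))))
       (Seq close_head
         (Seq (For ''i'' ''n'' (If (Eq (Cell ''O'' (Cell ''C'' (Var ''i''))) (Const 1))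
                (Assign ''C'' (Var ''i'') (Var ''fst'')) Skip))
           (Seq (For ''i'' ''n'' (Assign ''O'' (Var ''i'') (Const 0))) (Set ''pl'' (Const 0))))) Skip))"

lemma mods_push_com [simp]:
  "mods push_com = {''p'', ''p2'', ''af'', ''sf'', ''x'', ''y'', ''fst'', ''lst'', ''O'', ''pl''}"
  unfolding push_com_def push_tail_def by auto

lemma mods_close_com [simp]:
  "mods close_com = {''p'', ''p2'', ''af'', ''sf'', ''x'', ''y'', ''t'', ''i'', ''C'', ''O'', ''pl''}"
  unfolding close_com_def close_head_def by auto

lemma runs_Seq_ev:
  assumes "loop_free c" "runs N d (ev c s) Q"
  shows "runs N (Seq c d) s Q"
  by (rule runs_Seq[OF runs_loop_free[where Q = "\<lambda>s'. s' = ev c s"]]) (use assms in auto)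

locale ram =
  fixes n N :: nat and S U :: "nat set set"
  assumes flex_graph: "flex_graph {..<n} S U" and nN: "n \<le> N"
begin

sublocale flex "{..<n}" S U
  by (unfold_locales) (rule flex_graph)

abbreviation "E \<equiv> S \<union> U"

lemma edge_lt: "{x, y} \<in> E \<Longrightarrow> x < n \<and> y < n"
  using edgeD by blast

lemma runs_push:
  assumes env: "env n S U s" and rep: "rep n s c" and w: "s ''w'' 0 = int w" "w < n"
  shows "runs N push_com s (\<lambda>s'. rep n s' (push E w c))"
proof -
  obtain lab ps t where c: "c = (lab, ps, t)" by (cases c)
  define s1 where "s1 = ev (Seq (Set ''p'' (Var ''lst'')) (Set ''p2'' (Cell ''C'' (Var ''w'')))) s"
  have r: "\<And>v. v < n \<Longrightarrow> s ''C'' (int v) = lab v \<and> 0 \<le> lab v \<and> lab v < int n"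
    "set ps \<subseteq> {0..<int n}" "\<And>p. 0 \<le> p \<Longrightarrow> p < int n \<Longrightarrow> s ''O'' p = (if p \<in> set ps then 1 else 0)"
    "s ''pl'' 0 = int (length ps)" "ps \<noteq> [] \<Longrightarrow> s ''fst'' 0 = hd ps" "ps \<noteq> [] \<Longrightarrow> s ''lst'' 0 = last ps"
    "s ''t'' 0 = int t"
    using rep unfolding c rep_def by simp_all
  have fr1: "frame {''p'', ''p2''} s s1" unfolding s1_def frame_def by simp
  have s1: "s1 ''p'' 0 = s ''lst'' 0" "s1 ''p2'' 0 = lab w"
    using r(1)[OF w(2)] w(1) unfolding s1_def by simp_all
  have env1: "env n S U s1" by (rule env_frame[OF env fr1]) simp
  have lab1: "s1 ''C'' (int v) = lab v" if "v < n" for v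
    using r(1)[OF that] frameD[OF fr1] by simp
  have "runs N (Seq adjc push_tail) s1 (\<lambda>s'. rep n s' (push E w c))"
  proof (rule runs_Seq[OF runs_adjc[OF env1 nN lab1 edge_lt]])
    fix s2 assume fr: "frame (mods adjc) s1 s2"
      and a: "(s2 ''af'' 0 = 1 \<longleftrightarrow> adj E lab (s1 ''p'' 0) (s1 ''p2'' 0)) \<and>
        (s2 ''sf'' 0 = 1 \<longleftrightarrow> adj S lab (s1 ''p'' 0) (s1 ''p2'' 0))"
    have st: "s2 y = s y" if "y \<notin> {''p'', ''p2'', ''af'', ''sf'', ''x'', ''y''}" for y
      using that frameD[OF fr, of y] frameD[OF fr1, of y] by simp
    have s2: "s2 ''p2'' 0 = lab w" "s2 ''af'' 0 = 1 \<longleftrightarrow> adj E lab (s ''lst'' 0) (lab w)"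
      using frameD[OF fr, of "''p2''"] a s1 by simp_all
    have lw: "0 \<le> lab w" "lab w < int n" using r(1)[OF w(2)] by auto
    define go where "go \<longleftrightarrow> ps = [] \<or> adj E lab (last ps) (lab w) \<and> lab w \<notin> set ps"
    have go: "bval (Or (Less (Var ''pl'') (Const 1))
       (And (Eq (Var ''af'') (Const 1)) (Less (Cell ''O'' (Var ''p2'')) (Const 1)))) s2 \<longleftrightarrow> go"
    proof (cases "ps = []")
      \<comment> \<open>For the empty walk \<open>lst\<close> may be stale and the flag
        \<open>af\<close> meaningless, but the test of \<open>pl\<close> already decides.\<close>
      case True
      then show ?thesis using r(4) st unfolding go_def by simp
    next
      case False
      then have "0 < length ps" by simp
      then have "\<not> int (length ps) < 1" by linarith
      then show ?thesis using False r(4) r(6)[OF False] r(3)[OF lw] s2 st unfolding go_def by simp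
    qed
    have "rep n (ev push_tail s2) (push E w c)"
    proof (cases go)
      case False
      then have "ev push_tail s2 = s2"
        using go unfolding push_tail_def by (simp only: ev.simps if_False)
      moreover have "push E w c = c" using False unfolding c push_def go_def by auto
      ultimately show ?thesis using rep st unfolding rep_def c by simp
    next
      case True
      have p: "push E w c = (lab, ps @ [lab w], t)" using True unfolding c push_def go_def by auto
      define s3 where "s3 = ev push_tail s2"
      have "s3 = ev (Seq (If (Less (Var ''pl'') (Const 1)) (Set ''fst'' (Var ''p2'')) Skip)
       (Seq (Set ''lst'' (Var ''p2''))
         (Seq (Assign ''O'' (Var ''p2'') (Const 1)) (Set ''pl'' (Add (Var ''pl'') (Const 1)))))) s2"
        using True go unfolding s3_def push_tail_def by simp
      then have s3: "s3 ''C'' = s ''C''" "s3 ''t'' = s ''t''" "s3 ''pl'' 0 = int (length ps) + 1"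
          "s3 ''lst'' 0 = lab w" "s3 ''O'' = (s ''O'')(lab w := 1)"
          "s3 ''fst'' 0 = (if ps = [] then lab w else s ''fst'' 0)"
        using s2(1) r(4) st by simp_all
      show ?thesis unfolding p rep_def s3_def[symmetric] using r lw by (auto simp: s3)
    qed
    then show "runs N push_tail s2 (\<lambda>s'. rep n s' (push E w c))"
      by (intro runs_loop_free) (simp_all add: push_tail_def)
  qed
  then show ?thesis unfolding push_com_def s1_def by (rule runs_Seq_ev[rotated]) simp
qed

lemma runs_close:
  assumes env: "env n S U s" and rep: "rep n s c"
  shows "runs N close_com s (\<lambda>s'. rep n s' (close S E c))"
proof -
  obtain lab ps t where c: "c = (lab, ps, t)" by (cases c)
  define s1 where "s1 = ev (Seq (Set ''p'' (Var ''lst'')) (Set ''p2'' (Var ''fst''))) s"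
  have r: "\<And>v. v < n \<Longrightarrow> s ''C'' (int v) = lab v \<and> 0 \<le> lab v \<and> lab v < int n"
    "set ps \<subseteq> {0..<int n}" "\<And>p. 0 \<le> p \<Longrightarrow> p < int n \<Longrightarrow> s ''O'' p = (if p \<in> set ps then 1 else 0)"
    "s ''pl'' 0 = int (length ps)" "ps \<noteq> [] \<Longrightarrow> s ''fst'' 0 = hd ps" "ps \<noteq> [] \<Longrightarrow> s ''lst'' 0 = last ps"
    "s ''t'' 0 = int t"
    using rep unfolding c rep_def by simp_all
  have fr1: "frame {''p'', ''p2''} s s1" unfolding s1_def frame_def by simp
  have s1: "s1 ''p'' 0 = s ''lst'' 0" "s1 ''p2'' 0 = s ''fst'' 0" unfolding s1_def by simp_all
  have env1: "env n S U s1" by (rule env_frame[OF env fr1]) simp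
  have lab1: "s1 ''C'' (int v) = lab v" if "v < n" for v
    using r(1)[OF that] frameD[OF fr1] by simp
  let ?loop1 = "For ''i'' ''n'' (If (Eq (Cell ''O'' (Cell ''C'' (Var ''i''))) (Const 1))
                (Assign ''C'' (Var ''i'') (Var ''fst'')) Skip)"
  let ?loop2 = "For ''i'' ''n'' (Assign ''O'' (Var ''i'') (Const 0))"
  let ?tail = "Seq close_head (Seq ?loop1 (Seq ?loop2 (Set ''pl'' (Const 0))))"
  let ?cond = "Or (And (Less (Const 2) (Var ''pl'')) (Eq (Var ''af'') (Const 1)))
             (And (Eq (Var ''pl'') (Const 2)) (Eq (Var ''sf'') (Const 1)))"
  have "runs N (Seq adjc (If ?cond ?tail Skip)) s1 (\<lambda>s'. rep n s' (close S E c))"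
  proof (rule runs_Seq[OF runs_adjc[OF env1 nN lab1 edge_lt]])
    fix s2 assume fr: "frame (mods adjc) s1 s2"
      and a: "(s2 ''af'' 0 = 1 \<longleftrightarrow> adj E lab (s1 ''p'' 0) (s1 ''p2'' 0)) \<and>
        (s2 ''sf'' 0 = 1 \<longleftrightarrow> adj S lab (s1 ''p'' 0) (s1 ''p2'' 0))"
    have st: "s2 y = s y" if "y \<notin> {''p'', ''p2'', ''af'', ''sf'', ''x'', ''y''}" for y
      using that frameD[OF fr, of y] frameD[OF fr1, of y] by simp
    have s2: "s2 ''af'' 0 = 1 \<longleftrightarrow> adj E lab (s ''lst'' 0) (s ''fst'' 0)" 
        "s2 ''sf'' 0 = 1 \<longleftrightarrow> adj S lab (s ''lst'' 0) (s ''fst'' 0)"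
      using a s1 by simp_all
    define go where "go \<longleftrightarrow> 3 \<le> length ps \<and> adj E lab (last ps) (hd ps) \<or> length ps = 2 \<and> adj S lab (last ps) (hd ps)"
    have go: "bval ?cond s2 \<longleftrightarrow> go"
    proof (cases "ps = []")
      case True
      then show ?thesis using r(4) st unfolding go_def by simp
    next
      case False
      have "2 < int (length ps) \<longleftrightarrow> 3 \<le> length ps" "int (length ps) = 2 \<longleftrightarrow> length ps = 2" by linarith+
      then show ?thesis using r(4) r(5,6)[OF False] s2 st unfolding go_def by simp
    qed
    show "runs N (If ?cond ?tail Skip) s2 (\<lambda>s'. rep n s' (close S E c))"
    proof (rule runs_If)
      assume "\<not> bval ?cond s2"
      then have "close S E c = c" using go unfolding c close_def go_def by auto
      then show "runs N Skip s2 (\<lambda>s'. rep n s' (close S E c))"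
        using rep st unfolding rep_def c by (intro runs_Skip) simp
    next
      assume "bval ?cond s2"
      then have g: go using go by simp
      then have ne: "ps \<noteq> []" and l2: "2 \<le> length ps" unfolding go_def by auto
      have cl: "close S E c = (merge lab ps, [], t + profit ps)"
        using g unfolding c close_def go_def by (simp only: prod.case if_True)
      have hdr: "0 \<le> hd ps" "hd ps < int n" using r(2) hd_in_set[OF ne] by (auto dest: subsetD)
      show "runs N ?tail s2 (\<lambda>s'. rep n s' (close S E c))"
      proof (rule runs_Seq[OF runs_loop_free[where Q = "\<lambda>s'. s' ''t'' 0 = int (t + profit ps)"]])
        show "loop_free close_head" unfolding close_head_def by simp
        show "ev close_head s2 ''t'' 0 = int (t + profit ps)"
          using st r(4,7) l2 unfolding close_head_def profit_def by (simp add: of_nat_diff)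
      next
        fix s3 assume fr3: "frame (mods close_head) s2 s3" and t3: "s3 ''t'' 0 = int (t + profit ps)"
        have st3: "s3 y = s y" if "y \<notin> {''p'', ''p2'', ''af'', ''sf'', ''x'', ''y'', ''t''}" for y
          using that frameD[OF fr3, of y] st[of y] unfolding close_head_def by simp
        have n3: "s3 ''n'' 0 = int n" using st3 env unfolding env_def by simp
        show "runs N (Seq ?loop1 (Seq ?loop2 (Set ''pl'' (Const 0)))) s3 (\<lambda>s'. rep n s' (close S E c))"
        proof (rule runs_Seq[OF runs_For[where M = n and Q = "\<lambda>s'. \<forall>v<n. s' ''C'' (int v) = merge lab ps v"
            and I = "\<lambda>i s'. \<forall>v<n. s' ''C'' (int v) = (if v < i then merge lab ps v else lab v)"]])
          fix i s4 assume i: "i < n" and I: "\<forall>v<n. s4 ''C'' (int v) = (if v < i then merge lab ps v else lab v)"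
            and x: "s4 ''i'' 0 = int i" and fr4: "frame (insert ''i'' (mods (If (Eq (Cell ''O'' (Cell ''C'' (Var ''i''))) (Const 1))
                (Assign ''C'' (Var ''i'') (Var ''fst'')) Skip))) s3 s4"
          have C: "s4 ''C'' (int i) = lab i" using I i by simp
          have O: "s4 ''O'' = s ''O''" "s4 ''fst'' = s ''fst''"
            using frameD[OF fr4] st3 by simp_all
          have Oi: "s ''O'' (lab i) = 1 \<longleftrightarrow> lab i \<in> set ps" using r(1)[OF i] r(3) by simp
          show "runs N (If (Eq (Cell ''O'' (Cell ''C'' (Var ''i''))) (Const 1))
                (Assign ''C'' (Var ''i'') (Var ''fst'')) Skip) s4
               (\<lambda>s''. \<forall>v<n. update s'' ''i'' 0 (int (Suc i)) ''C'' (int v) =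
                 (if v < Suc i then merge lab ps v else lab v))"
            using I C r(5)[OF ne] by (intro runs_loop_free) (auto simp: x O Oi merge_def less_Suc_eq)
        next
          show "\<forall>v<n. update s3 ''i'' 0 0 ''C'' (int v) = (if v < 0 then merge lab ps v else lab v)"
            using st3 r(1) by simp
        next
          fix s4 assume fr4: "frame (mods ?loop1) s3 s4" and C4: "\<forall>v<n. s4 ''C'' (int v) = merge lab ps v"
          have t4: "s4 ''t'' 0 = int (t + profit ps)" "s4 ''n'' 0 = int n"
            using frameD[OF fr4] t3 n3 by simp_all
          show "runs N (Seq ?loop2 (Set ''pl'' (Const 0))) s4 (\<lambda>s'. rep n s' (close S E c))"
          proof (rule runs_Seq[OF runs_For[where M = n and Q = "\<lambda>s'. \<forall>v<n. s' ''O'' (int v) = 0"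
              and I = "\<lambda>i s'. \<forall>v<i. s' ''O'' (int v) = 0"]])
            fix i s5 assume I: "\<forall>v<i. s5 ''O'' (int v) = 0" and x: "s5 ''i'' 0 = int i"
            then show "runs N (Assign ''O'' (Var ''i'') (Const 0)) s5
               (\<lambda>s''. \<forall>v<Suc i. update s'' ''i'' 0 (int (Suc i)) ''O'' (int v) = 0)"
              by (intro runs_loop_free) (auto simp: less_Suc_eq)
          next
            fix s5 assume fr5: "frame (mods ?loop2) s4 s5" and O5: "\<forall>v<n. s5 ''O'' (int v) = 0"
            have O5': "s5 ''O'' p = 0" if "0 \<le> p" "p < int n" for p
              using O5[rule_format, of "nat p"] that by simp
            have s5: "s5 ''C'' = s4 ''C''" "s5 ''t'' = s4 ''t''" using frameD[OF fr5] by simp_all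
            have "rep n (ev (Set ''pl'' (Const 0)) s5) (merge lab ps, [], t + profit ps)"
              unfolding rep_def using C4 O5' t4 r(1) hdr by (auto simp: s5 merge_def)
            then show "runs N (Set ''pl'' (Const 0)) s5 (\<lambda>s'. rep n s' (close S E c))"
              unfolding cl by (intro runs_loop_free) simp_all
          qed (use nN t4 in auto)
        qed (use nN n3 in auto)
      qed
    qed
  qed
  then show ?thesis unfolding close_com_def s1_def by (rule runs_Seq_ev[rotated]) simp
qed

end

section \<open>Selection by rank and decoding of digits\<close>

text \<open>The element of rank \<open>j\<close>, counted from 0, among the numbers below the bound
  that satisfy \<open>P\<close>. Ranks are cardinalities, which suits both the loop invariant and
  the counting of addressed vertices.\<close>

primrec select :: "(nat \<Rightarrow> bool) \<Rightarrow> nat \<Rightarrow> nat \<Rightarrow> nat option" where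
  "select P 0 j = None"
| "select P (Suc i) j = (if P i \<and> card {i'. i' < i \<and> P i'} = j then Some i else select P i j)"

lemma select_less: "select P i j = Some w \<Longrightarrow> w < i"
  by (induction i) (auto split: if_splits)

lemma card_less_Suc_Collect:
  "card {i'. i' < Suc i \<and> P i'} = card {i'. i' < i \<and> P i'} + (if P i then 1 else 0)"
proof -
  have "{i'. i' < Suc i \<and> P i'} = (if P i then insert i {i'. i' < i \<and> P i'} else {i'. i' < i \<and> P i'})"
    by (auto simp: less_Suc_eq)
  then show ?thesis by simp
qed

lemma select_eq: "w < i \<Longrightarrow> P w \<Longrightarrow> card {i'. i' < w \<and> P i'} = j \<Longrightarrow> select P i j = Some w"
proof (induction i)
  case (Suc i)
  show ?case
  proof (cases "w = i")
    case True
    then show ?thesis using Suc.prems by simp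
  next
    case False
    then have "w < i" using Suc.prems(1) by simp
    then have "{i'. i' < w \<and> P i'} \<subset> {i'. i' < i \<and> P i'}" using Suc.prems(2) by auto
    then have "card {i'. i' < w \<and> P i'} < card {i'. i' < i \<and> P i'}" by (intro psubset_card_mono) simp_all
    then have "j < card {i'. i' < i \<and> P i'}" using Suc.prems(3) by simp
    then show ?thesis using Suc \<open>w < i\<close> by simp
  qed
qed simp

definition row_hit :: "store \<Rightarrow> int \<Rightarrow> nat \<Rightarrow> bool" where
  "row_hit s z i \<longleftrightarrow> 0 < s ''G'' (s ''R'' z + int i)"

text \<open>Defined on raw cells, so that it agrees with the program even if the second digit is no
  index of a cover vertex. Such a triple selects some vertex or none, and \<open>push\<close>
  ignores inadmissible vertices.\<close>

definition decode :: "nat \<Rightarrow> store \<Rightarrow> nat \<Rightarrow> nat \<Rightarrow> nat \<Rightarrow> nat option" where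
  "decode n s a b j = select (\<lambda>i. row_hit s (s ''H'' (int a)) i \<and> row_hit s (s ''H'' (int b)) i) n j"

definition decode_com :: com where
  "decode_com = Seq
     (Seq (Set ''a'' (Cell ''H'' (Sub (Var ''d'') (Var ''h''))))
       (Seq (Set ''b'' (Cell ''H'' (Cell ''D'' (Var ''pos''))))
         (Seq (Set ''j'' (Cell ''D'' (Add (Var ''pos'') (Const 1)))) (Set ''pos'' (Add (Var ''pos'') (Const 2))))))
     (For ''i'' ''n'' (If (And (Less (Const 0) (entry ''a'' ''i'')) (Less (Const 0) (entry ''b'' ''i'')))
       (Seq (If (Eq (Var ''j'') (Const 0)) (Set ''w'' (Var ''i'')) Skip)
         (Set ''j'' (Sub (Var ''j'') (Const 1)))) Skip))"

definition token_head :: com where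
  "token_head = Seq (Set ''d'' (Cell ''D'' (Var ''pos''))) (Seq (Set ''pos'' (Add (Var ''pos'') (Const 1)))
     (Seq (Set ''w'' (Const (-1)))
       (If (And (Less (Const 0) (Var ''d'')) (Not (Less (Var ''h'') (Var ''d''))))
         (Set ''w'' (Cell ''H'' (Var ''d''))) Skip)))"

definition token_com :: com where
  "token_com = Seq token_head
     (Seq (If (And (Less (Var ''h'') (Var ''d'')) (Not (Less (Add (Var ''h'') (Var ''h'')) (Var ''d'')))) decode_com Skip)
       (Seq (If (Not (Less (Var ''w'') (Const 0))) push_com Skip)
         (If (Less (Add (Var ''h'') (Var ''h'')) (Var ''d'')) close_com Skip)))"

lemma mods_decode_com [simp]: "mods decode_com = {''a'', ''b'', ''j'', ''pos'', ''i'', ''w''}"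
  unfolding decode_com_def by auto

lemma mods_token_head [simp]: "mods token_head = {''d'', ''pos'', ''w''}"
  unfolding token_head_def by auto

lemma mods_token_com [simp]: "mods token_com = {''d'', ''pos'', ''w'', ''a'', ''b'', ''j'', ''i'',
    ''p'', ''p2'', ''af'', ''sf'', ''x'', ''y'', ''fst'', ''lst'', ''O'', ''pl'', ''t'', ''C''}"
  unfolding token_com_def by auto

context ram
begin

lemma runs_decode:
  assumes env: "env n S U s" and st: "s ''w'' 0 = -1" "s ''pos'' 0 = int (pos + 1)"
    "s ''d'' 0 = int (dg pos)" "s ''h'' 0 = int h" "h < dg pos" "\<And>i. s ''D'' (int i) = int (dg i)"
  shows "runs N decode_com s (\<lambda>s'. s' ''pos'' 0 = int (pos + 3) \<and>
    s' ''w'' 0 = (case decode n s (dg pos - h) (dg (pos + 1)) (dg (pos + 2)) of None \<Rightarrow> -1 | Some w \<Rightarrow> int w))"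
proof -
  define P where "P i \<longleftrightarrow> row_hit s (s ''H'' (int (dg pos - h))) i \<and> row_hit s (s ''H'' (int (dg (pos + 1)))) i" for i
  define j0 where "j0 = dg (pos + 2)"
  let ?head = "Seq (Set ''a'' (Cell ''H'' (Sub (Var ''d'') (Var ''h''))))
       (Seq (Set ''b'' (Cell ''H'' (Cell ''D'' (Var ''pos''))))
         (Seq (Set ''j'' (Cell ''D'' (Add (Var ''pos'') (Const 1)))) (Set ''pos'' (Add (Var ''pos'') (Const 2)))))"
  let ?b = "If (And (Less (Const 0) (entry ''a'' ''i'')) (Less (Const 0) (entry ''b'' ''i'')))
       (Seq (If (Eq (Var ''j'') (Const 0)) (Set ''w'' (Var ''i'')) Skip)
         (Set ''j'' (Sub (Var ''j'') (Const 1)))) Skip"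
  have D: "s ''D'' (1 + int pos) = int (dg (pos + 1))" "s ''D'' (1 + int pos + 1) = int (dg (pos + 2))"
    using st(6)[of "pos + 1"] st(6)[of "pos + 2"] by (simp_all add: add.commute)
  have "runs N (Seq ?head (For ''i'' ''n'' ?b)) s (\<lambda>s'. s' ''pos'' 0 = int (pos + 3) \<and>
      s' ''w'' 0 = (case select P n j0 of None \<Rightarrow> -1 | Some w \<Rightarrow> int w))"
  proof (rule runs_Seq[OF runs_loop_free[where Q = "\<lambda>s'. s' = ev ?head s"]])
    fix s1 assume fr1: "frame (mods ?head) s s1" and s1: "s1 = ev ?head s"
    have a: "s1 ''a'' 0 = s ''H'' (int (dg pos - h))" "s1 ''b'' 0 = s ''H'' (int (dg (pos + 1)))"
        "s1 ''j'' 0 = int j0" "s1 ''pos'' 0 = int (pos + 3)" "s1 ''w'' 0 = -1" "s1 ''n'' 0 = int n"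
      using st env D unfolding s1 j0_def env_def by (simp_all add: of_nat_diff add.commute)
    have GR: "s1 ''G'' = s ''G''" "s1 ''R'' = s ''R''" using frameD[OF fr1] by simp_all
    show "runs N (For ''i'' ''n'' ?b) s1 (\<lambda>s'. s' ''pos'' 0 = int (pos + 3) \<and>
      s' ''w'' 0 = (case select P n j0 of None \<Rightarrow> -1 | Some w \<Rightarrow> int w))"
    \<comment> \<open>\<open>j\<close> falls by one at each common neighbour and passes 0 only once;
      the neighbour met while it is 0 is the selected one. Afterwards \<open>j\<close> is negative
      and \<open>w\<close> stays fixed.\<close>
    proof (rule runs_For[where M = n and I = "\<lambda>i s'. s' ''j'' 0 = int j0 - int (card {i'. i' < i \<and> P i'}) \<and>
        s' ''w'' 0 = (case select P i j0 of None \<Rightarrow> -1 | Some w \<Rightarrow> int w)"])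
      fix i s2 assume i: "i < n" and fr: "frame (insert ''i'' (mods ?b)) s1 s2" and x: "s2 ''i'' 0 = int i"
        and I: "s2 ''j'' 0 = int j0 - int (card {i'. i' < i \<and> P i'}) \<and>
          s2 ''w'' 0 = (case select P i j0 of None \<Rightarrow> -1 | Some w \<Rightarrow> int w)"
      have "s2 ''G'' = s ''G''" "s2 ''R'' = s ''R''" "s2 ''a'' = s1 ''a''" "s2 ''b'' = s1 ''b''"
        using frameD[OF fr] GR by simp_all
      then have c: "bval (And (Less (Const 0) (entry ''a'' ''i'')) (Less (Const 0) (entry ''b'' ''i''))) s2 \<longleftrightarrow> P i"
        using a(1,2) x unfolding P_def row_hit_def by simp
      have j: "s2 ''j'' 0 = 0 \<longleftrightarrow> card {i'. i' < i \<and> P i'} = j0" using I by auto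
      have e: "ev ?b s2 ''j'' 0 = s2 ''j'' 0 - (if P i then 1 else 0)"
          "ev ?b s2 ''w'' 0 = (if P i \<and> card {i'. i' < i \<and> P i'} = j0 then int i else s2 ''w'' 0)"
        using c x j by (simp_all del: bval.simps)
      show "runs N ?b s2 (\<lambda>s''. update s'' ''i'' 0 (int (Suc i)) ''j'' 0 = int j0 - int (card {i'. i' < Suc i \<and> P i'}) \<and>
         update s'' ''i'' 0 (int (Suc i)) ''w'' 0 = (case select P (Suc i) j0 of None \<Rightarrow> -1 | Some w \<Rightarrow> int w))"
        by (intro runs_loop_free) (use I in \<open>simp_all add: e card_less_Suc_Collect del: ev.simps\<close>)
    next
      fix s2 assume "s2 ''j'' 0 = int j0 - int (card {i'. i' < n \<and> P i'}) \<and>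
          s2 ''w'' 0 = (case select P n j0 of None \<Rightarrow> -1 | Some w \<Rightarrow> int w)"
        and fr: "frame (insert ''i'' (mods ?b)) s1 s2"
      then show "s2 ''pos'' 0 = int (pos + 3) \<and> s2 ''w'' 0 = (case select P n j0 of None \<Rightarrow> -1 | Some w \<Rightarrow> int w)"
        using frameD[OF fr] a(4) by simp
    qed (use a nN in auto)
  qed simp_all
  then show ?thesis unfolding decode_com_def decode_def P_def j0_def .
qed

lemma runs_token:
  assumes env: "env n S U s" and rep: "rep n s c" 
    and st: "s ''pos'' 0 = int pos" "s ''h'' 0 = int h" "\<And>i. s ''D'' (int i) = int (dg i)"
      "\<And>d. 1 \<le> d \<Longrightarrow> d \<le> h \<Longrightarrow> s ''H'' (int d) = int (hv d) \<and> hv d < n"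
  shows "runs N token_com s (\<lambda>s'. s' ''pos'' 0 = int (fst (nxt S E h hv (decode n s) dg (pos, c))) \<and>
    rep n s' (snd (nxt S E h hv (decode n s) dg (pos, c))))"
proof -
  define d where "d = dg pos"
  \<comment> \<open>\<open>wo\<close> is the vertex that the digit asks to push, if any. In the
    store \<open>None\<close> becomes -1, which is no vertex.\<close>
  define wo where "wo = (if 1 \<le> d \<and> d \<le> h then Some (hv d)
     else if h < d \<and> d \<le> 2 * h then decode n s (d - h) (dg (pos + 1)) (dg (pos + 2)) else None)"
  define pos' where "pos' = (if h < d \<and> d \<le> 2 * h then pos + 3 else pos + 1)"
  define c1 where "c1 = (case wo of None \<Rightarrow> c | Some w \<Rightarrow> push E w c)"
  define enc where "enc v = (case v of None \<Rightarrow> - 1 | Some w \<Rightarrow> int w)" for v :: "nat option"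
  have nx: "nxt S E h hv (decode n s) dg (pos, c) = (pos', if 2 * h < d then close S E c1 else c1)"
  proof -
    consider "d = 0" | "1 \<le> d" "d \<le> h" | "h < d" "d \<le> 2 * h" | "2 * h < d" by linarith
    then show ?thesis
      by cases (simp_all add: nxt_def pos'_def c1_def wo_def d_def)
  qed
  have wo_less: "w < n" if "wo = Some w" for w
    using that st(4)[of d] select_less unfolding wo_def decode_def by (auto split: if_splits)
  have d0: "(0::int) < int d \<longleftrightarrow> 1 \<le> d" "int h < int d \<longleftrightarrow> h < d" "int h + int h < int d \<longleftrightarrow> 2 * h < d"
    by linarith+
  let ?c2 = "If (And (Less (Var ''h'') (Var ''d'')) (Not (Less (Add (Var ''h'') (Var ''h'')) (Var ''d'')))) decode_com Skip"
  let ?c3 = "If (Not (Less (Var ''w'') (Const 0))) push_com Skip"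
  let ?c4 = "If (Less (Add (Var ''h'') (Var ''h'')) (Var ''d'')) close_com Skip"
  show ?thesis
    unfolding nx token_com_def fst_conv snd_conv
  proof (rule runs_Seq[OF runs_loop_free[where Q = "\<lambda>s'. s' = ev token_head s"]])
    show "loop_free token_head" unfolding token_head_def by simp
    fix s1 assume fr1: "frame (mods token_head) s s1" and s1: "s1 = ev token_head s"
    have a1: "s1 ''d'' 0 = int d" "s1 ''pos'' 0 = int (pos + 1)" "s1 ''h'' 0 = int h"
        "s1 ''w'' 0 = (if 1 \<le> d \<and> d \<le> h then int (hv d) else -1)"
      using st(1-3) st(4)[of d] d0 unfolding s1 token_head_def d_def[symmetric]
      by (auto simp: d_def[symmetric] not_less)
    have env1: "env n S U s1" by (rule env_frame[OF env fr1]) simp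
    have rep1: "rep n s1 c" by (rule rep_frame[OF rep fr1]) simp
    have GRHD: "s1 ''G'' = s ''G''" "s1 ''R'' = s ''R''" "s1 ''H'' = s ''H''" "s1 ''D'' = s ''D''"
      using frameD[OF fr1] by simp_all
    have dec1: "decode n s1 = decode n s" unfolding decode_def row_hit_def GRHD by simp
    show "runs N (Seq ?c2 (Seq ?c3 ?c4)) s1 
        (\<lambda>s'. s' ''pos'' 0 = int pos' \<and> rep n s' (if 2 * h < d then close S E c1 else c1))"
    proof (rule runs_Seq[where R = "\<lambda>s'. s' ''pos'' 0 = int pos' \<and> s' ''w'' 0 = enc wo"])
      show "runs N ?c2 s1 (\<lambda>s'. s' ''pos'' 0 = int pos' \<and> s' ''w'' 0 = enc wo)"
      proof (rule runs_If)
        assume "bval (And (Less (Var ''h'') (Var ''d'')) (Not (Less (Add (Var ''h'') (Var ''h'')) (Var ''d'')))) s1"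
        then have hd: "h < d" "d \<le> 2 * h" using a1 d0 by auto
        show "runs N decode_com s1 (\<lambda>s'. s' ''pos'' 0 = int pos' \<and> s' ''w'' 0 = enc wo)"
        proof (rule runs_mono[OF runs_decode[OF env1]])
          show "s1 ''w'' 0 = -1" "s1 ''pos'' 0 = int (pos + 1)" "s1 ''d'' 0 = int (dg pos)" "s1 ''h'' 0 = int h" "h < dg pos"
            using a1 hd unfolding d_def by simp_all
          show "s1 ''D'' (int i) = int (dg i)" for i using st(3) GRHD by simp
        next
          fix s' assume "s' ''pos'' 0 = int (pos + 3) \<and> s' ''w'' 0 =
            (case decode n s1 (dg pos - h) (dg (pos + 1)) (dg (pos + 2)) of None \<Rightarrow> - 1 | Some w \<Rightarrow> int w)"
          then show "s' ''pos'' 0 = int pos' \<and> s' ''w'' 0 = enc wo"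
            using hd unfolding dec1 pos'_def enc_def wo_def d_def by simp
        qed
      next
        assume "\<not> bval (And (Less (Var ''h'') (Var ''d'')) (Not (Less (Add (Var ''h'') (Var ''h'')) (Var ''d'')))) s1"
        then have hd: "\<not> (h < d \<and> d \<le> 2 * h)" using a1 d0 by auto
        show "runs N Skip s1 (\<lambda>s'. s' ''pos'' 0 = int pos' \<and> s' ''w'' 0 = enc wo)"
          by (rule runs_Skip) (use a1 hd in \<open>auto simp: pos'_def enc_def wo_def\<close>)
      qed
    next
      fix s2 assume fr2: "frame (mods ?c2) s1 s2" and a2: "s2 ''pos'' 0 = int pos' \<and> s2 ''w'' 0 = enc wo"
      have env2: "env n S U s2" by (rule env_frame[OF env1 fr2]) simp
      have rep2: "rep n s2 c" by (rule rep_frame[OF rep1 fr2]) simp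
      have h2: "s2 ''h'' 0 = int h" "s2 ''d'' 0 = int d" using frameD[OF fr2] a1 by simp_all
      show "runs N (Seq ?c3 ?c4) s2 (\<lambda>s'. s' ''pos'' 0 = int pos' \<and> rep n s' (if 2 * h < d then close S E c1 else c1))"
      proof (rule runs_Seq[where R = "\<lambda>s'. rep n s' c1"])
        show "runs N ?c3 s2 (\<lambda>s'. rep n s' c1)"
        proof (cases wo)
          case None
          then have "runs N Skip s2 (\<lambda>s'. rep n s' c1)" using rep2 unfolding c1_def by (intro runs_Skip) simp
          moreover have "\<not> bval (Not (Less (Var ''w'') (Const 0))) s2" using a2 None unfolding enc_def by simp
          ultimately show ?thesis by (intro runs_If) simp_all
        next
          case (Some w)
          have "runs N push_com s2 (\<lambda>s'. rep n s' (push E w c))"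
            by (rule runs_push[OF env2 rep2 _ wo_less[OF Some]]) (use a2 Some in \<open>simp add: enc_def\<close>)
          moreover have "bval (Not (Less (Var ''w'') (Const 0))) s2" using a2 Some unfolding enc_def by simp
          ultimately show ?thesis using Some unfolding c1_def by (intro runs_If) simp_all
        qed
      next
        fix s3 assume fr3: "frame (mods ?c3) s2 s3" and rep3: "rep n s3 c1"
        have env3: "env n S U s3" by (rule env_frame[OF env2 fr3]) simp
        have h3: "s3 ''h'' 0 = int h" "s3 ''d'' 0 = int d" "s3 ''pos'' 0 = int pos'" 
          using frameD[OF fr3] h2 a2 by simp_all
        show "runs N ?c4 s3 (\<lambda>s'. s' ''pos'' 0 = int pos' \<and> rep n s' (if 2 * h < d then close S E c1 else c1))"
        proof (rule runs_If)
          assume "bval (Less (Add (Var ''h'') (Var ''h'')) (Var ''d'')) s3"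
          then have hd: "2 * h < d" using h3 d0 by simp
          show "runs N close_com s3 (\<lambda>s'. s' ''pos'' 0 = int pos' \<and> rep n s' (if 2 * h < d then close S E c1 else c1))"
          proof (rule runs_mono[OF runs_close[OF env3 rep3]])
            fix s' assume "frame (mods close_com) s3 s'" "rep n s' (close S E c1)"
            then show "s' ''pos'' 0 = int pos' \<and> rep n s' (if 2 * h < d then close S E c1 else c1)"
              using hd h3 frameD[of "mods close_com" s3 s' "''pos''"] by simp
          qed
        next
          assume "\<not> bval (Less (Add (Var ''h'') (Var ''h'')) (Var ''d'')) s3"
          then have "\<not> 2 * h < d" using h3 d0 by simp
          then show "runs N Skip s3 (\<lambda>s'. s' ''pos'' 0 = int pos' \<and> rep n s' (if 2 * h < d then close S E c1 else c1))"
            using rep3 h3 by (intro runs_Skip) simp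
        qed
      qed
    qed
  qed simp
qed

end

section \<open>Evaluation of one digit string\<close>

definition init_com :: com where
  "init_com = For ''i'' ''n'' (Seq (Assign ''C'' (Var ''i'') (Var ''i'')) (Assign ''O'' (Var ''i'') (Const 0)))"

definition zero_com :: com where
  "zero_com = For ''i'' ''n'' (Assign ''M'' (Var ''i'') (Const 0))"

definition close_cond :: bexp where
  "close_cond = And (Less (Const 0) (entry ''x'' ''y''))
     (Or (Less (Cell ''O'' (Cell ''C'' (Var ''y''))) (Const 1)) (Eq (Cell ''C'' (Var ''y'')) (Var ''fst'')))"

definition closable_com :: com where
  "closable_com = Seq zero_com (Seq (Assign ''M'' (Var ''lst'') (Const 1)) (Seq (clo close_cond)
     (If (Eq (Cell ''M'' (Var ''fst'')) (Const 1)) (Set ''acc'' (Const 1)) Skip)))"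

definition accept_com :: com where
  "accept_com = Seq (Seq (Set ''acc'' (Const 0)) (If (Not (Less (Var ''t'') (Var ''q''))) (Set ''acc'' (Const 1)) Skip))
     (If (And (Less (Const 2) (Var ''pl'')) (Not (Less (Add (Var ''t'') (Var ''pl'')) (Add (Var ''q'') (Const 2)))))
       closable_com Skip)"

definition check_com :: com where
  "check_com = Seq init_com (Seq (Seq (Set ''t'' (Const 0)) (Seq (Set ''pl'' (Const 0)) (Set ''pos'' (Const 0))))
     (Seq (For ''z'' ''L'' token_com) accept_com))"

lemma mods_init_com [simp]: "mods init_com = {''i'', ''C'', ''O''}"
  unfolding init_com_def by auto

lemma mods_zero_com [simp]: "mods zero_com = {''i'', ''M''}"
  unfolding zero_com_def by auto

lemma mods_closable_com [simp]: "mods closable_com = {''i'', ''r'', ''x'', ''y'', ''M'', ''acc''}"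
  unfolding closable_com_def by auto

lemma mods_accept_com [simp]: "mods accept_com = {''i'', ''r'', ''x'', ''y'', ''M'', ''acc''}"
  unfolding accept_com_def by auto

lemma mods_check_com [simp]: "mods check_com = {''d'', ''pos'', ''w'', ''a'', ''b'', ''j'', ''i'', ''z'', ''r'', ''M'', ''acc'',
    ''p'', ''p2'', ''af'', ''sf'', ''x'', ''y'', ''fst'', ''lst'', ''O'', ''pl'', ''t'', ''C''}"
  unfolding check_com_def by auto

lemma nat_range_iff: "(\<forall>v<n. Q (int v)) \<longleftrightarrow> (\<forall>p. 0 \<le> p \<and> p < int n \<longrightarrow> Q p)"
  by (metis nat_0_le nat_less_iff of_nat_0_le_iff of_nat_less_iff)

context ram
begin

lemma runs_init:
  assumes "s ''n'' 0 = int n"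
  shows "runs N init_com s (\<lambda>s'. \<forall>v<n. s' ''C'' (int v) = int v \<and> s' ''O'' (int v) = 0)"
  unfolding init_com_def
proof (rule runs_For[where M = n and I = "\<lambda>i s'. \<forall>v<i. s' ''C'' (int v) = int v \<and> s' ''O'' (int v) = 0"])
  fix i s' assume I: "\<forall>v<i. s' ''C'' (int v) = int v \<and> s' ''O'' (int v) = 0" and x: "s' ''i'' 0 = int i"
  show "runs N (Seq (Assign ''C'' (Var ''i'') (Var ''i'')) (Assign ''O'' (Var ''i'') (Const 0))) s'
     (\<lambda>s''. \<forall>v<Suc i. update s'' ''i'' 0 (int (Suc i)) ''C'' (int v) = int v \<and>
       update s'' ''i'' 0 (int (Suc i)) ''O'' (int v) = 0)"
    using I by (intro runs_loop_free) (auto simp: x less_Suc_eq)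
qed (use assms nN in auto)

lemma runs_zero:
  assumes "s ''n'' 0 = int n"
  shows "runs N zero_com s (\<lambda>s'. \<forall>p. 0 \<le> p \<and> p < int n \<longrightarrow> s' ''M'' p = 0)"
  unfolding zero_com_def
proof (rule runs_For[where M = n and I = "\<lambda>i s'. \<forall>v<i. s' ''M'' (int v) = 0"])
  fix i s' assume I: "\<forall>v<i. s' ''M'' (int v) = 0" and x: "s' ''i'' 0 = int i"
  show "runs N (Assign ''M'' (Var ''i'') (Const 0)) s'
     (\<lambda>s''. \<forall>v<Suc i. update s'' ''i'' 0 (int (Suc i)) ''M'' (int v) = 0)"
    using I by (intro runs_loop_free) (auto simp: x less_Suc_eq)
next
  fix s' assume "\<forall>v<n. s' ''M'' (int v) = 0"
  then show "\<forall>p. 0 \<le> p \<and> p < int n \<longrightarrow> s' ''M'' p = 0"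
    using nat_range_iff[of n "\<lambda>p. s' ''M'' p = 0"] by blast
qed (use assms nN in auto)

lemma runs_closable:
  assumes env: "env n S U s" and rep: "rep n s (lab, ps, t)" and ne: "ps \<noteq> []"
  shows "runs N closable_com s (\<lambda>s'. s' ''acc'' 0 = (if closable E lab ps then 1 else s ''acc'' 0))"
  unfolding closable_com_def
proof (rule runs_Seq[OF runs_zero])
  show "s ''n'' 0 = int n" using env unfolding env_def by simp
  have r: "\<And>v. v < n \<Longrightarrow> s ''C'' (int v) = lab v \<and> 0 \<le> lab v \<and> lab v < int n"
    "set ps \<subseteq> {0..<int n}" "\<And>p. 0 \<le> p \<Longrightarrow> p < int n \<Longrightarrow> s ''O'' p = (if p \<in> set ps then 1 else 0)"
    "s ''fst'' 0 = hd ps" "s ''lst'' 0 = last ps"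
    using rep ne unfolding rep_def by simp_all
  have hdps: "0 \<le> hd ps" "hd ps < int n" and lastps: "0 \<le> last ps" "last ps < int n"
    using r(2) hd_in_set[OF ne] last_in_set[OF ne] by auto
  let ?tail = "Seq (clo close_cond) (If (Eq (Cell ''M'' (Var ''fst'')) (Const 1)) (Set ''acc'' (Const 1)) Skip)"
  fix s1 assume fr1: "frame (mods zero_com) s s1" and z: "\<forall>p. 0 \<le> p \<and> p < int n \<longrightarrow> s1 ''M'' p = 0"
  define s2 where "s2 = ev (Assign ''M'' (Var ''lst'') (Const 1)) s1"
  have st2: "s2 y = s y" if "y \<notin> {''i'', ''M''}" for y
    using that frameD[OF fr1, of y] unfolding s2_def by simp
  have M2: "s2 ''M'' p = 1 \<longleftrightarrow> p \<in> {last ps}" if "0 \<le> p" "p < int n" for p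
    using z that frameD[OF fr1, of "''lst''"] r(5) unfolding s2_def by simp
  define P where "P x y \<longleftrightarrow> {x, y} \<in> E \<and> (lab y \<notin> set ps \<or> lab y = hd ps)" for x y
  define Rl where "Rl = {(s2 ''C'' (int x), s2 ''C'' (int y)) |x y. x < n \<and> y < n \<and> P x y}"
  have Rl: "Rl = {(a, b). adj E lab a b \<and> (b \<notin> set ps \<or> b = hd ps)}"
  proof -
    have "Rl = {(lab x, lab y) |x y. x < n \<and> y < n \<and> P x y}"
    proof -
      have lc: "s2 ''C'' (int v) = lab v" if "v < n" for v using st2[of "''C''"] r(1)[OF that] by simp
      show ?thesis unfolding Rl_def by (rule Collect_cong) (metis lc)
    qed
    also have "\<dots> = {(a, b). adj E lab a b \<and> (b \<notin> set ps \<or> b = hd ps)}"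
    proof (intro subset_antisym subsetI)
      fix z assume "z \<in> {(a, b). adj E lab a b \<and> (b \<notin> set ps \<or> b = hd ps)}"
      then obtain x y where xy: "z = (lab x, lab y)" "{x, y} \<in> E" "lab y \<notin> set ps \<or> lab y = hd ps"
        unfolding adj_def by blast
      then have "P x y" "x < n" "y < n" using edge_lt[OF xy(2)] unfolding P_def by simp_all
      then show "z \<in> {(lab x, lab y) |x y. x < n \<and> y < n \<and> P x y}" using xy(1) by blast
    next
      fix z assume "z \<in> {(lab x, lab y) |x y. x < n \<and> y < n \<and> P x y}"
      then show "z \<in> {(a, b). adj E lab a b \<and> (b \<notin> set ps \<or> b = hd ps)}"
        unfolding P_def adj_def by blast
    qed
    finally show ?thesis .
  qed
  have "runs N ?tail s2 (\<lambda>s'. s' ''acc'' 0 = (if closable E lab ps then 1 else s ''acc'' 0))"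
  proof (rule runs_Seq[OF runs_clo[where n = n and P = P and ?X0.0 = "{last ps}"]])
    show "s2 ''n'' 0 = int n" using st2 env unfolding env_def by simp
    show "0 \<le> s2 ''C'' (int x) \<and> s2 ''C'' (int x) < int n" if "x < n" for x
      using st2 r(1)[OF that] by simp
    show "{last ps} \<subseteq> {0..<int n}" using lastps by simp
    fix s' x y assume xy: "x < n" "y < n" "s' ''x'' 0 = int x" "s' ''y'' 0 = int y"
      and fr: "frame {''r'', ''x'', ''y'', ''M''} s2 s'"
    have "s' ''G'' = s ''G''" "s' ''R'' = s ''R''" "s' ''C'' = s ''C''" "s' ''O'' = s ''O''" "s' ''fst'' = s ''fst''"
      using frameD[OF fr] st2 by simp_all
    then show "bval close_cond s' \<longleftrightarrow> P x y"
      using xy env r(1)[OF xy(2)] r(3,4) unfolding close_cond_def P_def env_def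
      by (auto simp: edge_code_cases)
  next
    fix s3 assume fr3: "frame (mods (clo close_cond)) s2 s3" and
      M3: "\<forall>p. 0 \<le> p \<and> p < int n \<longrightarrow> (s3 ''M'' p = 1 \<longleftrightarrow>
        p \<in> {(s2 ''C'' (int x), s2 ''C'' (int y)) |x y. x < n \<and> y < n \<and> P x y}\<^sup>* `` {last ps})"
    have "s3 ''M'' (hd ps) = 1 \<longleftrightarrow> closable E lab ps"
      using M3 hdps unfolding Rl_def[symmetric] Rl closable_def by simp
    moreover have "s3 ''fst'' 0 = hd ps" "s3 ''acc'' 0 = s ''acc'' 0"
      using frameD[OF fr3] st2 r(4) by simp_all
    ultimately show "runs N (If (Eq (Cell ''M'' (Var ''fst'')) (Const 1)) (Set ''acc'' (Const 1)) Skip) s3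
       (\<lambda>s'. s' ''acc'' 0 = (if closable E lab ps then 1 else s ''acc'' 0))"
      by (intro runs_loop_free) simp_all
  qed (use nN M2 in auto)
  then show "runs N (Seq (Assign ''M'' (Var ''lst'') (Const 1)) ?tail) s1
      (\<lambda>s'. s' ''acc'' 0 = (if closable E lab ps then 1 else s ''acc'' 0))"
    unfolding s2_def by (rule runs_Seq_ev[rotated]) simp
qed

lemma runs_accept:
  assumes env: "env n S U s" and rep: "rep n s c" and q: "s ''q'' 0 = int q"
  shows "runs N accept_com s (\<lambda>s'. s' ''acc'' 0 = (if accept E q c then 1 else 0))"
proof -
  obtain lab ps t where c: "c = (lab, ps, t)" by (cases c)
  let ?head = "Seq (Set ''acc'' (Const 0)) (If (Not (Less (Var ''t'') (Var ''q''))) (Set ''acc'' (Const 1)) Skip)"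
  let ?cond = "And (Less (Const 2) (Var ''pl'')) (Not (Less (Add (Var ''t'') (Var ''pl'')) (Add (Var ''q'') (Const 2))))"
  have r: "s ''pl'' 0 = int (length ps)" "s ''t'' 0 = int t" using rep unfolding c rep_def by simp_all
  define s1 where "s1 = ev ?head s"
  have fr1: "frame {''acc''} s s1" unfolding s1_def frame_def by simp
  have acc1: "s1 ''acc'' 0 = (if q \<le> t then 1 else 0)" using q r unfolding s1_def by simp
  have env1: "env n S U s1" by (rule env_frame[OF env fr1]) simp
  have rep1: "rep n s1 c" by (rule rep_frame[OF rep fr1]) simp
  have cond: "bval ?cond s1 \<longleftrightarrow> 3 \<le> length ps \<and> q + 2 \<le> t + length ps"
  proof -
    have "2 < int (length ps) \<longleftrightarrow> 3 \<le> length ps" 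
      "int t + int (length ps) < int q + 2 \<longleftrightarrow> \<not> q + 2 \<le> t + length ps" by linarith+
    then show ?thesis using r q frameD[OF fr1] by simp
  qed
  have "runs N (If ?cond closable_com Skip) s1 (\<lambda>s'. s' ''acc'' 0 = (if accept E q c then 1 else 0))"
  proof (rule runs_If)
    assume "bval ?cond s1"
    then have b: "3 \<le> length ps \<and> q + 2 \<le> t + length ps" using cond by blast
    then have "ps \<noteq> []" by auto
    then show "runs N closable_com s1 (\<lambda>s'. s' ''acc'' 0 = (if accept E q c then 1 else 0))"
      by (intro runs_mono[OF runs_closable[OF env1 rep1[unfolded c]]])
        (use b acc1 in \<open>simp_all add: c accept_def\<close>)
  next
    assume "\<not> bval ?cond s1"
    then have "\<not> (3 \<le> length ps \<and> q + 2 \<le> t + length ps)" using cond by blast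
    then have "accept E q c \<longleftrightarrow> q \<le> t" unfolding c accept_def by auto
    then show "runs N Skip s1 (\<lambda>s'. s' ''acc'' 0 = (if accept E q c then 1 else 0))"
      using acc1 by (intro runs_Skip) simp
  qed
  then show ?thesis unfolding accept_com_def s1_def by (rule runs_Seq_ev[rotated]) simp
qed

lemma runs_check:
  assumes env: "env n S U s" and st: "s ''q'' 0 = int q" "s ''L'' 0 = int L" "L \<le> N" "s ''h'' 0 = int h"
    "\<And>i. s ''D'' (int i) = int (dg i)"
    "\<And>d. 1 \<le> d \<Longrightarrow> d \<le> h \<Longrightarrow> s ''H'' (int d) = int (hv d) \<and> hv d < n"
  shows "runs N check_com s (\<lambda>s'. s' ''acc'' 0 =
    (if accept E q (snd ((nxt S E h hv (decode n s) dg ^^ L) (0, (int, [], 0)))) then 1 else 0))"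
proof -
  let ?reset = "Seq (Set ''t'' (Const 0)) (Seq (Set ''pl'' (Const 0)) (Set ''pos'' (Const 0)))"
  let ?x = "\<lambda>k. (nxt S E h hv (decode n s) dg ^^ k) (0, (int, [], 0))"
  let ?Q = "\<lambda>s'. s' ''acc'' 0 = (if accept E q (snd (?x L)) then (1 :: int) else 0)"
  show ?thesis
    unfolding check_com_def
  proof (rule runs_Seq[OF runs_init])
    show "s ''n'' 0 = int n" using env unfolding env_def by simp
    fix s1 assume fr1: "frame (mods init_com) s s1" and I1: "\<forall>v<n. s1 ''C'' (int v) = int v \<and> s1 ''O'' (int v) = 0"
    define s2 where "s2 = ev ?reset s1"
    have O1: "s1 ''O'' p = 0" if "0 \<le> p" "p < int n" for p
      using I1[rule_format, of "nat p"] that by simp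
    have rep2: "rep n s2 (int, [], 0)" using I1 O1 unfolding s2_def rep_def by simp
    have fr2: "frame {''i'', ''C'', ''O'', ''t'', ''pl'', ''pos''} s s2"
      using fr1 unfolding s2_def frame_def by simp
    have pos2: "s2 ''pos'' 0 = int 0" unfolding s2_def by simp
    have "runs N (Seq (For ''z'' ''L'' token_com) accept_com) s2 ?Q"
    proof (rule runs_Seq[OF runs_For[where M = L and Q = "\<lambda>s'. rep n s' (snd (?x L))"
          and I = "\<lambda>k s'. s' ''pos'' 0 = int (fst (?x k)) \<and> rep n s' (snd (?x k))"]])
      show "s2 ''L'' 0 = int L" using frameD[OF fr2] st(2) by simp
      show "update s2 ''z'' 0 0 ''pos'' 0 = int (fst (?x 0)) \<and> rep n (update s2 ''z'' 0 0) (snd (?x 0))"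
        using pos2 rep2 unfolding rep_def by simp
    next
      fix k s3 assume I: "s3 ''pos'' 0 = int (fst (?x k)) \<and> rep n s3 (snd (?x k))"
        and fr3: "frame (insert ''z'' (mods token_com)) s2 s3"
      have st3: "s3 y = s y" if "y \<in> {''n'', ''G'', ''R'', ''h'', ''D'', ''H''}" for y
        using that frameD[OF fr3, of y] frameD[OF fr2, of y] by auto
      have env3: "env n S U s3" using env st3 unfolding env_def by simp
      have dec3: "decode n s3 = decode n s" using st3 unfolding decode_def row_hit_def by simp
      have "runs N token_com s3 (\<lambda>s'. s' ''pos'' 0 = int (fst (nxt S E h hv (decode n s3) dg (fst (?x k), snd (?x k)))) \<and>
          rep n s' (snd (nxt S E h hv (decode n s3) dg (fst (?x k), snd (?x k)))))"
        by (rule runs_token[OF env3]) (use I st st3 in simp_all)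
      then show "runs N token_com s3 (\<lambda>s''. update s'' ''z'' 0 (int (Suc k)) ''pos'' 0 = int (fst (?x (Suc k))) \<and>
          rep n (update s'' ''z'' 0 (int (Suc k))) (snd (?x (Suc k))))"
        by (rule runs_mono) (auto simp: dec3 rep_def)
    next
      fix s3 assume fr3: "frame (mods (For ''z'' ''L'' token_com)) s2 s3" and rep3: "rep n s3 (snd (?x L))"
      have st3: "s3 y = s y" if "y \<in> {''n'', ''G'', ''R'', ''q''}" for y
        using that frameD[OF fr3, of y] frameD[OF fr2, of y] by auto
      have env3: "env n S U s3" using env st3 unfolding env_def by simp
      show "runs N accept_com s3 ?Q"
        by (rule runs_accept[OF env3 rep3]) (use st3 st(1) in simp)
    qed (use st(3) in auto)
    then show "runs N (Seq ?reset (Seq (For ''z'' ''L'' token_com) accept_com)) s1 ?Q"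
      unfolding s2_def by (rule runs_Seq_ev[rotated]) simp
  qed
qed

end

section \<open>Code of the feasibility test, the greedy cover and the counter\<close>

definition rows_com :: com where
  "rows_com = Seq (Set ''r0'' (Const 0)) (For ''i'' ''n''
     (Seq (Assign ''R'' (Var ''i'') (Var ''r0'')) (Set ''r0'' (Add (Var ''r0'') (Var ''n'')))))"

text \<open>The pair \<open>u\<close>, \<open>v\<close> is left out only where it is an unsafe edge;
  all other pairs test plain connectedness.\<close>

definition feas_cond :: bexp where
  "feas_cond = And (Less (Const 0) (entry ''x'' ''y'')) (Not (And (Eq (entry ''x'' ''y'') (Const 2))
     (Or (And (Eq (Var ''x'') (Var ''u'')) (Eq (Var ''y'') (Var ''v'')))
         (And (Eq (Var ''x'') (Var ''v'')) (Eq (Var ''y'') (Var ''u''))))))"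

definition reach_com :: com where
  "reach_com = Seq zero_com (Seq (Assign ''M'' (Const 0) (Const 1)) (Seq (clo feas_cond)
     (For ''i'' ''n'' (If (Eq (Cell ''M'' (Var ''i'')) (Const 1)) Skip (Set ''feas'' (Const 0))))))"

definition feas_com :: com where
  "feas_com = Seq init_com (Seq (Set ''feas'' (Const 1)) (For ''u'' ''n'' (For ''v'' ''n'' reach_com)))"

text \<open>\<open>h\<close> is raised before the store, so \<open>H\<close> is indexed from 1 and
  the digit 0 remains free for the no-op.\<close>

definition add_com :: "string \<Rightarrow> com" where
  "add_com z = If (Less (Cell ''I'' (Var z)) (Const 1))
     (Seq (Assign ''I'' (Var z) (Const 1)) (Seq (Set ''h'' (Add (Var ''h'') (Const 1)))
       (Assign ''H'' (Var ''h'') (Var z)))) Skip"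

text \<open>The matching argument for vertex covers, with forced vertices: both ends of each safe
  edge, and both ends of an unsafe edge that is still uncovered.\<close>

definition cover_step :: com where
  "cover_step = If (Or (Eq (entry ''u'' ''v'') (Const 1)) (And (Eq (entry ''u'' ''v'') (Const 2))
       (And (Less (Cell ''I'' (Var ''u'')) (Const 1)) (Less (Cell ''I'' (Var ''v'')) (Const 1)))))
     (Seq (add_com ''u'') (add_com ''v'')) Skip"

definition cover_com :: com where
  "cover_com = Seq (Set ''h'' (Const 0)) (Seq (For ''i'' ''n'' (Assign ''I'' (Var ''i'') (Const 0)))
     (For ''u'' ''n'' (For ''v'' ''n'' cover_step)))"

definition inc_body :: com where
  "inc_body = If (Eq (Var ''cy'') (Const 1))
     (If (Eq (Cell ''D'' (Var ''i'')) (Sub (Var ''B'') (Const 1))) (Assign ''D'' (Var ''i'') (Const 0))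
       (Seq (Assign ''D'' (Var ''i'') (Add (Cell ''D'' (Var ''i'')) (Const 1))) (Set ''cy'' (Const 0)))) Skip"

definition inc_com :: com where
  "inc_com = Seq (Set ''cy'' (Const 1)) (Seq (For ''i'' ''L'' inc_body)
     (If (Eq (Var ''cy'') (Const 1)) (Set ''fin'' (Const 1)) Skip))"

lemma mods_rows_com [simp]: "mods rows_com = {''r0'', ''i'', ''R''}"
  unfolding rows_com_def by auto

lemma mods_reach_com [simp]: "mods reach_com = {''i'', ''r'', ''x'', ''y'', ''M'', ''feas''}"
  unfolding reach_com_def by auto

lemma mods_feas_com [simp]: "mods feas_com = {''i'', ''r'', ''x'', ''y'', ''M'', ''feas'', ''C'', ''O'', ''u'', ''v''}"
  unfolding feas_com_def by auto

lemma mods_add_com [simp]: "mods (add_com z) = {''I'', ''h'', ''H''}"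
  unfolding add_com_def by auto

lemma mods_cover_step [simp]: "mods cover_step = {''I'', ''h'', ''H''}"
  unfolding cover_step_def by auto

lemma mods_cover_com [simp]: "mods cover_com = {''i'', ''u'', ''v'', ''I'', ''h'', ''H''}"
  unfolding cover_com_def by auto

lemma mods_inc_com [simp]: "mods inc_com = {''i'', ''D'', ''cy'', ''fin''}"
  unfolding inc_com_def inc_body_def by auto

section \<open>Counting in base B\<close>

text \<open>The zeros from position \<open>L\<close> on describe the untouched cells behind the
  counter, which surplus steps may read.\<close>

definition digit :: "nat \<Rightarrow> nat \<Rightarrow> nat \<Rightarrow> nat \<Rightarrow> nat" where
  "digit B L v i = (if i < L then v div B ^ i mod B else 0)"

lemma digit_less: "0 < B \<Longrightarrow> digit B L v i < B"
  unfolding digit_def by simp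

lemma digits_ex:
  assumes "\<And>i. dg i < B" "\<And>i. L \<le> i \<Longrightarrow> dg i = 0"
  shows "\<exists>v<B ^ L. digit B L v = dg"
proof -
  have "\<exists>v<B ^ L. \<forall>i<L. v div B ^ i mod B = dg i"
    using assms(1)
  proof (induction L arbitrary: dg)
    case 0
    then show ?case by simp
  next
    case (Suc L)
    obtain v where v: "v < B ^ L" "\<And>i. i < L \<Longrightarrow> v div B ^ i mod B = dg (Suc i)"
      using Suc.IH[of "\<lambda>i. dg (Suc i)"] Suc.prems by blast
    have B: "dg 0 < B" by (rule Suc.prems)
    have "dg 0 + B * v < B ^ Suc L"
    proof -
      have "B * Suc v \<le> B * B ^ L" using v(1) by (intro mult_left_mono) simp_all
      then show ?thesis using B by simp
    qed
    moreover have "(dg 0 + B * v) div B ^ i mod B = dg i" if "i < Suc L" for i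
    proof (cases i)
      case 0
      then show ?thesis using B by simp
    next
      case (Suc j)
      have "(dg 0 + B * v) div B ^ i = (dg 0 + B * v) div B div B ^ j" unfolding Suc by (simp add: div_mult2_eq)
      also have "(dg 0 + B * v) div B = v" using B by simp
      finally show ?thesis using v(2)[of j] that Suc by simp
    qed
    ultimately show ?case by blast
  qed
  then obtain v where "v < B ^ L" "\<forall>i<L. v div B ^ i mod B = dg i" by blast
  moreover from this have "digit B L v = dg" using assms(2) unfolding digit_def by (auto simp: fun_eq_iff not_less)
  ultimately show ?thesis by blast
qed

text \<open>Equivalently, the lowest \<open>i\<close> digits of \<open>v\<close> are all
  \<open>B - 1\<close>.\<close>

definition carry :: "nat \<Rightarrow> nat \<Rightarrow> nat \<Rightarrow> bool" where
  "carry B i v \<longleftrightarrow> Suc v mod B ^ i = 0"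

lemma digit_Suc:
  assumes "0 < B"
  shows "Suc v div B ^ i mod B = (if carry B i v then (if v div B ^ i mod B = B - 1 then 0 else v div B ^ i mod B + 1)
      else v div B ^ i mod B)"
    and "carry B (Suc i) v \<longleftrightarrow> carry B i v \<and> v div B ^ i mod B = B - 1"
proof -
  define w where "w = v div B ^ i"
  have w: "Suc v div B ^ i = (if carry B i v then Suc w else w)"
    unfolding carry_def w_def by (simp add: div_Suc)
  have Sw: "Suc w mod B = (if w mod B = B - 1 then 0 else w mod B + 1)"
    using assms by (auto simp: mod_Suc)
  show "Suc v div B ^ i mod B = (if carry B i v then (if v div B ^ i mod B = B - 1 then 0 else v div B ^ i mod B + 1)
      else v div B ^ i mod B)"
    unfolding w Sw w_def[symmetric] by (simp add: Sw)
  have "Suc v mod B ^ Suc i = B ^ i * (Suc v div B ^ i mod B) + Suc v mod B ^ i"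
    by (simp add: mod_mult2_eq mult.commute[of B])
  then have "carry B (Suc i) v \<longleftrightarrow> carry B i v \<and> Suc v div B ^ i mod B = 0"
    unfolding carry_def using assms by auto
  then show "carry B (Suc i) v \<longleftrightarrow> carry B i v \<and> v div B ^ i mod B = B - 1"
    using Sw unfolding w w_def[symmetric] by auto
qed

lemma runs_inc:
  assumes B: "s ''B'' 0 = int B" "0 < B" and L: "s ''L'' 0 = int L" "L \<le> N"
    and D: "\<And>i. s ''D'' (int i) = int (digit B L v i)" and v: "v < B ^ L" and f: "s ''fin'' 0 = 0"
  shows "runs N inc_com s (\<lambda>s'. (\<forall>i. s' ''D'' (int i) = int (digit B L (Suc v) i)) \<and>
    s' ''fin'' 0 = (if Suc v = B ^ L then 1 else 0))"
proof -
  define s1 where "s1 = ev (Set ''cy'' (Const 1)) s"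
  define I where "I i s' \<longleftrightarrow> s' ''cy'' 0 = (if carry B i v then 1 else 0) \<and>
    (\<forall>j. s' ''D'' (int j) = int (if j < i then digit B L (Suc v) j else digit B L v j))" for i s'
  \<comment> \<open>A carry out of the top makes \<open>Suc v\<close> a multiple of
    \<open>B ^ L\<close>; it is at most \<open>B ^ L\<close>, hence equal to it.\<close>
  have carry_iff: "carry B L v \<longleftrightarrow> Suc v = B ^ L"
  proof
    assume "carry B L v"
    then have "B ^ L dvd Suc v" unfolding carry_def by auto
    then have "B ^ L \<le> Suc v" by (rule dvd_imp_le) simp
    then show "Suc v = B ^ L" using v by simp
  qed (simp add: carry_def)
  have "runs N (Seq (For ''i'' ''L'' inc_body) (If (Eq (Var ''cy'') (Const 1)) (Set ''fin'' (Const 1)) Skip)) s1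
    (\<lambda>s'. (\<forall>i. s' ''D'' (int i) = int (digit B L (Suc v) i)) \<and> s' ''fin'' 0 = (if Suc v = B ^ L then 1 else 0))"
  proof (rule runs_Seq[OF runs_For[where M = L and I = I and Q = "I L"]])
    show "s1 ''L'' 0 = int L" using L unfolding s1_def by simp
    show "I 0 (update s1 ''i'' 0 0)" using D unfolding I_def s1_def by (simp add: carry_def)
  next
    fix i s2 assume i: "i < L" and I2: "I i s2" and fr: "frame (insert ''i'' (mods inc_body)) s1 s2"
      and x: "s2 ''i'' 0 = int i"
    have B2: "s2 ''B'' 0 = int B" using frameD[OF fr] B(1) unfolding s1_def inc_body_def by simp
    have Di: "s2 ''D'' (int i) = int (v div B ^ i mod B)" using I2 i unfolding I_def digit_def by simp
    have eqB: "int (v div B ^ i mod B) = int B - 1 \<longleftrightarrow> v div B ^ i mod B = B - 1" using B(2) by linarith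
    have cy: "s2 ''cy'' 0 = 1 \<longleftrightarrow> carry B i v" using I2 unfolding I_def by simp
    define s3 where "s3 = ev inc_body s2"
    have s3: "s3 ''cy'' 0 = (if carry B (Suc i) v then 1 else 0)"
    proof -
      have "s2 ''cy'' 0 = (if carry B i v then 1 else 0)" using I2 unfolding I_def by blast
      moreover have "int (B - 1) = int B - 1" using B(2) by linarith
      ultimately show ?thesis unfolding s3_def inc_body_def digit_Suc(2)[OF B(2)]
        by (simp add: x B2 Di eqB del: One_nat_def)
    qed
    have D3: "s3 ''D'' = (s2 ''D'')(int i := int (Suc v div B ^ i mod B))"
      unfolding s3_def inc_body_def digit_Suc(1)[OF B(2), of v i]
      by (auto simp: x B2 Di eqB cy fun_eq_iff)
    have "I (Suc i) (update s3 ''i'' 0 (int (Suc i)))"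
      using I2 i unfolding I_def by (auto simp: s3 D3 digit_def less_Suc_eq)
    then show "runs N inc_body s2 (\<lambda>s''. I (Suc i) (update s'' ''i'' 0 (int (Suc i))))"
      unfolding s3_def by (intro runs_loop_free) (simp_all add: inc_body_def)
  next
    fix s2 assume fr: "frame (mods (For ''i'' ''L'' inc_body)) s1 s2" and I2: "I L s2"
    have "s2 ''fin'' 0 = 0" using frameD[OF fr] f unfolding s1_def inc_body_def by simp
    moreover have "s2 ''D'' (int j) = int (digit B L (Suc v) j)" for j
      using I2 unfolding I_def digit_def by auto
    ultimately show "runs N (If (Eq (Var ''cy'') (Const 1)) (Set ''fin'' (Const 1)) Skip) s2
       (\<lambda>s'. (\<forall>i. s' ''D'' (int i) = int (digit B L (Suc v) i)) \<and> s' ''fin'' 0 = (if Suc v = B ^ L then 1 else 0))"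
      using I2 carry_iff unfolding I_def by (intro runs_loop_free) auto
  qed (use L(2) in \<open>auto simp: inc_body_def\<close>)
  then show ?thesis unfolding inc_com_def s1_def by (rule runs_Seq_ev[rotated]) simp
qed

section \<open>Row offsets and the feasibility test\<close>

lemma conn_int: "conn V T (int :: nat \<Rightarrow> int) \<longleftrightarrow> conn V T id"
proof
  assume "conn V T (int :: nat \<Rightarrow> int)"
  then have "conn V T (nat \<circ> int)" by (rule conn_comp)
  then show "conn V T id" by (simp add: comp_def id_def)
next
  assume "conn V T (id :: nat \<Rightarrow> nat)"
  then have "conn V T (int \<circ> id)" by (rule conn_comp)
  then show "conn V T (int :: nat \<Rightarrow> int)" by simp
qed

context ram
begin

lemma runs_rows:
  assumes "s ''n'' 0 = int n"
  shows "runs N rows_com s (\<lambda>s'. \<forall>i<n. s' ''R'' (int i) = int i * int n)"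
proof -
  define s1 where "s1 = ev (Set ''r0'' (Const 0)) s"
  have "runs N (For ''i'' ''n'' (Seq (Assign ''R'' (Var ''i'') (Var ''r0'')) (Set ''r0'' (Add (Var ''r0'') (Var ''n''))))) s1
    (\<lambda>s'. \<forall>i<n. s' ''R'' (int i) = int i * int n)"
  proof (rule runs_For[where M = n and I = "\<lambda>i s'. s' ''r0'' 0 = int i * int n \<and> (\<forall>j<i. s' ''R'' (int j) = int j * int n)"])
    fix i s2 assume I: "s2 ''r0'' 0 = int i * int n \<and> (\<forall>j<i. s2 ''R'' (int j) = int j * int n)"
      and x: "s2 ''i'' 0 = int i"
      and fr: "frame (insert ''i'' (mods (Seq (Assign ''R'' (Var ''i'') (Var ''r0'')) (Set ''r0'' (Add (Var ''r0'') (Var ''n'')))))) s1 s2"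
    have "s2 ''n'' 0 = int n" using frameD[OF fr] assms unfolding s1_def by simp
    then show "runs N (Seq (Assign ''R'' (Var ''i'') (Var ''r0'')) (Set ''r0'' (Add (Var ''r0'') (Var ''n'')))) s2
       (\<lambda>s''. update s'' ''i'' 0 (int (Suc i)) ''r0'' 0 = int (Suc i) * int n \<and>
          (\<forall>j<Suc i. update s'' ''i'' 0 (int (Suc i)) ''R'' (int j) = int j * int n))"
      using I x by (intro runs_loop_free) (auto simp: less_Suc_eq algebra_simps)
  qed (use assms nN in \<open>auto simp: s1_def\<close>)
  then show ?thesis unfolding rows_com_def s1_def by (rule runs_Seq_ev[rotated]) simp
qed

definition reached :: "nat \<Rightarrow> nat \<Rightarrow> bool" where
  "reached u v \<longleftrightarrow> (\<forall>i<n. (0, int i) \<in> {(a, b). adj (E - ({{u, v}} \<inter> U)) int a b}\<^sup>*)"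

lemma runs_reach:
  assumes env: "env n S U s" and n: "0 < n" and uv: "s ''u'' 0 = int u" "s ''v'' 0 = int v" 
    and C: "\<forall>x<n. s ''C'' (int x) = int x"
  shows "runs N reach_com s (\<lambda>s'. s' ''feas'' 0 = (if reached u v then s ''feas'' 0 else 0))"
  unfolding reach_com_def
proof (rule runs_Seq[OF runs_zero])
  show "s ''n'' 0 = int n" using env unfolding env_def by simp
  let ?loop = "For ''i'' ''n'' (If (Eq (Cell ''M'' (Var ''i'')) (Const 1)) Skip (Set ''feas'' (Const 0)))"
  fix s1 assume fr1: "frame (mods zero_com) s s1" and z: "\<forall>p. 0 \<le> p \<and> p < int n \<longrightarrow> s1 ''M'' p = 0"
  define s2 where "s2 = ev (Assign ''M'' (Const 0) (Const 1)) s1"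
  have st2: "s2 y = s y" if "y \<notin> {''i'', ''M''}" for y
    using that frameD[OF fr1, of y] unfolding s2_def by simp
  have M2: "s2 ''M'' p = 1 \<longleftrightarrow> p \<in> {0}" if "0 \<le> p" "p < int n" for p
    using z that unfolding s2_def by simp
  define P where "P x y \<longleftrightarrow> {x, y} \<in> E - ({{u, v}} \<inter> U)" for x y
  define Rl where "Rl = {(s2 ''C'' (int x), s2 ''C'' (int y)) |x y. x < n \<and> y < n \<and> P x y}"
  have Rl: "Rl = {(a, b). adj (E - ({{u, v}} \<inter> U)) int a b}"
  proof (intro subset_antisym subsetI)
    have C2: "s2 ''C'' (int x) = int x" if "x < n" for x using C st2 that by simp
    fix z
    show "z \<in> {(a, b). adj (E - ({{u, v}} \<inter> U)) int a b}" if "z \<in> Rl"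
      using that C2 unfolding Rl_def P_def adj_def by auto
    assume "z \<in> {(a, b). adj (E - ({{u, v}} \<inter> U)) int a b}"
    then obtain x y where xy: "z = (int x, int y)" "P x y" unfolding adj_def P_def by blast
    then have "x < n" "y < n" using edge_lt[of x y] unfolding P_def by blast+
    moreover from this have "z = (s2 ''C'' (int x), s2 ''C'' (int y))" using xy(1) C2 by simp
    ultimately show "z \<in> Rl" using xy(2) unfolding Rl_def by blast
  qed
  have "runs N (Seq (clo feas_cond) ?loop) s2 (\<lambda>s'. s' ''feas'' 0 = (if reached u v then s ''feas'' 0 else 0))"
  proof (rule runs_Seq[OF runs_clo[where n = n and P = P and ?X0.0 = "{0}"]])
    show "s2 ''n'' 0 = int n" using st2 env unfolding env_def by simp
    show "0 \<le> s2 ''C'' (int x) \<and> s2 ''C'' (int x) < int n" if "x < n" for x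
      using st2 C that by simp
    show "{0} \<subseteq> {0..<int n}" using n by simp
    fix s' x y assume xy: "x < n" "y < n" "s' ''x'' 0 = int x" "s' ''y'' 0 = int y"
      and fr: "frame {''r'', ''x'', ''y'', ''M''} s2 s'"
    have "s' ''G'' = s ''G''" "s' ''R'' = s ''R''" "s' ''u'' 0 = int u" "s' ''v'' 0 = int v"
      using frameD[OF fr] st2 uv by simp_all
    then have "bval feas_cond s' \<longleftrightarrow> {x, y} \<in> E \<and> \<not> ({x, y} \<in> U \<and> (x = u \<and> y = v \<or> x = v \<and> y = u))"
      using xy env unfolding feas_cond_def env_def by (simp add: edge_code_cases disj)
    then show "bval feas_cond s' \<longleftrightarrow> P x y" unfolding P_def by (auto simp: doubleton_eq_iff)
  next
    fix s3 assume fr3: "frame (mods (clo feas_cond)) s2 s3" and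
      M3: "\<forall>p. 0 \<le> p \<and> p < int n \<longrightarrow> (s3 ''M'' p = 1 \<longleftrightarrow>
        p \<in> {(s2 ''C'' (int x), s2 ''C'' (int y)) |x y. x < n \<and> y < n \<and> P x y}\<^sup>* `` {0})"
    have M: "s3 ''M'' (int i) = 1 \<longleftrightarrow> (0, int i) \<in> {(a, b). adj (E - ({{u, v}} \<inter> U)) int a b}\<^sup>*" if "i < n" for i
      using M3 that unfolding Rl_def[symmetric] Rl by simp
    define pre where "pre i \<longleftrightarrow> (\<forall>j<i. s3 ''M'' (int j) = 1)" for i :: nat
    have pre_Suc: "pre (Suc i) \<longleftrightarrow> pre i \<and> s3 ''M'' (int i) = 1" for i
      unfolding pre_def by (auto simp: less_Suc_eq)
    have n3: "s3 ''n'' 0 = int n" "s3 ''feas'' 0 = s ''feas'' 0"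
      using frameD[OF fr3] st2 env unfolding env_def by simp_all
    show "runs N ?loop s3 (\<lambda>s'. s' ''feas'' 0 = (if reached u v then s ''feas'' 0 else 0))"
    proof (rule runs_For[where M = n and I = "\<lambda>i s'. s' ''feas'' 0 = (if pre i then s ''feas'' 0 else 0)"])
      fix i s4 assume I: "s4 ''feas'' 0 = (if pre i then s ''feas'' 0 else 0)"
        and x: "s4 ''i'' 0 = int i"
        and fr: "frame (insert ''i'' (mods (If (Eq (Cell ''M'' (Var ''i'')) (Const 1)) Skip (Set ''feas'' (Const 0))))) s3 s4"
      have "s4 ''M'' = s3 ''M''" using frameD[OF fr] by simp
      then show "runs N (If (Eq (Cell ''M'' (Var ''i'')) (Const 1)) Skip (Set ''feas'' (Const 0))) s4
         (\<lambda>s''. update s'' ''i'' 0 (int (Suc i)) ''feas'' 0 = (if pre (Suc i) then s ''feas'' 0 else 0))"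
        using I x by (intro runs_loop_free) (simp_all add: pre_Suc)
    next
      fix s4 :: store assume "s4 ''feas'' 0 = (if pre n then s ''feas'' 0 else 0)"
      then show "s4 ''feas'' 0 = (if reached u v then s ''feas'' 0 else 0)"
        unfolding reached_def pre_def using M by simp
    qed (use n3 nN in \<open>auto simp: pre_def\<close>)
  qed (use nN M2 in auto)
  then show "runs N (Seq (Assign ''M'' (Const 0) (Const 1)) (Seq (clo feas_cond) ?loop)) s1
      (\<lambda>s'. s' ''feas'' 0 = (if reached u v then s ''feas'' 0 else 0))"
    unfolding s2_def by (rule runs_Seq_ev[rotated]) simp
qed

lemma reached_conn: "0 < n \<Longrightarrow> reached u v \<longleftrightarrow> conn {..<n} (E - ({{u, v}} \<inter> U)) int"
proof -
  assume n: "0 < n"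
  let ?T = "E - ({{u, v}} \<inter> U)"
  show ?thesis
  proof
    assume r: "reached u v"
    show "conn {..<n} ?T int"
      unfolding conn_def
    proof (intro ballI)
      fix p q assume "p \<in> int ` {..<n}" "q \<in> int ` {..<n}"
      then have "(0, p) \<in> {(a, b). adj ?T int a b}\<^sup>*" "(0, q) \<in> {(a, b). adj ?T int a b}\<^sup>*"
        using r unfolding reached_def by auto
      then show "(p, q) \<in> {(a, b). adj ?T int a b}\<^sup>*"
        using rtrancl_sym_adj rtrancl_trans by metis
    qed
  next
    assume c: "conn {..<n} ?T int"
    have z: "0 \<in> int ` {..<n}" using n by (intro image_eqI[of _ _ 0]) simp_all
    show "reached u v"
      unfolding reached_def
    proof (intro allI impI)
      fix i assume "i < n"
      then have "int i \<in> int ` {..<n}" by simp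
      then show "(0, int i) \<in> {(a, b). adj ?T int a b}\<^sup>*" using c z unfolding conn_def by blast
    qed
  qed
qed

lemma all_reached_iff:
  assumes "0 < n"
  shows "(\<forall>u<n. \<forall>v<n. reached u v) \<longleftrightarrow> good {..<n} U E id"
proof
  assume r: "\<forall>u<n. \<forall>v<n. reached u v"
  have c: "conn {..<n} (E - ({{u, v}} \<inter> U)) id" if "u < n" "v < n" for u v
    using r that reached_conn[OF assms] conn_int by blast
  show "good {..<n} U E id"
    unfolding good_def
  proof (intro conjI ballI)
    \<comment> \<open>Any pair would do, since each tested graph is a subgraph of \<open>E\<close>;
      vertex 0 exists because \<open>n\<close> is positive.\<close>
    show "conn {..<n} E id" by (rule conn_mono[OF c[OF assms assms]]) blast
    fix e assume e: "e \<in> E \<inter> U"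
    then obtain u v where uv: "e = {u, v}" "u < n" "v < n" using edge_ex[of e] by auto
    have "{{u, v}} \<inter> U = {e}" using e uv by blast
    then show "conn {..<n} (E - {e}) id" using c[OF uv(2,3)] by simp
  qed
next
  assume g: "good {..<n} U E id"
  show "\<forall>u<n. \<forall>v<n. reached u v"
  proof (intro allI impI)
    fix u v assume "u < n" "v < n"
    have "conn {..<n} (E - ({{u, v}} \<inter> U)) id"
    proof (cases "{u, v} \<in> U")
      case True
      then have "{{u, v}} \<inter> U = {{u, v}}" by blast
      then show ?thesis using g True unfolding good_def by simp
    next
      case False
      then have "{{u, v}} \<inter> U = {}" by blast
      then show ?thesis using g unfolding good_def by simp
    qed
    then show "reached u v" using reached_conn[OF assms] conn_int by blast
  qed
qed

lemma runs_feas: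
  assumes env: "env n S U s" and n: "0 < n"
  shows "runs N feas_com s (\<lambda>s'. s' ''feas'' 0 = (if good {..<n} U E id then 1 else 0))"
  unfolding feas_com_def
proof (rule runs_Seq[OF runs_init])
  show "s ''n'' 0 = int n" using env unfolding env_def by simp
  fix s1 assume fr1: "frame (mods init_com) s s1" and C1: "\<forall>v<n. s1 ''C'' (int v) = int v \<and> s1 ''O'' (int v) = 0"
  define s2 where "s2 = ev (Set ''feas'' (Const 1)) s1"
  have st2: "s2 y = s y" if "y \<in> {''n'', ''G'', ''R''}" for y
    using that frameD[OF fr1, of y] unfolding s2_def by auto
  have C2: "\<forall>v<n. s2 ''C'' (int v) = int v" using C1 unfolding s2_def by simp
  have "runs N (For ''u'' ''n'' (For ''v'' ''n'' reach_com)) s2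
    (\<lambda>s'. s' ''feas'' 0 = (if good {..<n} U E id then 1 else 0))"
  proof (rule runs_For[where M = n and I = "\<lambda>i s'. s' ''feas'' 0 = (if \<forall>u<i. \<forall>v<n. reached u v then 1 else 0)"])
    show "s2 ''n'' 0 = int n" using st2 env unfolding env_def by simp
  next
    fix i s3 assume I: "s3 ''feas'' 0 = (if \<forall>u<i. \<forall>v<n. reached u v then 1 else 0)" and u: "s3 ''u'' 0 = int i"
      and fr3: "frame (insert ''u'' (mods (For ''v'' ''n'' reach_com))) s2 s3"
    have st3: "s3 y = s y" if "y \<in> {''n'', ''G'', ''R''}" for y
      using that frameD[OF fr3, of y] st2[of y] by auto
    show "runs N (For ''v'' ''n'' reach_com) s3
       (\<lambda>s''. update s'' ''u'' 0 (int (Suc i)) ''feas'' 0 = (if \<forall>u<Suc i. \<forall>v<n. reached u v then 1 else 0))"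
    proof (rule runs_For[where M = n and I = "\<lambda>j s'. s' ''feas'' 0 =
        (if (\<forall>u<i. \<forall>v<n. reached u v) \<and> (\<forall>v<j. reached i v) then 1 else 0)"])
      show "s3 ''n'' 0 = int n" using st3 env unfolding env_def by simp
    next
      fix j s4 assume J: "s4 ''feas'' 0 = (if (\<forall>u<i. \<forall>v<n. reached u v) \<and> (\<forall>v<j. reached i v) then 1 else 0)"
        and v: "s4 ''v'' 0 = int j" and fr4: "frame (insert ''v'' (mods reach_com)) s3 s4"
      have env4: "env n S U s4" using env frameD[OF fr4] st3 unfolding env_def by simp
      have u4: "s4 ''u'' 0 = int i" "s4 ''C'' = s2 ''C''" using frameD[OF fr4] u frameD[OF fr3] by simp_all
      have all: "(\<forall>v<Suc j. reached i v) \<longleftrightarrow> (\<forall>v<j. reached i v) \<and> reached i j" by (auto simp: less_Suc_eq)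
      show "runs N reach_com s4 (\<lambda>s''. update s'' ''v'' 0 (int (Suc j)) ''feas'' 0 =
          (if (\<forall>u<i. \<forall>v<n. reached u v) \<and> (\<forall>v<Suc j. reached i v) then 1 else 0))"
        by (rule runs_mono[OF runs_reach[OF env4 n u4(1) v]]) (use C2 u4(2) J all in simp_all)
    next
      fix s4 :: store assume J: "s4 ''feas'' 0 = (if (\<forall>u<i. \<forall>v<n. reached u v) \<and> (\<forall>v<n. reached i v) then 1 else 0)"
      have all: "(\<forall>u<Suc i. \<forall>v<n. reached u v) \<longleftrightarrow> (\<forall>u<i. \<forall>v<n. reached u v) \<and> (\<forall>v<n. reached i v)"
        by (auto simp: less_Suc_eq)
      show "update s4 ''u'' 0 (int (Suc i)) ''feas'' 0 = (if \<forall>u<Suc i. \<forall>v<n. reached u v then 1 else 0)"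
        unfolding all using J by simp
    qed (use I nN in auto)
  next
    fix s3 assume "s3 ''feas'' 0 = (if \<forall>u<n. \<forall>v<n. reached u v then 1 else 0)"
    then show "s3 ''feas'' 0 = (if good {..<n} U E id then 1 else 0)" using all_reached_iff[OF n] by simp
  qed (use nN in \<open>auto simp: s2_def\<close>)
  then show "runs N (Seq (Set ''feas'' (Const 1)) (For ''u'' ''n'' (For ''v'' ''n'' reach_com))) s1
    (\<lambda>s'. s' ''feas'' 0 = (if good {..<n} U E id then 1 else 0))"
    unfolding s2_def by (rule runs_Seq_ev[rotated]) simp
qed

section \<open>The greedy cover\<close>

definition ins :: "nat \<Rightarrow> nat list \<Rightarrow> nat list" where
  "ins v hs = (if v \<in> set hs then hs else hs @ [v])"

definition hrep :: "store \<Rightarrow> nat list \<Rightarrow> bool" where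
  "hrep s hs \<longleftrightarrow> s ''h'' 0 = int (length hs) \<and> (\<forall>i<length hs. s ''H'' (int (Suc i)) = int (hs ! i)) \<and>
     (\<forall>v<n. s ''I'' (int v) = (if v \<in> set hs then 1 else 0)) \<and> distinct hs \<and> set hs \<subseteq> {..<n}"

text \<open>A local form of the factor 2: at least half of the chosen vertices lie in every
  admissible cover \<open>X\<close>. A safe edge adds only vertices of \<open>X\<close>; of the two
  new ends of an unsafe edge at least one is in \<open>X\<close>.\<close>

definition balanced :: "nat list \<Rightarrow> bool" where
  "balanced hs \<longleftrightarrow> (\<forall>X. safe_cover X \<longrightarrow> card (set hs - X) \<le> card (set hs \<inter> X))"

lemma hrep_add:
  assumes "hrep s hs" "s z 0 = int v" "v < n" "z \<notin> {''I'', ''h'', ''H''}"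
  shows "hrep (ev (add_com z) s) (ins v hs)"
proof (cases "v \<in> set hs")
  case True
  then show ?thesis using assms unfolding add_com_def ins_def hrep_def by simp
next
  case False
  define s' where "s' = ev (add_com z) s"
  have z: "z \<noteq> ''I''" "z \<noteq> ''h''" "z \<noteq> ''H''" using assms(4) by auto
  have "s ''I'' (int v) = 0" "s ''h'' 0 = int (length hs)" using assms(1,3) False unfolding hrep_def by simp_all
  then have "s' ''h'' 0 = int (Suc (length hs))" "s' ''I'' = (s ''I'')(int v := 1)"
      "s' ''H'' = (s ''H'')(int (Suc (length hs)) := int v)"
    using assms(2) z unfolding s'_def add_com_def by (simp_all add: add.commute)
  then show ?thesis
    using assms(1,3) False unfolding s'_def[symmetric] ins_def hrep_def by (auto simp: nth_append less_Suc_eq)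
qed

lemma set_ins: "set (ins v hs) = insert v (set hs)"
  unfolding ins_def by auto

lemma balanced_safe: "balanced hs \<Longrightarrow> {u, v} \<in> S \<Longrightarrow> balanced (ins v (ins u hs))"
  unfolding balanced_def
proof (intro allI impI)
  fix X assume b: "\<forall>X. safe_cover X \<longrightarrow> card (set hs - X) \<le> card (set hs \<inter> X)" and uv: "{u, v} \<in> S" and X: "safe_cover X"
  have "u \<in> X" "v \<in> X" using X uv unfolding safe_cover_def by auto
  then have 1: "set (ins v (ins u hs)) - X = set hs - X" "set hs \<inter> X \<subseteq> set (ins v (ins u hs)) \<inter> X" 
    unfolding set_ins by auto
  have "card (set hs \<inter> X) \<le> card (set (ins v (ins u hs)) \<inter> X)" by (rule card_mono[OF _ 1(2)]) simp
  then show "card (set (ins v (ins u hs)) - X) \<le> card (set (ins v (ins u hs)) \<inter> X)"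
    using b X 1(1) by (metis le_trans)
qed

lemma balanced_unsafe:
  assumes "balanced hs" "{u, v} \<in> U" "u \<notin> set hs" "v \<notin> set hs"
  shows "balanced (ins v (ins u hs))"
  unfolding balanced_def
proof (intro allI impI)
  fix X assume X: "safe_cover X"
  have ne: "u \<noteq> v" using edgeD[of u v] assms(2) by blast
  have "u \<in> X \<or> v \<in> X" using X assms(2) unfolding safe_cover_def by blast
  then have c: "card ({u, v} - X) \<le> 1" "1 \<le> card ({u, v} \<inter> X)"
  proof -
    have "{u, v} - X \<subseteq> {u} \<or> {u, v} - X \<subseteq> {v}" using \<open>u \<in> X \<or> v \<in> X\<close> by blast
    then show "card ({u, v} - X) \<le> 1" by (metis card.empty card_insert_disjoint card_mono finite.emptyI finite_insert insert_absorb insert_not_empty One_nat_def)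
    have "{u, v} \<inter> X \<noteq> {}" using \<open>u \<in> X \<or> v \<in> X\<close> by blast
    then show "1 \<le> card ({u, v} \<inter> X)" by (simp add: Suc_le_eq card_gt_0_iff)
  qed
  have "set (ins v (ins u hs)) - X = (set hs - X) \<union> ({u, v} - X)" unfolding set_ins by auto
  then have 1: "card (set (ins v (ins u hs)) - X) \<le> card (set hs - X) + 1"
    using card_Un_le[of "set hs - X" "{u, v} - X"] c(1) by simp
  have "set (ins v (ins u hs)) \<inter> X = (set hs \<inter> X) \<union> ({u, v} \<inter> X)" unfolding set_ins by auto
  then have 2: "card (set (ins v (ins u hs)) \<inter> X) = card (set hs \<inter> X) + card ({u, v} \<inter> X)"
  proof -
    have "(set hs \<inter> X) \<inter> ({u, v} \<inter> X) = {}" using assms(3,4) by blast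
    then show ?thesis unfolding \<open>set (ins v (ins u hs)) \<inter> X = _\<close> by (intro card_Un_disjoint) simp_all
  qed
  show "card (set (ins v (ins u hs)) - X) \<le> card (set (ins v (ins u hs)) \<inter> X)"
    using 1 2 c(2) assms(1) X unfolding balanced_def by fastforce
qed

definition handled :: "nat list \<Rightarrow> nat \<Rightarrow> nat \<Rightarrow> bool" where
  "handled hs u v \<longleftrightarrow> ({u, v} \<in> S \<longrightarrow> u \<in> set hs \<and> v \<in> set hs) \<and> ({u, v} \<in> U \<longrightarrow> u \<in> set hs \<or> v \<in> set hs)"

lemma cover_step:
  assumes env: "env n S U s" and hs: "hrep s hs" "balanced hs" and uv: "s ''u'' 0 = int u" "s ''v'' 0 = int v" "u < n" "v < n"
  shows "\<exists>hs'. hrep (ev cover_step s) hs' \<and> balanced hs' \<and> set hs \<subseteq> set hs' \<and> handled hs' u v"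
proof -
  have c: "bval (Or (Eq (entry ''u'' ''v'') (Const 1)) (And (Eq (entry ''u'' ''v'') (Const 2))
       (And (Less (Cell ''I'' (Var ''u'')) (Const 1)) (Less (Cell ''I'' (Var ''v'')) (Const 1))))) s
     \<longleftrightarrow> {u, v} \<in> S \<or> {u, v} \<in> U \<and> u \<notin> set hs \<and> v \<notin> set hs" (is "bval ?c s \<longleftrightarrow> ?P")
    using env hs(1) uv unfolding env_def hrep_def by (simp add: edge_code_cases disj)
  show ?thesis
  proof (cases ?P)
    case False
    then have "\<not> bval ?c s" using c by blast
    then have "ev cover_step s = s" unfolding cover_step_def by (simp only: ev.simps if_False)
    then show ?thesis using False hs unfolding handled_def by (intro exI[of _ hs]) auto
  next
    case True
    then have "bval ?c s" using c by blast
    then have e: "ev cover_step s = ev (add_com ''v'') (ev (add_com ''u'') s)"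
      unfolding cover_step_def by (simp only: ev.simps if_True)
    have h1: "hrep (ev (add_com ''u'') s) (ins u hs)" by (rule hrep_add[OF hs(1) uv(1,3)]) simp
    have "ev (add_com ''u'') s ''v'' 0 = int v" using uv(2) unfolding add_com_def by simp
    then have "hrep (ev cover_step s) (ins v (ins u hs))"
      unfolding e by (rule hrep_add[OF h1 _ uv(4)]) simp
    moreover have "balanced (ins v (ins u hs))"
      using True balanced_safe[OF hs(2)] balanced_unsafe[OF hs(2)] by blast
    ultimately show ?thesis unfolding handled_def
      by (intro exI[of _ "ins v (ins u hs)"]) (auto simp: set_ins)
  qed
qed

lemma runs_cover:
  assumes env: "env n S U s"
  shows "runs N cover_com s (\<lambda>s'. \<exists>hs. hrep s' hs \<and> safe_cover (set hs) \<and>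
    (\<forall>X. safe_cover X \<longrightarrow> length hs \<le> 2 * card X))"
proof -
  let ?loop = "For ''i'' ''n'' (Assign ''I'' (Var ''i'') (Const 0))"
  let ?main = "For ''u'' ''n'' (For ''v'' ''n'' cover_step)"
  let ?Q = "\<lambda>s'. \<exists>hs. hrep s' hs \<and> safe_cover (set hs) \<and> (\<forall>X. safe_cover X \<longrightarrow> length hs \<le> 2 * card X)"
  define s1 where "s1 = ev (Set ''h'' (Const 0)) s"
  have "runs N (Seq ?loop ?main) s1 ?Q"
  proof (rule runs_Seq[OF runs_For[where M = n and Q = "\<lambda>s'. \<forall>v<n. s' ''I'' (int v) = 0"
        and I = "\<lambda>i s'. \<forall>v<i. s' ''I'' (int v) = 0"]])
    show "s1 ''n'' 0 = int n" using env unfolding s1_def env_def by simp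
    fix i s2 assume "\<forall>v<i. s2 ''I'' (int v) = 0" "s2 ''i'' 0 = int i"
    then show "runs N (Assign ''I'' (Var ''i'') (Const 0)) s2
       (\<lambda>s''. \<forall>v<Suc i. update s'' ''i'' 0 (int (Suc i)) ''I'' (int v) = 0)"
      by (intro runs_loop_free) (auto simp: less_Suc_eq)
  next
    fix s2 assume fr2: "frame (mods ?loop) s1 s2" and I2: "\<forall>v<n. s2 ''I'' (int v) = 0"
    have st2: "s2 y = s y" if "y \<in> {''n'', ''G'', ''R''}" for y
      using that frameD[OF fr2, of y] unfolding s1_def by auto
    have h2: "s2 ''h'' 0 = 0" using frameD[OF fr2] unfolding s1_def by simp
    define J where "J i j s' \<longleftrightarrow> (\<exists>hs. hrep s' hs \<and> balanced hs \<and> (\<forall>u<i. \<forall>v<n. handled hs u v) \<and> (\<forall>v<j. handled hs i v))"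
      for i j :: nat and s'
    have J_upd: "J i j (update s' z 0 v) \<longleftrightarrow> J i j s'" if "z \<in> {''u'', ''v''}" for i j s' z v
      using that unfolding J_def hrep_def by auto
    have handled_mono: "handled hs u v \<Longrightarrow> set hs \<subseteq> set hs' \<Longrightarrow> handled hs' u v" for hs hs' u v
      unfolding handled_def by blast
    show "runs N ?main s2 ?Q"
    proof (rule runs_For[where M = n and I = "\<lambda>i s'. J i 0 s'"])
      show "s2 ''n'' 0 = int n" using st2 env unfolding env_def by simp
      have "hrep s2 []" unfolding hrep_def using h2 I2 by simp
      moreover have "balanced []" unfolding balanced_def by simp
      ultimately have "J 0 0 s2" unfolding J_def by (intro exI[of _ "[]"]) simp
      then show "J 0 0 (update s2 ''u'' 0 0)" using J_upd by simp
    next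
      fix i s3 assume i: "i < n" and J3: "J i 0 s3" and u: "s3 ''u'' 0 = int i"
        and fr3: "frame (insert ''u'' (mods (For ''v'' ''n'' cover_step))) s2 s3"
      have st3: "s3 y = s y" if "y \<in> {''n'', ''G'', ''R''}" for y
        using that frameD[OF fr3, of y] st2[of y] by auto
      show "runs N (For ''v'' ''n'' cover_step) s3 (\<lambda>s''. J (Suc i) 0 (update s'' ''u'' 0 (int (Suc i))))"
      proof (rule runs_For[where M = n and I = "J i"])
        show "s3 ''n'' 0 = int n" using st3 env unfolding env_def by simp
        show "J i 0 (update s3 ''v'' 0 0)" using J3 J_upd by simp
      next
        fix j s4 assume j: "j < n" and J4: "J i j s4" and v: "s4 ''v'' 0 = int j"
          and fr4: "frame (insert ''v'' (mods cover_step)) s3 s4"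
        have env4: "env n S U s4" using env frameD[OF fr4] st3 unfolding env_def by simp
        have u4: "s4 ''u'' 0 = int i" using frameD[OF fr4] u by simp
        obtain hs where hs: "hrep s4 hs" "balanced hs" "\<forall>u<i. \<forall>v<n. handled hs u v" "\<forall>v<j. handled hs i v"
          using J4 unfolding J_def by blast
        obtain hs' where hs': "hrep (ev cover_step s4) hs'" "balanced hs'" "set hs \<subseteq> set hs'" "handled hs' i j"
          using cover_step[OF env4 hs(1,2) u4 v i j] by blast
        have "J i (Suc j) (ev cover_step s4)"
          unfolding J_def using hs' hs(3,4) handled_mono[OF _ hs'(3)]
          by (intro exI[of _ hs']) (auto simp: less_Suc_eq)
        then show "runs N cover_step s4 (\<lambda>s''. J i (Suc j) (update s'' ''v'' 0 (int (Suc j))))"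
          using J_upd by (intro runs_loop_free) (simp_all add: cover_step_def add_com_def)
      next
        fix s4 assume "J i n s4"
        then have "J (Suc i) 0 s4" unfolding J_def by (auto simp: less_Suc_eq)
        then show "J (Suc i) 0 (update s4 ''u'' 0 (int (Suc i)))" using J_upd by simp
      qed (use nN in auto)
    next
      fix s3 assume "J n 0 s3"
      then obtain hs where hs: "hrep s3 hs" "balanced hs" "\<forall>u<n. \<forall>v<n. handled hs u v" unfolding J_def by blast
      have "safe_cover (set hs)"
        unfolding safe_cover_def
      proof (intro conjI allI impI subsetI)
        show "x \<in> {..<n}" if "x \<in> set hs" for x using hs(1) that unfolding hrep_def by blast
        fix x y assume "{x, y} \<in> E"
        then show "x \<in> set hs \<or> y \<in> set hs" using hs(3) edge_lt[of x y] unfolding handled_def by blast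
      next
        fix x assume "x \<in> \<Union>S"
        then obtain e where e: "e \<in> S" "x \<in> e" by blast
        then obtain a b where "e = {a, b}" using edge_ex by blast
        then show "x \<in> set hs" using e hs(3) edge_lt[of a b] unfolding handled_def by auto
      qed
      moreover have "length hs \<le> 2 * card X" if X: "safe_cover X" for X
      proof -
        have "card (set hs) = card (set hs - X) + card (set hs \<inter> X)"
          by (metis List.finite_set add.commute card_Int_Diff)
        also have "\<dots> \<le> 2 * card (set hs \<inter> X)" using hs(2) X unfolding balanced_def by fastforce
        also have "\<dots> \<le> 2 * card X"
        proof -
          have "finite X" using X fin finite_subset unfolding safe_cover_def by blast
          then show ?thesis by (simp add: card_mono)
        qed
        finally show ?thesis using hs(1) distinct_card[of hs] unfolding hrep_def by simp
      qed
      ultimately show "?Q s3" using hs(1) by blast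
    qed (use nN in auto)
  qed (use nN in auto)
  then show ?thesis unfolding cover_com_def s1_def by (rule runs_Seq_ev[rotated]) simp
qed

end

section \<open>Correctness and running time\<close>

definition loop_com :: com where
  "loop_com = Seq check_com (Seq (If (Eq (Var ''acc'') (Const 1)) (Set ''out'' (Const 1)) Skip) inc_com)"

definition double_com :: com where
  "double_com = Set ''B'' (Add (Var ''B'') (Var ''B''))"

text \<open>Six doublings of \<open>2 * q\<close> yield \<open>128 * q\<close>, and seven summands
  yield \<open>7 * q\<close>, all without a multiplication.\<close>

definition enum_init :: com where
  "enum_init = Seq (Set ''B'' (Add (Var ''q'') (Var ''q'')))
     (Seq double_com (Seq double_com (Seq double_com (Seq double_com (Seq double_com (Seq double_com
     (Seq (Set ''L'' (Add (Var ''q'') (Add (Var ''q'') (Add (Var ''q'') (Add (Var ''q'') (Add (Var ''q'') (Add (Var ''q'') (Var ''q''))))))))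
       (Set ''fin'' (Const 0)))))))))"

definition enum_com :: com where
  "enum_com = Seq enum_init (While (Less (Var ''fin'') (Const 1)) loop_com)"

definition six_q :: aexp where
  "six_q = Add (Var ''q'') (Add (Var ''q'') (Add (Var ''q'') (Add (Var ''q'') (Add (Var ''q'') (Var ''q'')))))"

text \<open>The empty graph is treated apart because both the bound \<open>2 * (n - 1)\<close> and
  the search from vertex 0 presuppose a vertex.\<close>

definition UFGC_com :: com where
  "UFGC_com = If (Less (Var ''n'') (Const 1))
     (If (Less (Var ''k'') (Const 0)) Skip (Set ''out'' (Const 1)))
     (Seq rows_com (Seq feas_com (If (Less (Var ''feas'') (Const 1)) Skip
       (Seq (Set ''q'' (Sub (Add (Var ''n'') (Var ''n'')) (Add (Const 2) (Var ''k''))))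
         (If (Less (Var ''q'') (Const 1)) (Set ''out'' (Const 1))
           (Seq cover_com (If (Less six_q (Var ''h'')) (Set ''out'' (Const 1)) enum_com)))))))"

section \<open>The exponential enumeration\<close>

text \<open>Only the enumeration makes more than \<open>N\<close> rounds of a loop; its cost enters
  as the additive term \<open>K\<close>.\<close>

definition slow_runs :: "nat \<Rightarrow> nat \<Rightarrow> com \<Rightarrow> store \<Rightarrow> (store \<Rightarrow> bool) \<Rightarrow> bool" where
  "slow_runs N K c s Q \<longleftrightarrow> (\<exists>t s'. exec c s t s' \<and> t \<le> tm N c + K \<and> Q s')"

lemma slow_runs_if_runs: "runs N c s Q \<Longrightarrow> slow_runs N K c s Q"
  unfolding runs_def slow_runs_def by (meson trans_le_add1)

lemma slow_runs_Seq:
  assumes "runs N c s R" "\<And>s'. frame (mods c) s s' \<Longrightarrow> R s' \<Longrightarrow> slow_runs N K d s' Q"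
  shows "slow_runs N K (Seq c d) s Q"
proof -
  obtain t s' where 1: "exec c s t s'" "t \<le> tm N c" "R s'" using assms(1) unfolding runs_def by blast
  then obtain t' s'' where 2: "exec d s' t' s''" "t' \<le> tm N d + K" "Q s''"
    using assms(2) exec_frame unfolding slow_runs_def by blast
  have "exec (Seq c d) s (t + t') s''" by (rule exec.Seq[OF 1(1) 2(1)])
  then show ?thesis using 1(2) 2(2,3) unfolding slow_runs_def by (intro exI[of _ "t + t'"] exI[of _ s'']) simp
qed

lemma slow_runs_If:
  assumes "bval b s \<Longrightarrow> slow_runs N K c s Q" "\<not> bval b s \<Longrightarrow> slow_runs N K d s Q"
  shows "slow_runs N K (If b c d) s Q"
proof (cases "bval b s")
  case True
  then obtain t s' where 1: "exec c s t s'" "t \<le> tm N c + K" "Q s'" using assms(1) unfolding slow_runs_def by blast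
  have "exec (If b c d) s (1 + bcost b + t) s'" by (rule exec.IfTrue[OF True 1(1)])
  then show ?thesis using 1(2,3) unfolding slow_runs_def by (intro exI[of _ "1 + bcost b + t"] exI[of _ s']) simp
next
  case False
  then obtain t s' where 1: "exec d s t s'" "t \<le> tm N d + K" "Q s'" using assms(2) unfolding slow_runs_def by blast
  have "exec (If b c d) s (1 + bcost b + t) s'" by (rule exec.IfFalse[OF False 1(1)])
  then show ?thesis using 1(2,3) unfolding slow_runs_def by (intro exI[of _ "1 + bcost b + t"] exI[of _ s']) simp
qed

lemma select_cong: "(\<And>i. i < m \<Longrightarrow> P i \<longleftrightarrow> Q i) \<Longrightarrow> select P m j = select Q m j"
proof (induction m)
  case (Suc m)
  have "{i'. i' < m \<and> P i'} = {i'. i' < m \<and> Q i'}" using Suc.prems by auto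
  then show ?case using Suc by simp
qed simp

text \<open>The elements of rank below \<open>B\<close> are the first \<open>B\<close> ones, or all
  of them if there are fewer.\<close>

lemma card_low_rank:
  fixes m :: nat
  shows "min B (card {i. i < m \<and> P i}) \<le> card {i. i < m \<and> P i \<and> card {i'. i' < i \<and> P i'} < B}"
proof (induction m)
  case (Suc m)
  have "card {i. i < Suc m \<and> P i \<and> card {i'. i' < i \<and> P i'} < B} =
      card {i. i < m \<and> P i \<and> card {i'. i' < i \<and> P i'} < B} + (if P m \<and> card {i'. i' < m \<and> P i'} < B then 1 else 0)"
    using card_less_Suc_Collect[of m "\<lambda>i. P i \<and> card {i'. i' < i \<and> P i'} < B"] by simp
  moreover have "card {i. i < Suc m \<and> P i} = card {i. i < m \<and> P i} + (if P m then 1 else 0)"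
    by (rule card_less_Suc_Collect)
  ultimately show ?case using Suc.IH by (auto simp: min_def split: if_splits)
qed simp

context ram
begin

definition accepts :: "store \<Rightarrow> nat \<Rightarrow> nat \<Rightarrow> (nat \<Rightarrow> nat) \<Rightarrow> nat \<Rightarrow> nat \<Rightarrow> (nat \<Rightarrow> nat) \<Rightarrow> bool" where
  "accepts s q h hv B L dg \<longleftrightarrow> accept E q (snd ((nxt S E h hv (decode n s) dg ^^ L) (0, (int, [], 0))))"

lemma runs_loop:
  assumes env: "env n S U s" and st: "s ''q'' 0 = int q" "s ''L'' 0 = int L" "L \<le> N" "s ''h'' 0 = int h"
    "s ''B'' 0 = int B" "0 < B" "\<And>d. 1 \<le> d \<Longrightarrow> d \<le> h \<Longrightarrow> s ''H'' (int d) = int (hv d) \<and> hv d < n"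
    and v: "v < B ^ L" "\<And>i. s ''D'' (int i) = int (digit B L v i)" "s ''fin'' 0 = 0"
  shows "runs N loop_com s (\<lambda>s'. (\<forall>i. s' ''D'' (int i) = int (digit B L (Suc v) i)) \<and>
    s' ''fin'' 0 = (if Suc v = B ^ L then 1 else 0) \<and>
    s' ''out'' 0 = (if accepts s q h hv B L (digit B L v) then 1 else s ''out'' 0))"
  unfolding loop_com_def
proof (rule runs_Seq[OF runs_check[OF env st(1-4) v(2) st(7)]])
  let ?out = "If (Eq (Var ''acc'') (Const 1)) (Set ''out'' (Const 1)) Skip"
  fix s1 assume fr1: "frame (mods check_com) s s1" and acc: "s1 ''acc'' 0 = (if accept E q
      (snd ((nxt S E h hv (decode n s) (digit B L v) ^^ L) (0, (int, [], 0)))) then 1 else 0)"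
  define s2 where "s2 = ev ?out s1"
  have out: "s2 ''out'' 0 = (if accepts s q h hv B L (digit B L v) then 1 else s ''out'' 0)"
    using acc frameD[OF fr1] unfolding s2_def accepts_def by simp
  have st2: "s2 y = s y" if "y \<in> {''B'', ''L'', ''D'', ''fin''}" for y
    using that frameD[OF fr1, of y] unfolding s2_def by auto
  have "runs N inc_com s2 (\<lambda>s'. (\<forall>i. s' ''D'' (int i) = int (digit B L (Suc v) i)) \<and>
      s' ''fin'' 0 = (if Suc v = B ^ L then 1 else 0))"
    by (rule runs_inc) (use st2 st v in simp_all)
  then have "runs N inc_com s2 (\<lambda>s'. (\<forall>i. s' ''D'' (int i) = int (digit B L (Suc v) i)) \<and>
    s' ''fin'' 0 = (if Suc v = B ^ L then 1 else 0) \<and>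
    s' ''out'' 0 = (if accepts s q h hv B L (digit B L v) then 1 else s ''out'' 0))"
    by (rule runs_mono) (use out in \<open>simp add: frame_def\<close>)
  then show "runs N (Seq ?out inc_com) s1 (\<lambda>s'. (\<forall>i. s' ''D'' (int i) = int (digit B L (Suc v) i)) \<and>
    s' ''fin'' 0 = (if Suc v = B ^ L then 1 else 0) \<and>
    s' ''out'' 0 = (if accepts s q h hv B L (digit B L v) then 1 else s ''out'' 0))"
    unfolding s2_def by (rule runs_Seq_ev[rotated]) simp
qed

lemma slow_runs_enum:
  assumes env: "env n S U s" and st: "s ''q'' 0 = int q" "1 \<le> q" "7 * q \<le> N" "s ''h'' 0 = int h"
    "\<And>d. 1 \<le> d \<Longrightarrow> d \<le> h \<Longrightarrow> s ''H'' (int d) = int (hv d) \<and> hv d < n"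
    and z: "s ''D'' = (\<lambda>_. 0)" "s ''out'' 0 = 0"
  shows "slow_runs N (((128 * q) ^ (7 * q) + 1) * tm N enum_com) enum_com s (\<lambda>s'. s' ''out'' 0 =
    (if \<exists>v<(128 * q) ^ (7 * q). accepts s q h hv (128 * q) (7 * q) (digit (128 * q) (7 * q) v) then 1 else 0))"
proof -
  define B L M where "B = 128 * q" and "L = 7 * q" and "M = B ^ L"
  define s1 where "s1 = ev enum_init s"
  have fr1: "frame {''B'', ''L'', ''fin''} s s1"
    unfolding s1_def enum_init_def double_com_def frame_def by simp
  have s1: "s1 ''B'' 0 = int B" "s1 ''L'' 0 = int L" "s1 ''fin'' 0 = 0"
    using st(1) unfolding s1_def enum_init_def double_com_def B_def L_def by simp_all
  have st1: "s1 y = s y" if "y \<in> {''n'', ''G'', ''R'', ''q'', ''h'', ''H'', ''D'', ''out''}" for y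
    using that frameD[OF fr1, of y] by auto
  have B0: "0 < B" using st(2) unfolding B_def by simp
  have M0: "0 < M" using B0 unfolding M_def by simp
  have stable: "y \<notin> mods loop_com" if "y \<in> {''n'', ''G'', ''R'', ''q'', ''h'', ''H'', ''B'', ''L''}" for y
    using that unfolding loop_com_def by auto
  define I where "I v s' \<longleftrightarrow> frame (mods loop_com) s1 s' \<and> (\<forall>i. s' ''D'' (int i) = int (digit B L v i)) \<and>
    s' ''fin'' 0 = (if v = M then 1 else 0) \<and>
    s' ''out'' 0 = (if \<exists>v'<v. accepts s q h hv B L (digit B L v') then 1 else 0)" for v s'
  let ?b = "Less (Var ''fin'') (Const 1)"
  have "\<exists>t s'. exec (While ?b loop_com) s1 t s' \<and> t \<le> (M - 0 + 1) * (1 + bcost ?b + tm N loop_com) \<and> I M s'"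
  proof (rule exec_While_bounded[where I = I])
    show "I 0 s1" unfolding I_def using s1(3) z st1 M0 by (simp add: frame_def digit_def)
    show "\<not> bval ?b s'" if "I M s'" for s' using that unfolding I_def by simp
    fix v s' assume v: "v < M" and I: "I v s'"
    have fr: "frame (mods loop_com) s1 s'" using I unfolding I_def by blast
    have st': "s' y = s1 y" if "y \<in> {''n'', ''G'', ''R'', ''q'', ''h'', ''H'', ''B'', ''L''}" for y
      using frameD[OF fr stable[OF that]] .
    have env': "env n S U s'" using env st' st1 unfolding env_def by simp
    have "decode n s' = decode n s" using st' st1 unfolding decode_def row_hit_def by simp
    then have acc: "accepts s' q h hv B L dg \<longleftrightarrow> accepts s q h hv B L dg" for dg unfolding accepts_def by simp
    have "runs N loop_com s' (\<lambda>s''. (\<forall>i. s'' ''D'' (int i) = int (digit B L (Suc v) i)) \<and>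
        s'' ''fin'' 0 = (if Suc v = B ^ L then 1 else 0) \<and>
        s'' ''out'' 0 = (if accepts s' q h hv B L (digit B L v) then 1 else s' ''out'' 0))"
      by (rule runs_loop[OF env'])
        (use st' st1 s1 st I v B0 in \<open>simp_all add: I_def M_def L_def\<close>)
    then obtain t s'' where ex: "exec loop_com s' t s''" "t \<le> tm N loop_com"
        "\<forall>i. s'' ''D'' (int i) = int (digit B L (Suc v) i)" "s'' ''fin'' 0 = (if Suc v = M then 1 else 0)"
        "s'' ''out'' 0 = (if accepts s' q h hv B L (digit B L v) then 1 else s' ''out'' 0)"
      unfolding runs_def M_def by blast
    have "s'' ''out'' 0 = (if \<exists>v'<Suc v. accepts s q h hv B L (digit B L v') then 1 else 0)"
      using ex(5) I unfolding I_def acc ex_less_Suc_disj by simp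
    then have "I (Suc v) s''"
      unfolding I_def using ex(3,4) frame_trans[OF fr exec_frame[OF ex(1)]] by blast
    moreover have "bval ?b s'" using I v unfolding I_def by simp
    ultimately show "bval ?b s' \<and> (\<exists>t s''. exec loop_com s' t s'' \<and> t \<le> tm N loop_com \<and> I (Suc v) s'')"
      using ex(1,2) by blast
  qed simp
  then obtain t s' where ex: "exec (While ?b loop_com) s1 t s'" "t \<le> (M + 1) * (1 + bcost ?b + tm N loop_com)" "I M s'"
    by auto
  have "loop_free enum_init" unfolding enum_init_def double_com_def by simp
  then have "runs N enum_init s (\<lambda>s'. s' = s1)" unfolding s1_def by (rule runs_loop_free) simp
  then obtain t1 where ex1: "exec enum_init s t1 s1" "t1 \<le> tm N enum_init" unfolding runs_def by blast
  have "exec enum_com s (t1 + t) s'" unfolding enum_com_def by (rule exec.Seq[OF ex1(1) ex(1)])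
  moreover have "t1 + t \<le> tm N enum_com + (M + 1) * tm N enum_com"
  proof -
    \<comment> \<open>\<open>tm N enum_com\<close> already charges at least one round, so it serves
      as the price of each round and no separate constant for the loop body arises.\<close>
    have "tm N enum_com = tm N enum_init + (N + 1) * (1 + bcost ?b + tm N loop_com)"
      unfolding enum_com_def by simp
    then have "1 + bcost ?b + tm N loop_com \<le> tm N enum_com" "tm N enum_init \<le> tm N enum_com" by simp_all
    then have "(M + 1) * (1 + bcost ?b + tm N loop_com) \<le> (M + 1) * tm N enum_com" by (intro mult_left_mono) simp_all
    then show ?thesis using ex(2) ex1(2) \<open>tm N enum_init \<le> tm N enum_com\<close> by linarith
  qed
  moreover have "s' ''out'' 0 = (if \<exists>v<M. accepts s q h hv B L (digit B L v) then 1 else 0)"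
    using ex(3) unfolding I_def by blast
  ultimately show ?thesis unfolding slow_runs_def M_def B_def L_def by blast
qed

text \<open>The vertices that no code addresses have at least \<open>B\<close> addressed substitutes for any pair
  of neighbours.\<close>

lemma accepts_iff_gain:
  assumes env: "env n S U s" and hs: "hrep s hs" "safe_cover (set hs)" "length hs \<le> 6 * q" and q: "1 \<le> q"
  defines "hv \<equiv> \<lambda>d. hs ! (d - 1 :: nat)"
  shows "(\<exists>v<(128 * q) ^ (7 * q). accepts s q (length hs) hv (128 * q) (7 * q) (digit (128 * q) (7 * q) v)) \<longleftrightarrow>
    gain S E id q"
proof -
  define h B where "h = length hs" and "B = 128 * q"
  define D where "D = {w \<in> {..<n}. w \<notin> set hs \<and>
    \<not> (\<exists>a b j. 1 \<le> a \<and> a \<le> h \<and> 1 \<le> b \<and> b \<le> h \<and> j < B \<and> decode n s a b j = Some w)}"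
  have H: "s ''H'' (int a) = int (hv a)" "hv a \<in> set hs" if a: "1 \<le> a" "a \<le> h" for a
  proof -
    obtain i where "a = Suc i" "i < h" using a by (cases a) simp_all
    then show "s ''H'' (int a) = int (hv a)" using hs(1) unfolding hrep_def h_def hv_def by simp
    show "hv a \<in> set hs" using a unfolding hv_def h_def by simp
  qed
  have hsn: "v < n" if "v \<in> set hs" for v using hs(1) that unfolding hrep_def by auto
  have decode_select: "decode n s a b j = select (\<lambda>i. {hv a, i} \<in> E \<and> {hv b, i} \<in> E) n j"
    if "1 \<le> a" "a \<le> h" "1 \<le> b" "b \<le> h" for a b j
    unfolding decode_def
  proof (rule select_cong)
    fix i assume "i < n"
    then show "row_hit s (s ''H'' (int a)) i \<and> row_hit s (s ''H'' (int b)) i \<longleftrightarrow> {hv a, i} \<in> E \<and> {hv b, i} \<in> E"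
      using env H that hsn unfolding row_hit_def env_def by (simp add: edge_code_cases)
  qed
  have hv_ex: "\<exists>a. 1 \<le> a \<and> a \<le> h \<and> hv a = x" if "x \<in> set hs" for x
  proof -
    from that obtain i where "i < h" "hs ! i = x" unfolding h_def in_set_conv_nth by blast
    then show ?thesis unfolding hv_def by (intro exI[of _ "Suc i"]) simp
  qed
  have hv: "hv ` {1..h} = set hs" using hv_ex H(2) by force
  interpret certificates "{..<n}" S U "set hs" D h B hv "decode n s"
  proof
    show "safe_cover (set hs)" by (rule hs(2))
    show "hv ` {1..h} = set hs" by (rule hv)
    show "2 * h + 1 < B" using hs(3) q unfolding h_def B_def by linarith
    fix w x assume "w \<notin> set hs" "w \<notin> D" "{x, w} \<in> E"
    then show "\<exists>a b j. 1 \<le> a \<and> a \<le> h \<and> 1 \<le> b \<and> b \<le> h \<and> j < B \<and> decode n s a b j = Some w"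
      using edge_lt[of x w] unfolding D_def by blast
  qed
  have rich: "12 * card (set hs) \<le> card {f. {x, f} \<in> E \<and> {y, f} \<in> E \<and> f \<notin> D}"
    if d: "d \<in> D" "x \<in> set hs" "y \<in> set hs" "{x, d} \<in> E" "{y, d} \<in> E" for d x y
  proof -
    define P where "P i \<longleftrightarrow> {x, i} \<in> E \<and> {y, i} \<in> E" for i
    obtain a b where ab: "1 \<le> a" "a \<le> h" "hv a = x" "1 \<le> b" "b \<le> h" "hv b = y" using hv_ex d(2,3) by metis
    have dec': "decode n s a b j = select P n j" for j
      using decode_select[OF ab(1,2,4,5)] ab(3,6) unfolding P_def by simp
    have addr: "w \<notin> D" if "w < n" "P w" "card {i'. i' < w \<and> P i'} < B" for w
    proof -
      have "select P n (card {i'. i' < w \<and> P i'}) = Some w" by (rule select_eq[of w n P, OF that(1,2)]) simp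
      then have "decode n s a b (card {i'. i' < w \<and> P i'}) = Some w" by (simp only: dec')
      then show ?thesis using ab(1,2,4,5) that(3) unfolding D_def by blast
    qed
    have dn: "d < n" "P d" using d unfolding D_def P_def by auto
    \<comment> \<open>\<open>d\<close> is itself a common neighbour of \<open>x\<close> and
      \<open>y\<close> but not addressed, so at least \<open>B\<close> common neighbours precede it;
      the first \<open>B\<close> of them are addressed.\<close>
    have "B \<le> card {i'. i' < d \<and> P i'}" using addr[OF dn] d(1) by (meson not_le)
    then have "B \<le> card {i. i < d \<and> P i \<and> card {i'. i' < i \<and> P i'} < B}"
      using card_low_rank[of B d P] by simp
    also have "\<dots> \<le> card {f. {x, f} \<in> E \<and> {y, f} \<in> E \<and> f \<notin> D}"
    proof (rule card_mono)
      have "f < n" if "{x, f} \<in> E" for f using edge_lt[OF that] by simp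
      then have "{f. {x, f} \<in> E \<and> {y, f} \<in> E \<and> f \<notin> D} \<subseteq> {..<n}" by blast
      then show "finite {f. {x, f} \<in> E \<and> {y, f} \<in> E \<and> f \<notin> D}" using finite_subset by blast
      show "{i. i < d \<and> P i \<and> card {i'. i' < i \<and> P i'} < B} \<subseteq> {f. {x, f} \<in> E \<and> {y, f} \<in> E \<and> f \<notin> D}"
        using addr dn(1) P_def by auto
    qed
    finally have "B \<le> card {f. {x, f} \<in> E \<and> {y, f} \<in> E \<and> f \<notin> D}" .
    moreover have "12 * card (set hs) \<le> B" using hs(3) card_length[of hs] unfolding B_def by linarith
    ultimately show ?thesis by (rule order_trans[rotated])
  qed
  have B0: "0 < B" using q unfolding B_def by simp
  have "gain S E id q \<longleftrightarrow> (\<exists>dg. (\<forall>i. dg i < B) \<and> (\<forall>i\<ge>7 * q. dg i = 0) \<and> accepts s q h hv B (7 * q) dg)"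
    unfolding accepts_def
  proof (rule gain_iff_certificate)
    show "finite D" "D \<inter> set hs = {}" unfolding D_def by auto
    show "inj int" by (simp add: inj_on_def)
  qed (rule rich)
  also have "\<dots> \<longleftrightarrow> (\<exists>v<B ^ (7 * q). accepts s q h hv B (7 * q) (digit B (7 * q) v))"
  proof
    assume "\<exists>dg. (\<forall>i. dg i < B) \<and> (\<forall>i\<ge>7 * q. dg i = 0) \<and> accepts s q h hv B (7 * q) dg"
    then obtain dg where "\<forall>i. dg i < B" "\<forall>i\<ge>7 * q. dg i = 0" "accepts s q h hv B (7 * q) dg" by blast
    moreover from this obtain v where "v < B ^ (7 * q)" "digit B (7 * q) v = dg"
      using digits_ex[of dg B "7 * q"] by blast
    ultimately show "\<exists>v<B ^ (7 * q). accepts s q h hv B (7 * q) (digit B (7 * q) v)" by blast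
  next
    assume "\<exists>v<B ^ (7 * q). accepts s q h hv B (7 * q) (digit B (7 * q) v)"
    then obtain v where "accepts s q h hv B (7 * q) (digit B (7 * q) v)" by blast
    moreover have "\<forall>i. digit B (7 * q) v i < B" "\<forall>i\<ge>7 * q. digit B (7 * q) v i = 0"
      using digit_less[OF B0] unfolding digit_def by simp_all
    ultimately show "\<exists>dg. (\<forall>i. dg i < B) \<and> (\<forall>i\<ge>7 * q. dg i = 0) \<and> accepts s q h hv B (7 * q) dg" by blast
  qed
  finally show ?thesis unfolding h_def B_def by simp
qed

end

section \<open>The complete program and its running time\<close>

lemma env_instance:
  assumes "frame X (instance_store n S U k) s" "X \<inter> {''n'', ''G''} = {}" "\<forall>i<n. s ''R'' (int i) = int i * int n"
  shows "env n S U s"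
  unfolding env_def
proof (intro conjI allI impI)
  have s: "s ''n'' = instance_store n S U k ''n''" "s ''G'' = instance_store n S U k ''G''"
    using frameD[OF assms(1)] assms(2) by auto
  show "s ''n'' 0 = int n" unfolding s instance_store_def by simp
  fix i j assume ij: "i < n" "j < n"
  have e: "int i * int n + int j = int (i * n + j)" by simp
  have "i * n + j < Suc i * n" using ij(2) by simp
  also have "\<dots> \<le> n * n" using ij(1) by (intro mult_right_mono) simp_all
  finally have lt: "i * n + j < n * n" .
  have dm: "(i * n + j) div n = i" "(i * n + j) mod n = j" using ij by simp_all
  have "s ''G'' (int (i * n + j)) = edge_code S U i j"
  proof -
    have "int (i * n + j) < int n * int n" using lt by (metis of_nat_less_iff of_nat_mult)
    then show ?thesis unfolding s instance_store_def edge_code_def using dm by (simp add: Let_def del: of_nat_add of_nat_mult)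
  qed
  moreover have "s ''R'' (int i) = int i * int n" using assms(3) ij(1) by blast
  ultimately show "s ''G'' (s ''R'' (int i) + int j) = edge_code S U i j" by (simp only: e)
qed

lemma UFGC_empty: "UFGC {} {} {} k \<longleftrightarrow> 0 \<le> k"
  unfolding UFGC_def unsafe_spanning_connected_def graph_connected_def by auto

text \<open>\<open>N\<close> covers both kinds of counting loops: those over vertices make
  \<open>n\<close> rounds, those over digits or tokens \<open>7 * q\<close>.\<close>

lemma UFGC_com_correct:
  fixes n :: nat and k :: int
  assumes fg: "flex_graph {..<n} S U"
  defines "q \<equiv> nat (2 * int n - 2 - k)"
  defines "N \<equiv> n + 7 * q"
  shows "slow_runs N (((128 * q) ^ (7 * q) + 1) * tm N enum_com) UFGC_com (instance_store n S U k)
    (\<lambda>s'. s' ''out'' 0 = (if UFGC {..<n} S U k then 1 else 0))"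
proof -
  interpret ram n N S U by (unfold_locales) (simp_all add: fg N_def)
  define s0 where "s0 = instance_store n S U k"
  let ?K = "((128 * q) ^ (7 * q) + 1) * tm N enum_com"
  let ?Q = "\<lambda>s'. s' ''out'' 0 = (if UFGC {..<n} S U k then (1 :: int) else 0)"
  have s0: "s0 ''n'' 0 = int n" "s0 ''k'' 0 = k" "s0 ''out'' 0 = 0" "s0 ''D'' = (\<lambda>_. 0)"
    unfolding s0_def instance_store_def by (auto simp: fun_eq_iff)
  show ?thesis
    unfolding UFGC_com_def s0_def[symmetric]
  proof (rule slow_runs_If)
    assume "bval (Less (Var ''n'') (Const 1)) s0"
    then have n0: "n = 0" using s0 by simp
    then have "S = {}" "U = {}" using edge_ex by fastforce+
    then have UF: "UFGC {..<n} S U k \<longleftrightarrow> 0 \<le> k" using UFGC_empty n0 by simp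
    show "slow_runs N ?K (If (Less (Var ''k'') (Const 0)) Skip (Set ''out'' (Const 1))) s0 ?Q"
      by (rule slow_runs_if_runs, rule runs_loop_free) (use s0 UF in auto)
  next
    assume "\<not> bval (Less (Var ''n'') (Const 1)) s0"
    then have n: "0 < n" using s0 by simp
    have UF: "UFGC {..<n} S U k \<longleftrightarrow> good {..<n} U E id \<and> gain S E id q"
      using UFGC_iff_gain[of k] n unfolding q_def by (auto simp: lessThan_empty_iff)
    show "slow_runs N ?K (Seq rows_com (Seq feas_com (If (Less (Var ''feas'') (Const 1)) Skip
       (Seq (Set ''q'' (Sub (Add (Var ''n'') (Var ''n'')) (Add (Const 2) (Var ''k''))))
         (If (Less (Var ''q'') (Const 1)) (Set ''out'' (Const 1))
           (Seq cover_com (If (Less six_q (Var ''h'')) (Set ''out'' (Const 1)) enum_com))))))) s0 ?Q"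
    proof (rule slow_runs_Seq[OF runs_rows[of s0, OF s0(1)]], rule slow_runs_Seq[OF runs_feas[OF _ n]])
      fix s1 assume fr1: "frame (mods rows_com) s0 s1" and R: "\<forall>i<n. s1 ''R'' (int i) = int i * int n"
      show env1: "env n S U s1" by (rule env_instance[OF fr1[unfolded s0_def] _ R]) simp
      fix s2 assume fr2: "frame (mods feas_com) s1 s2" and feas: "s2 ''feas'' 0 = (if good {..<n} U E id then 1 else 0)"
      have env2: "env n S U s2" by (rule env_frame[OF env1 fr2]) simp
      have st2: "s2 ''k'' 0 = k" "s2 ''out'' 0 = 0" "s2 ''D'' = (\<lambda>_. 0)" "s2 ''n'' 0 = int n"
        using frameD[OF fr2] frameD[OF fr1] s0 by simp_all
      show "slow_runs N ?K (If (Less (Var ''feas'') (Const 1)) Skip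
       (Seq (Set ''q'' (Sub (Add (Var ''n'') (Var ''n'')) (Add (Const 2) (Var ''k''))))
         (If (Less (Var ''q'') (Const 1)) (Set ''out'' (Const 1))
           (Seq cover_com (If (Less six_q (Var ''h'')) (Set ''out'' (Const 1)) enum_com))))) s2 ?Q"
      proof (rule slow_runs_If)
        assume "bval (Less (Var ''feas'') (Const 1)) s2"
        then have "\<not> UFGC {..<n} S U k" using feas UF by (simp split: if_splits)
        then show "slow_runs N ?K Skip s2 ?Q" using st2 by (intro slow_runs_if_runs runs_Skip) simp
      next
        assume "\<not> bval (Less (Var ''feas'') (Const 1)) s2"
        then have g: "good {..<n} U E id" using feas by (simp split: if_splits)
        show "slow_runs N ?K (Seq (Set ''q'' (Sub (Add (Var ''n'') (Var ''n'')) (Add (Const 2) (Var ''k''))))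
         (If (Less (Var ''q'') (Const 1)) (Set ''out'' (Const 1))
           (Seq cover_com (If (Less six_q (Var ''h'')) (Set ''out'' (Const 1)) enum_com)))) s2 ?Q"
        proof (rule slow_runs_Seq[OF runs_Assign[where Q = "\<lambda>s'. s' ''q'' 0 = 2 * int n - 2 - k"]])
          fix s3 assume fr3: "frame (mods (Set ''q'' (Sub (Add (Var ''n'') (Var ''n'')) (Add (Const 2) (Var ''k''))))) s2 s3"
            and q3: "s3 ''q'' 0 = 2 * int n - 2 - k"
          have env3: "env n S U s3" by (rule env_frame[OF env2 fr3]) simp
          have st3: "s3 ''out'' 0 = 0" "s3 ''D'' = (\<lambda>_. 0)" using frameD[OF fr3] st2 by simp_all
          show "slow_runs N ?K (If (Less (Var ''q'') (Const 1)) (Set ''out'' (Const 1))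
             (Seq cover_com (If (Less six_q (Var ''h'')) (Set ''out'' (Const 1)) enum_com))) s3 ?Q"
          proof (rule slow_runs_If)
            assume "bval (Less (Var ''q'') (Const 1)) s3"
            then have "q = 0" using q3 unfolding q_def by simp
            \<comment> \<open>A budget of at least \<open>2 * (n - 1)\<close> is met by every
              feasible instance.\<close>
            then have "UFGC {..<n} S U k" using UF g gain_0 by simp
            then show "slow_runs N ?K (Set ''out'' (Const 1)) s3 ?Q"
              by (intro slow_runs_if_runs runs_Assign) simp
          next
            assume "\<not> bval (Less (Var ''q'') (Const 1)) s3"
            then have q: "1 \<le> q" "s3 ''q'' 0 = int q" using q3 unfolding q_def by auto
            show "slow_runs N ?K (Seq cover_com (If (Less six_q (Var ''h'')) (Set ''out'' (Const 1)) enum_com)) s3 ?Q"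
            proof (rule slow_runs_Seq[OF runs_cover[OF env3]])
              fix s4 assume fr4: "frame (mods cover_com) s3 s4" and "\<exists>hs. hrep s4 hs \<and> safe_cover (set hs) \<and>
                (\<forall>X. safe_cover X \<longrightarrow> length hs \<le> 2 * card X)"
              then obtain hs where hs: "hrep s4 hs" "safe_cover (set hs)" "\<And>X. safe_cover X \<Longrightarrow> length hs \<le> 2 * card X"
                by blast
              have env4: "env n S U s4" by (rule env_frame[OF env3 fr4]) simp
              have st4: "s4 ''out'' 0 = 0" "s4 ''D'' = (\<lambda>_. 0)" "s4 ''q'' 0 = int q" "s4 ''h'' 0 = int (length hs)"
                using frameD[OF fr4] st3 q hs(1) unfolding hrep_def by simp_all
              show "slow_runs N ?K (If (Less six_q (Var ''h'')) (Set ''out'' (Const 1)) enum_com) s4 ?Q"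
              proof (rule slow_runs_If)
                assume "bval (Less six_q (Var ''h'')) s4"
                then have "6 * q < length hs" using st4 unfolding six_q_def by simp
                then have "gain S E id q" using gain_if_no_small_cover[OF g hs(3)] by blast
                then have "UFGC {..<n} S U k" using UF g by blast
                then show "slow_runs N ?K (Set ''out'' (Const 1)) s4 ?Q"
                  by (intro slow_runs_if_runs runs_Assign) simp
              next
                assume "\<not> bval (Less six_q (Var ''h'')) s4"
                then have h: "length hs \<le> 6 * q" using st4 unfolding six_q_def by simp
                have Hc: "s4 ''H'' (int d) = int (hs ! (d - 1)) \<and> hs ! (d - 1) < n" if d: "1 \<le> d" "d \<le> length hs" for d
                proof -
                  obtain i where i: "d = Suc i" "i < length hs" using d by (cases d) simp_all
                  then have "hs ! i < n" using hs(1) nth_mem[OF i(2)] unfolding hrep_def by blast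
                  then show ?thesis using hs(1) i unfolding hrep_def by simp
                qed
                have "slow_runs N ?K enum_com s4 (\<lambda>s'. s' ''out'' 0 =
                  (if \<exists>v<(128 * q) ^ (7 * q). accepts s4 q (length hs) (\<lambda>d. hs ! (d - 1)) (128 * q) (7 * q)
                    (digit (128 * q) (7 * q) v) then 1 else 0))"
                  by (rule slow_runs_enum[OF env4 st4(3) q(1) _ st4(4) Hc st4(2,1)]) (simp add: N_def)
                then show "slow_runs N ?K enum_com s4 ?Q"
                  unfolding accepts_iff_gain[OF env4 hs(1,2) h q(1)] using UF g by simp
              qed
            qed
          qed
        qed (use st2 in simp)
      qed
    qed
  qed
qed

text \<open>The slack between the exponents \<open>7 l\<close> and \<open>8 l\<close> absorbs the exponential factor
  \<open>K ^ (8 l)\<close> and any fixed power of \<open>l\<close>, since \<open>K ^ 16 \<le> l\<close> for large \<open>l\<close>.\<close>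

lemma growth_large:
  fixes l d K :: nat
  assumes K: "256 \<le> K" "K ^ 16 \<le> l" and l: "2 * (14 + d) \<le> l"
  shows "(128 * (l + 2)) ^ (7 * (l + 2)) * (8 * (l + 2)) ^ d \<le> l ^ (8 * l)"
proof -
  have l1: "1 \<le> l" "l + 2 \<le> 2 * l" using l by simp_all
  have Kl: "256 * l \<le> K * l" using K(1) by (rule mult_le_mono1)
  have "128 * (l + 2) \<le> 256 * l" "8 * (l + 2) \<le> 256 * l" using l1(2) by simp_all
  then have 1: "128 * (l + 2) \<le> K * l" "8 * (l + 2) \<le> K * l" using Kl by (blast intro: le_trans)+
  have "(128 * (l + 2)) ^ (7 * (l + 2)) * (8 * (l + 2)) ^ d \<le> (K * l) ^ (7 * (l + 2)) * (K * l) ^ d"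
    by (rule mult_le_mono[OF power_mono[OF 1(1)] power_mono[OF 1(2)]]) simp_all
  also have "\<dots> = (K * l) ^ (7 * l + 14 + d)"
    unfolding power_add[symmetric] by (rule arg_cong[where f = "\<lambda>e. (K * l) ^ e"]) simp
  also have "\<dots> = K ^ (7 * l + 14 + d) * l ^ (7 * l + 14 + d)" by (rule power_mult_distrib)
  also have "\<dots> \<le> K ^ (8 * l) * l ^ (7 * l + 14 + d)"
    by (rule mult_le_mono1, rule power_increasing) (use l K(1) in simp_all)
  also have "\<dots> = (K ^ (8 * l) * l ^ (14 + d)) * l ^ (7 * l)"
    by (simp only: power_add mult_ac)
  also have "\<dots> \<le> l ^ l * l ^ (7 * l)"
  proof (rule mult_le_mono1)
    \<comment> \<open>Each of the two factors is at most the square root of \<open>l ^ l\<close>;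
      comparing squares avoids roots.\<close>
    have "(K ^ (8 * l))\<^sup>2 = (K ^ 16) ^ l"
      unfolding power_mult[symmetric] by (rule arg_cong[where f = "\<lambda>e. K ^ e"]) simp
    also have "\<dots> \<le> l ^ l" by (rule power_mono[OF K(2)]) simp
    finally have "(K ^ (8 * l))\<^sup>2 \<le> l ^ l" .
    moreover have "(l ^ (14 + d))\<^sup>2 \<le> l ^ l"
      unfolding power_mult[symmetric] by (rule power_increasing) (use l l1 in simp_all)
    ultimately have "(K ^ (8 * l) * l ^ (14 + d))\<^sup>2 \<le> (l ^ l)\<^sup>2"
      unfolding power_mult_distrib power2_eq_square[of "l ^ l"] by (rule mult_le_mono)
    then show "K ^ (8 * l) * l ^ (14 + d) \<le> l ^ l" by (simp add: power_mono_iff)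
  qed
  also have "\<dots> = l ^ (8 * l)"
    unfolding power_add[symmetric] by (rule arg_cong[where f = "\<lambda>e. l ^ e"]) simp
  finally show ?thesis .
qed

text \<open>The shift by 2 reflects that \<open>q\<close> can exceed the parameter by 2. The factor
  \<open>(8 * (l + 2)) ^ d\<close> stems from the polynomial part of the running time, where the
  number of digits enters as a loop bound.\<close>

lemma growth: "\<exists>C. \<forall>l :: nat. (128 * (l + 2)) ^ (7 * (l + 2)) * (8 * (l + 2)) ^ d \<le> C * l ^ (8 * l)"
proof -
  define f where "f l = (128 * (l + 2)) ^ (7 * (l + 2)) * (8 * (l + 2)) ^ d" for l :: nat
  \<comment> \<open>From here on \<open>growth_large\<close> applies with \<open>K = 256\<close>;
    the finitely many smaller values are summed into the constant.\<close>
  define L0 where "L0 = (256 :: nat) ^ 16 + 2 * (14 + d)"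
  have "f l \<le> (sum f {..<L0} + 1) * l ^ (8 * l)" for l
  proof (cases "l < L0")
    case True
    have "f l \<le> sum f {..<L0}" by (rule member_le_sum) (use True in auto)
    \<comment> \<open>This includes \<open>l = 0\<close>, where the power is
      \<open>0 ^ 0 = 1\<close>.\<close>
    moreover have "1 \<le> l ^ (8 * l)" by (cases l) simp_all
    then have "(sum f {..<L0} + 1) * 1 \<le> (sum f {..<L0} + 1) * l ^ (8 * l)" by (intro mult_left_mono) simp_all
    then have "sum f {..<L0} \<le> (sum f {..<L0} + 1) * l ^ (8 * l)" by simp
    ultimately show ?thesis by (rule order_trans)
  next
    case False
    then have "f l \<le> l ^ (8 * l)" unfolding f_def L0_def by (intro growth_large[of 256]) (simp_all del: power_numeral)
    also have "\<dots> \<le> (sum f {..<L0} + 1) * l ^ (8 * l)" by simp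
    finally show ?thesis .
  qed
  then show ?thesis unfolding f_def by blast
qed

theorem theorem8:
  shows "\<exists>(prog :: com) (c :: nat) (p :: nat poly).
    solves_UFGC_within prog (\<lambda>n k. c * (ell n k ^ (8 * ell n k) * poly p n))"
proof -
  obtain a d where tm1: "\<And>N. tm N UFGC_com \<le> a * (N + 1) ^ d" using tm_poly by blast
  obtain C where C: "\<And>l :: nat. (128 * (l + 2)) ^ (7 * (l + 2)) * (8 * (l + 2)) ^ d \<le> C * l ^ (8 * l)"
    using growth by blast
  define p where "p = [:1, 1 :: nat:] ^ d"
  have p: "poly p n = (n + 1) ^ d" for n unfolding p_def by (simp add: poly_power)
  have "solves_UFGC_within UFGC_com (\<lambda>n k. 3 * a * C * (ell n k ^ (8 * ell n k) * poly p n))"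
    unfolding solves_UFGC_within_def
  proof (intro allI impI)
    fix n :: nat and S U :: "nat set set" and k :: int assume fg: "flex_graph {..<n} S U"
    define q where "q = nat (2 * int n - 2 - k)"
    define N where "N = n + 7 * q"
    define l where "l = ell n k"
    obtain t s' where ex: "exec UFGC_com (instance_store n S U k) t s'"
        "t \<le> tm N UFGC_com + ((128 * q) ^ (7 * q) + 1) * tm N enum_com"
        "s' ''out'' 0 = (if UFGC {..<n} S U k then 1 else 0)"
      using UFGC_com_correct[OF fg, of k] unfolding slow_runs_def q_def[symmetric] N_def[symmetric] by blast
    have "tm N enum_com \<le> tm N UFGC_com" unfolding UFGC_com_def by simp
    then have "((128 * q) ^ (7 * q) + 1) * tm N enum_com \<le> ((128 * q) ^ (7 * q) + 1) * tm N UFGC_com"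
      by (rule mult_left_mono) simp
    then have "t \<le> ((128 * q) ^ (7 * q) + 2) * tm N UFGC_com" using ex(2) by simp
    also have "\<dots> \<le> (3 * (128 * (l + 2)) ^ (7 * (l + 2))) * (a * ((8 * (l + 2)) ^ d * (n + 1) ^ d))"
    proof (rule mult_mono)
      \<comment> \<open>Only an inequality, because both quantities are truncated at 0.\<close>
      have ql: "q \<le> l + 2" unfolding q_def l_def ell_def by linarith
      have "(128 * q) ^ (7 * q) \<le> (128 * (l + 2)) ^ (7 * q)" by (rule power_mono) (use ql in simp_all)
      also have "\<dots> \<le> (128 * (l + 2)) ^ (7 * (l + 2))" by (rule power_increasing) (use ql in simp_all)
      finally have "(128 * q) ^ (7 * q) \<le> (128 * (l + 2)) ^ (7 * (l + 2))" .
      moreover have "1 \<le> (128 * (l + 2)) ^ (7 * (l + 2))" by (rule one_le_power) simp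
      ultimately show "(128 * q) ^ (7 * q) + 2 \<le> 3 * (128 * (l + 2)) ^ (7 * (l + 2))" by linarith
      \<comment> \<open>A product instead of a sum, so that the \<open>d\<close>-th power splits
        into a factor in \<open>l\<close> for \<open>growth\<close> and a polynomial in
        \<open>n\<close>.\<close>
      have "N + 1 \<le> (8 * (l + 2)) * (n + 1)"
      proof -
        have "N + 1 \<le> n + 8 * (l + 2)" using ql unfolding N_def by presburger
        also have "\<dots> \<le> (8 * (l + 2)) * n + 8 * (l + 2)" by simp
        finally show ?thesis by (simp add: algebra_simps)
      qed
      then have "(N + 1) ^ d \<le> ((8 * (l + 2)) * (n + 1)) ^ d" by (rule power_mono) simp
      then have "a * (N + 1) ^ d \<le> a * ((8 * (l + 2)) ^ d * (n + 1) ^ d)"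
        unfolding power_mult_distrib by (rule mult_left_mono) simp
      with tm1[of N] show "tm N UFGC_com \<le> a * ((8 * (l + 2)) ^ d * (n + 1) ^ d)" by (rule order_trans)
    qed simp_all
    also have "\<dots> = 3 * a * ((128 * (l + 2)) ^ (7 * (l + 2)) * (8 * (l + 2)) ^ d) * (n + 1) ^ d"
      by (simp only: mult_ac)
    also have "\<dots> \<le> 3 * a * (C * l ^ (8 * l)) * (n + 1) ^ d"
      by (intro mult_right_mono mult_left_mono C) simp_all
    also have "\<dots> = 3 * a * C * (l ^ (8 * l) * poly p n)" unfolding p by (simp only: mult_ac)
    finally have "t \<le> 3 * a * C * (ell n k ^ (8 * ell n k) * poly p n)" unfolding l_def .
    then show "\<exists>t s'. exec UFGC_com (instance_store n S U k) t s' \<and>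
        t \<le> 3 * a * C * (ell n k ^ (8 * ell n k) * poly p n) \<and>
        s' ''out'' 0 = (if UFGC {..<n} S U k then 1 else 0)"
      using ex(1,3) by blast
  qed
  then show ?thesis by blast
qed

end
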